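(* Let $p<q<r$ be primes. Let $\alpha=\min\{q_p^*,\,p-q_p^*,\,r_p^*,\,p-r_p^*\}$ and let $\beta$ be the unique integer with $0<\beta\le p-1$ and $\alpha\beta qr\equiv1\pmod p$. Then for every integer $i$, $a_{pqr}(i)\le\min\{2\alpha+\beta,\ p-\beta,\ 2p/3\}$ and $-a_{pqr}(i)\le\min\{p+2\alpha-\beta,\ \beta,\ 2p/3\}$.
   Context: For a positive integer $n$, the $n$-th cyclotomic polynomial is written $\Phi_n(x)=\sum_{k=0}^{\varphi(n)}a_n(k)x^k$, and $a_n(k)=0$ for $k<0$ or $k>\varphi(n)$. For a prime $p$ and a prime $s\ne p$, $s_p^*$ denotes the unique integer in $[1,p-1]$ with $s\,s_p^*\equiv1\pmod p$. *)

theory Defs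
  imports
    Complex_Main
    "HOL-Computational_Algebra.Polynomial"
    "HOL-Number_Theory.Totient"
    "HOL-Number_Theory.Modular_Inverse"
begin

definition cyclotomic_complex :: "nat \<Rightarrow> complex poly" where
  "cyclotomic_complex n = (\<Prod>k\<in>totatives n. [:- cis (2 * pi * real k / real n), 1:])"

lemma degree_cyclotomic_complex: "degree (cyclotomic_complex n) = totient n"
  unfolding cyclotomic_complex_def totient_def by (subst degree_prod_eq_sum_degree) auto

lemma lead_coeff_cyclotomic_complex: "lead_coeff (cyclotomic_complex n) = 1"
  unfolding cyclotomic_complex_def by (simp add: lead_coeff_prod)

lemma prod_all_roots_unity:
  assumes "n > 0"
  shows "(\<Prod>k\<in>{0<..n}. [:- cis (2 * pi * real k / real n), 1:]) = monom 1 n - 1"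
proof -
  let ?f = "\<lambda>k. [:- cis (2 * pi * real k / real n), 1:]"
  have "cis (2 * pi * real n / real n) = cis (2 * pi * real 0 / real n)"
    using assms by simp
  hence "?f n = ?f 0" by simp
  have "{0<..n} = insert n {0<..<n}" "{..<n} = insert 0 {0<..<n}"
    using assms by auto
  hence "prod ?f {0<..n} = prod ?f {..<n}"
    using \<open>?f n = ?f 0\<close> by simp
  also have "\<dots> = (\<Prod>z | z ^ n = 1. [:- z, 1:])"
    by (rule prod.reindex_bij_betw[OF bij_betw_roots_unity[OF assms],
              where g = "\<lambda>z. [:- z, 1:]"])
  also have "\<dots> = monom 1 n - 1"
  proof (rule poly_eqI_degree_lead_coeff[where A = "{z. z ^ n = 1}" and n = n])
    have fin: "finite {z::complex. z ^ n = 1}"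
      using finite_roots_unity[of n] assms by simp
    have card: "card {z::complex. z ^ n = 1} = n"
      by (rule card_roots_unity_eq[OF assms])
    have deg: "degree (\<Prod>z | z ^ n = (1::complex). [:- z, 1:]) = n"
      by (subst degree_prod_eq_sum_degree) (auto simp: card)
    have "lead_coeff (\<Prod>z | z ^ n = (1::complex). [:- z, 1:]) = 1"
      by (simp add: lead_coeff_prod)
    thus "coeff (\<Prod>z | z ^ n = (1::complex). [:- z, 1:]) n = coeff (monom 1 n - 1) n"
      using assms by (simp add: deg)
    show "n \<le> card {z::complex. z ^ n = 1}" by (simp add: card)
    show "degree (\<Prod>z | z ^ n = (1::complex). [:- z, 1:]) \<le> n" by (simp add: deg)
    show "degree (monom 1 n - 1 :: complex poly) \<le> n"
      by (rule degree_diff_le) (auto simp: degree_monom_eq)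
    show "poly (\<Prod>z | z ^ n = (1::complex). [:- z, 1:]) z = poly (monom 1 n - 1) z"
      if "z \<in> {z. z ^ n = 1}" for z
      using that fin by (auto simp: poly_prod poly_monom prod_zero_iff)
  qed
  finally show ?thesis .
qed

lemma prod_cyclotomic_complex:
  assumes "n > 0"
  shows "(\<Prod>d | d dvd n. cyclotomic_complex d) = monom 1 n - 1"
proof -
  let ?f = "\<lambda>n k. [:- cis (2 * pi * real k / real n), 1:]"
  define A where "A = (\<lambda>d. {k\<in>{0<..n}. gcd k n = d})"
  have A: "prod (?f n) (A d) = cyclotomic_complex (n div d)" if "d dvd n" for d
  proof -
    have "d > 0" using that assms by (auto intro!: Nat.gr0I)
    have "prod (?f n) (A d) = (\<Prod>k\<in>totatives (n div d). ?f n (k * d))"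
      unfolding A_def
      by (rule prod.reindex_bij_betw[OF bij_betw_totatives_gcd_eq, symmetric])
         (use assms that in auto)
    also have "\<dots> = cyclotomic_complex (n div d)"
      unfolding cyclotomic_complex_def
      using \<open>d > 0\<close> that by (intro prod.cong refl) (auto simp: field_simps elim!: dvdE)
    finally show ?thesis .
  qed
  have fin: "finite {d. d dvd n}" using assms by simp
  have "{0<..n} = (\<Union>d\<in>{d. d dvd n}. A d)" by safe (auto simp: A_def)
  hence "monom 1 n - 1 = prod (?f n) (\<Union>d\<in>{d. d dvd n}. A d)"
    using prod_all_roots_unity[OF assms] by simp
  also have "\<dots> = (\<Prod>d | d dvd n. prod (?f n) (A d))"
    by (rule prod.UNION_disjoint[OF fin]) (auto simp: A_def)
  also have "\<dots> = (\<Prod>d | d dvd n. cyclotomic_complex (n div d))"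
    by (intro prod.cong refl A) auto
  also have "\<dots> = (\<Prod>d | d dvd n. cyclotomic_complex d)"
    using assms by (intro prod.reindex_bij_witness[of _ "(div) n" "(div) n"]) (auto elim: dvdE)
  finally show ?thesis ..
qed

lemma map_poly_of_int_mult:
  "map_poly of_int (p * q) = (map_poly of_int p * map_poly of_int q :: complex poly)"
  by (rule poly_eqI) (simp add: coeff_map_poly coeff_mult)

lemma map_poly_of_int_add:
  "map_poly of_int (p + q) = (map_poly of_int p + map_poly of_int q :: complex poly)"
  by (rule poly_eqI) (simp add: coeff_map_poly)

lemma map_poly_of_int_prod:
  "map_poly of_int (prod f A) = (\<Prod>x\<in>A. map_poly of_int (f x) :: complex poly)"
  by (induction A rule: infinite_finite_induct) (simp_all add: map_poly_of_int_mult)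

lemma map_poly_of_int_eq_iff:
  "map_poly of_int p = (map_poly of_int q :: complex poly) \<longleftrightarrow> p = q"
  by (auto simp: poly_eq_iff coeff_map_poly)

lemma degree_map_poly_of_int: "degree (map_poly of_int p :: complex poly) = degree p"
  by (rule degree_map_poly) auto

lemma int_poly_cofactor:
  fixes R :: "complex poly"
  assumes monic: "lead_coeff Q = 1"
    and eq: "map_poly of_int Q * R = map_poly of_int S"
  shows "\<exists>P. map_poly of_int P = R"
proof -
  have "Q \<noteq> 0" using monic by auto
  obtain A B where AB: "pseudo_divmod S Q = (A, B)" by fastforce
  have S: "S = Q * A + B" and B: "B = 0 \<or> degree B < degree Q"
    using pseudo_divmod[OF \<open>Q \<noteq> 0\<close> AB] monic by auto
  let ?h = "map_poly of_int :: int poly \<Rightarrow> complex poly"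
  have 1: "?h Q * (R - ?h A) = ?h B"
    using eq by (simp add: S map_poly_of_int_mult map_poly_of_int_add algebra_simps)
  have "R - ?h A = 0"
  proof (rule ccontr)
    assume nz: "R - ?h A \<noteq> 0"
    have "?h Q \<noteq> 0" using \<open>Q \<noteq> 0\<close> map_poly_of_int_eq_iff[of Q 0] by simp
    hence "?h B \<noteq> 0" and "degree (?h B) \<ge> degree (?h Q)"
      using nz unfolding 1[symmetric] by (auto simp: degree_mult_eq)
    thus False using B by (auto simp: degree_map_poly_of_int)
  qed
  thus ?thesis by auto
qed

lemma cyclotomic_complex_int:
  assumes "n > 0"
  shows "\<exists>P. map_poly of_int P = cyclotomic_complex n"
  using assms
proof (induction n rule: less_induct)
  case (less n)
  define D where "D = {d. d dvd n} - {n}"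
  have D: "finite D" "\<And>d. d \<in> D \<Longrightarrow> 0 < d \<and> d < n"
    using less.prems by (auto simp: D_def dvd_imp_le intro!: Nat.gr0I le_neq_trans)
  obtain P where P: "\<And>d. d \<in> D \<Longrightarrow> map_poly of_int (P d) = cyclotomic_complex d"
    using less.IH D(2) by metis
  define Q where "Q = prod P D"
  have hQ: "map_poly of_int Q = prod cyclotomic_complex D"
    by (simp add: Q_def map_poly_of_int_prod P)
  have "complex_of_int (lead_coeff Q) = lead_coeff (map_poly of_int Q :: complex poly)"
    by (simp only: degree_map_poly_of_int coeff_map_poly of_int_0)
  also have "\<dots> = 1"
    by (simp add: hQ lead_coeff_prod lead_coeff_cyclotomic_complex)
  finally have monic: "lead_coeff Q = 1" by simp
  have "{d. d dvd n} = insert n D" by (auto simp: D_def)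
  hence "monom 1 n - 1 = cyclotomic_complex n * prod cyclotomic_complex D"
    using prod_cyclotomic_complex[OF less.prems] D by (metis less_irrefl prod.insert)
  moreover have "map_poly of_int (monom 1 n - 1) = (monom 1 n - 1 :: complex poly)"
    by (rule poly_eqI) (simp add: coeff_map_poly)
  ultimately have "map_poly of_int Q * cyclotomic_complex n = map_poly of_int (monom 1 n - 1)"
    by (simp add: hQ mult.commute)
  thus ?case by (rule int_poly_cofactor[OF monic])
qed

definition cyclotomic :: "nat \<Rightarrow> int poly" where
  "cyclotomic n = (THE P. map_poly of_int P = cyclotomic_complex n)"

lemma map_poly_of_int_cyclotomic:
  assumes "n > 0"
  shows "map_poly of_int (cyclotomic n) = cyclotomic_complex n"
proof -
  from cyclotomic_complex_int[OF assms] obtain P where "map_poly of_int P = cyclotomic_complex n"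
    by blast
  thus ?thesis
    unfolding cyclotomic_def by (rule theI) (metis map_poly_of_int_eq_iff \<open>map_poly of_int P = _\<close>)
qed

lemma degree_cyclotomic: "n > 0 \<Longrightarrow> degree (cyclotomic n) = totient n"
  by (metis degree_cyclotomic_complex degree_map_poly_of_int map_poly_of_int_cyclotomic)

definition cyclotomic_coeff :: "nat \<Rightarrow> int \<Rightarrow> int" where
  "cyclotomic_coeff n k = (if k < 0 then 0 else coeff (cyclotomic n) (nat k))"

lemma cyclotomic_coeff_outside:
  "n > 0 \<Longrightarrow> k < 0 \<or> k > int (totient n) \<Longrightarrow> cyclotomic_coeff n k = 0"
  by (auto simp: cyclotomic_coeff_def degree_cyclotomic intro: coeff_eq_0)

text \<open>
  The inverse \<open>s\<^sub>p\<^sup>*\<close> is rendered by the library's \<^const>\<open>modular_inverse\<close>, with the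
  modulus as first argument. Its representative lies in \<open>{0..<p}\<close>; for a prime \<open>s \<noteq> p\<close> it is
  the unique inverse of \<open>s\<close> in \<open>{1..p - 1}\<close>.
\<close>

lemma modular_inverse_prime_unique:
  fixes p s :: nat
  assumes "prime p" "prime s" "s \<noteq> p"
  shows "modular_inverse (int p) (int s) \<in> {1..int p - 1} \<and>
         [int s * modular_inverse (int p) (int s) = 1] (mod int p)"
    and "\<And>t. t \<in> {1..int p - 1} \<Longrightarrow> [int s * t = 1] (mod int p) \<Longrightarrow>
         t = modular_inverse (int p) (int s)"
proof -
  have cop: "coprime (int s) (int p)"
    using assms by (simp add: primes_coprime)
  have p: "int p > 1" using prime_gt_1_nat[OF assms(1)] by simp
  show "modular_inverse (int p) (int s) \<in> {1..int p - 1} \<and>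
        [int s * modular_inverse (int p) (int s) = 1] (mod int p)"
    using mult_modular_inverse_int_pos[OF p cop] modular_inverse_int_less[of "int p" "int s"]
          cong_modular_inverse1[OF cop] p by auto
  show "t = modular_inverse (int p) (int s)"
    if "t \<in> {1..int p - 1}" "[int s * t = 1] (mod int p)" for t
    using modular_inverse_int_eqI[of t "int p" "int s"] that by simp
qed

end

theory Submission
  imports Defs
begin

text \<open>
  Writing \<open>m = x q r + y p r + z p q - p q r F\<close> with reduced residues \<open>x, y, z\<close>, the
  coefficient \<open>a\<^sub>p\<^sub>q\<^sub>r(n)\<close> is a sum over \<open>p\<close> consecutive \<open>m\<close> of a second difference of the
  indicator of \<open>F m = 0\<close>. Its summand is positive or negative only on zones of \<open>x\<close>, which
  for a suitable choice of signs of the two shifts have sizes given by \<open>\<alpha>\<close> and \<open>\<beta>\<close>. Counting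
  residues in the zones gives the bounds \<open>p - \<beta>\<close> and \<open>2\<alpha> + \<beta>\<close>. Where neither implies
  \<open>2p/3\<close>, the triples \<open>(x, y, z)\<close> perform a walk with constant steps on a torus, and every
  walk with too many positive summands contradicts the congruence relating its step
  to \<open>\<alpha>\<beta>\<close>.
\<close>

text \<open>Reversing the direction of the shift by \<open>q\<close> replaces its residue
  \<open>A\<close> by \<open>p - A\<close>, and likewise for \<open>r\<close> and \<open>B\<close>.
  The product of the two signs decides whether the coefficient or its negative is bounded. For each
  product one of the two sign choices has \<open>A + B <= p\<close>; then \<open>min A B\<close> is
  \<alpha> and \<open>max A B\<close> is \<beta> or \<open>p - \<beta>\<close>. In the case left for
  \<open>2p/3\<close>, \<open>max A B\<close> is below \<open>p/3\<close>, so an excess would need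
  more than \<open>p/3\<close> summands with \<open>F = 2\<close>, all in a small box of the
  \<open>(y, z)\<close> torus. The step of the walk is unknown, so it is compared with the box: too
  long for two consecutive visits, short in both coordinates, or, after reversing time, short in one
  while the other moves backwards. Each case pairs positive times with non-positive ones, and each
  pairing falls short by one or two times. Only nearly extremal configurations survive, and these
  are excluded residue by residue. The congruence is decisive for just one of them: a long step with
  \<open>p = 3k + 1\<close> and \<open>a = b = k\<close>.\<close>

lemma min_complement_cases:
  fixes p Q R :: int
  assumes "0 < Q" "Q < p" "0 < R" "R < p"
  shows "R + Q \<le> p \<Longrightarrow> min Q (min (p - Q) (min R (p - R))) = min R Q"
    and "\<not> R + Q \<le> p \<Longrightarrow> min Q (min (p - Q) (min R (p - R))) = min (p - R) (p - Q)"
    and "R \<le> Q \<Longrightarrow> min Q (min (p - Q) (min R (p - R))) = min R (p - Q)"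
    and "\<not> R \<le> Q \<Longrightarrow> min Q (min (p - Q) (min R (p - R))) = min (p - R) Q"
  using assms by presburger+

lemma int_less_of_mult_less:
  fixes k n :: int and P :: real
  assumes "P * of_int k < P * of_int n" "P > 0"
  shows "k < n"
  using assms by simp

text \<open>Points in the box have \<open>x\<close> in an open interval of length
  \<open>a + b\<close> whose left end is real. This converts that interval into a count without
  losing one at the ends.\<close>

lemma card_int_open_le:
  fixes u :: real and n :: nat
  shows "finite {t::int. u < of_int t \<and> of_int t < u + real n}"
    and "card {t::int. u < of_int t \<and> of_int t < u + real n} \<le> n"
proof -
  have sub: "{t::int. u < of_int t \<and> of_int t < u + real n} \<subseteq> {\<lfloor>u\<rfloor> + 1..\<lfloor>u\<rfloor> + int n}"
  proof
    fix t :: int assume "t \<in> {t. u < of_int t \<and> of_int t < u + real n}"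
    hence t: "u < of_int t" "of_int t < u + real n" by auto
    have "\<lfloor>u\<rfloor> < t" using t(1) by (simp add: floor_less_iff)
    moreover have "of_int (t - int n) < u" using t(2) by simp
    hence "t - int n \<le> \<lfloor>u\<rfloor>" by (simp only: le_floor_iff less_imp_le)
    ultimately show "t \<in> {\<lfloor>u\<rfloor> + 1..\<lfloor>u\<rfloor> + int n}" by simp
  qed
  thus "finite {t::int. u < of_int t \<and> of_int t < u + real n}" by (rule finite_subset) simp
  have "card {t::int. u < of_int t \<and> of_int t < u + real n} \<le> card {\<lfloor>u\<rfloor> + 1..\<lfloor>u\<rfloor> + int n}"
    by (rule card_mono[OF _ sub]) simp
  thus "card {t::int. u < of_int t \<and> of_int t < u + real n} \<le> n" by simp
qed

section \<open>Walks on a torus: zones, laps and the consequences of an excess\<close>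

locale walk =
  fixes p :: nat and a b :: int and c d :: real and x F :: "nat \<Rightarrow> int" and Y Z :: "nat \<Rightarrow> real" and \<nu> :: real
  assumes prime_p: "prime p" and a_pos: "0 < a" and a_le_b: "a \<le> b" and b_small: "3 * b < int p"
    and c_le: "c \<le> of_int b" and d_le: "d \<le> of_int b" and cd: "c + d = of_int (a + b)"
    and region: "2 * int p < 3 * (2 * a + b)"
    and x_range: "\<And>j. j < p \<Longrightarrow> 0 \<le> x j \<and> x j < int p"
    and Y_range: "\<And>j. j < p \<Longrightarrow> 0 < Y j \<and> Y j \<le> real p"
    and Z_range: "\<And>j. j < p \<Longrightarrow> 0 < Z j \<and> Z j \<le> real p"
    and F_nonneg: "\<And>j. j < p \<Longrightarrow> 0 \<le> F j"
    and balance: "\<And>j. j < p \<Longrightarrow> Y j + Z j = of_int (x j) - \<nu> + real p * of_int (2 - F j)"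
begin

text \<open>In the application \<open>a = min A B\<close> and \<open>b = max A B\<close>, while
  \<open>c\<close> and \<open>d\<close> are \<open>B\<close> and \<open>A\<close>, whence
  \<open>c + d = a + b\<close>. \<open>b_small\<close> and \<open>region\<close> say that neither
  \<open>p - b\<close> nor \<open>2a + b\<close> settles the bound. \<open>P0\<close>,
  \<open>P1\<close>, \<open>P2\<close> carry the possible positive summands, \<open>Neg\<close>
  carries negative ones, and \<open>Y j < c\<close>, \<open>Z j < d\<close> describes the
  box.\<close>

definition P0 :: "nat set" where "P0 = {j. j < p \<and> x j < a \<and> F j = 0}"
definition P1 :: "nat set" where "P1 = {j. j < p \<and> x j < a \<and> F j = 1 \<and> Y j < c \<and> Z j < d}"
definition P2 :: "nat set" where "P2 = {j. j < p \<and> a + b \<le> x j \<and> F j = 2 \<and> Y j < c \<and> Z j < d}"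
definition Neg :: "nat set" where
  "Neg = {j. j < p \<and> b \<le> x j \<and> x j < a + b \<and> (F j = 0 \<or> F j = 1 \<and> (Y j < c \<or> Z j < d))}"
definition Bad :: "nat set" where "Bad = {..<p} - (P0 \<union> P1 \<union> P2)"

definition bounded :: bool where
  "bounded \<longleftrightarrow> 3 * (card P0 + card P1 + card P2) \<le> 2 * p + 3 * card Neg"

text \<open>\<open>Y\<close> and \<open>Z\<close> live on a real circle of length \<open>p\<close>,
  so congruence is expressed by an explicit integer multiple. Coprimality of \<open>w\<close> and
  \<open>p\<close> makes \<open>x\<close> visit each residue exactly once.\<close>

definition moves :: "int \<Rightarrow> real \<Rightarrow> real \<Rightarrow> bool" where
  "moves w \<eta> \<zeta> \<longleftrightarrow> of_int w = \<eta> + \<zeta> \<and> coprime w (int p) \<and>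
     (\<forall>j<p. (\<exists>k. x j = x 0 + int j * w - int p * k) \<and>
            (\<exists>k::int. Y j = Y 0 + real j * \<eta> - real p * of_int k) \<and>
            (\<exists>k::int. Z j = Z 0 + real j * \<zeta> - real p * of_int k))"

lemma p_ge: "p > 6"
proof -
  have "3 * (2 * a + b) \<le> 9 * b" using a_le_b by simp
  hence "2 * int p < 9 * b" using region by linarith
  moreover have "3 * b < int p" by (rule b_small)
  ultimately have "int p > 6 \<or> int p = 4" by presburger
  moreover have "p \<noteq> 4"
  proof
    assume "p = 4"
    hence "2 dvd p" "p \<noteq> 2" by simp_all
    thus False using prime_p by (metis primes_dvd_imp_eq two_is_prime_nat)
  qed
  ultimately show ?thesis by linarith
qed

lemma c_ge: "of_int a \<le> c" and d_ge: "of_int a \<le> d"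
  using c_le d_le cd by simp_all

lemma c_pos: "0 < c" and d_pos: "0 < d"
  using c_ge d_ge a_pos by linarith+

lemma c_small: "3 * c < real p" and d_small: "3 * d < real p"
proof -
  have "real_of_int (3 * b) < real_of_int (int p)" using b_small by (simp only: of_int_less_iff)
  thus "3 * c < real p" "3 * d < real p" using c_le d_le by simp_all
qed

lemma finite_sets [simp]: "finite P0" "finite P1" "finite P2" "finite Neg" "finite Bad"
  by (simp_all add: P0_def P1_def P2_def Neg_def Bad_def)

text \<open>Lap counters for the three coordinates. Subtracting \<open>balance\<close> at 0 from
  \<open>balance\<close> at \<open>j\<close>, the linear parts cancel because
  \<open>w = \<eta> + \<zeta>\<close>: \<open>F\<close> rises with each lap of \<open>Y\<close> or
  \<open>Z\<close> and falls with each lap of \<open>x\<close>.\<close>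

lemma movesE:
  assumes "moves w \<eta> \<zeta>"
  obtains fx fy fz :: "nat \<Rightarrow> int"
  where "\<And>j. j < p \<Longrightarrow> x j = x 0 + int j * w - int p * fx j"
    and "\<And>j. j < p \<Longrightarrow> Y j = Y 0 + real j * \<eta> - real p * of_int (fy j)"
    and "\<And>j. j < p \<Longrightarrow> Z j = Z 0 + real j * \<zeta> - real p * of_int (fz j)"
    and "\<And>j. j < p \<Longrightarrow> F j = F 0 + fy j + fz j - fx j"
    and "fx 0 = 0" "fy 0 = 0" "fz 0 = 0"
proof -
  have w: "of_int w = \<eta> + \<zeta>" using assms by (simp add: moves_def)
  have p0: "0 < p" using p_ge by simp
  obtain fx fy fz :: "nat \<Rightarrow> int" where
    f: "\<And>j. j < p \<Longrightarrow> x j = x 0 + int j * w - int p * fx j"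
       "\<And>j. j < p \<Longrightarrow> Y j = Y 0 + real j * \<eta> - real p * of_int (fy j)"
       "\<And>j. j < p \<Longrightarrow> Z j = Z 0 + real j * \<zeta> - real p * of_int (fz j)"
    using assms unfolding moves_def by metis
  have "F j = F 0 + fy j + fz j - fx j" if j: "j < p" for j
  proof -
    have xj: "real_of_int (x j) = of_int (x 0) + real j * of_int w - real p * of_int (fx j)"
      by (subst f(1)[OF j]) simp
    have "real p * of_int (2 - F j) - real p * of_int (2 - F 0) =
          (Y j - Y 0) + (Z j - Z 0) - (of_int (x j) - of_int (x 0))"
      using balance[OF j] balance[OF p0] by linarith
    also have "\<dots> = real p * of_int (fx j - fy j - fz j)"
      using f(2,3)[OF j] xj w by (simp add: algebra_simps)
    finally have "real p * of_int (F 0 - F j) = real p * of_int (fx j - fy j - fz j)"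
      by (simp add: algebra_simps)
    hence "F 0 - F j = fx j - fy j - fz j" using p0 by (metis mult_cancel_left of_int_eq_iff of_nat_0_less_iff less_irrefl)
    thus ?thesis by simp
  qed
  moreover have "fx 0 = 0" "fy 0 = 0" "fz 0 = 0" using f[OF p0] p0 by auto
  ultimately show ?thesis by (intro that[of fx fy fz]) (use f in blast)+
qed

lemma diffE:
  assumes "moves w \<eta> \<zeta>" "i < p" "j < p"
  obtains kx ky kz :: int
  where "x j = x i + (int j - int i) * w - int p * kx"
    and "Y j = Y i + (real j - real i) * \<eta> - real p * of_int ky"
    and "Z j = Z i + (real j - real i) * \<zeta> - real p * of_int kz"
    and "F j = F i + ky + kz - kx"
proof -
  obtain fx fy fz :: "nat \<Rightarrow> int"
  where f: "\<And>j. j < p \<Longrightarrow> x j = x 0 + int j * w - int p * fx j"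
    "\<And>j. j < p \<Longrightarrow> Y j = Y 0 + real j * \<eta> - real p * of_int (fy j)"
    "\<And>j. j < p \<Longrightarrow> Z j = Z 0 + real j * \<zeta> - real p * of_int (fz j)"
    "\<And>j. j < p \<Longrightarrow> F j = F 0 + fy j + fz j - fx j"
    using movesE[OF assms(1)] by metis
  show ?thesis
    by (rule that[of "fx j - fx i" "fy j - fy i" "fz j - fz i"])
       (use f[OF assms(2)] f[OF assms(3)] in \<open>simp_all add: algebra_simps\<close>)
qed

lemma bij_x:
  assumes "moves w \<eta> \<zeta>"
  shows "bij_betw x {..<p} {0..<int p}"
proof -
  have "inj_on x {..<p}"
  proof (rule inj_onI)
    fix i j assume ij: "i \<in> {..<p}" "j \<in> {..<p}" "x i = x j"
    obtain k where "x j = x i + (int j - int i) * w - int p * k"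
      using diffE[OF assms, of i j] ij by blast
    hence "(int j - int i) * w = int p * k" using ij(3) by simp
    hence "int p dvd (int j - int i) * w" by simp
    hence "int p dvd int j - int i"
      using assms coprime_dvd_mult_left_iff[of "int p" w] by (simp add: moves_def coprime_commute)
    moreover have "\<bar>int j - int i\<bar> < int p" using ij by auto
    ultimately have "int j - int i = 0" using dvd_imp_le_int[of "int j - int i" "int p"] by fastforce
    thus "i = j" by simp
  qed
  moreover have "x ` {..<p} \<subseteq> {0..<int p}" using x_range by auto
  moreover have "card (x ` {..<p}) = card {0..<int p}" using card_image[OF \<open>inj_on x {..<p}\<close>] by simp
  ultimately show ?thesis unfolding bij_betw_def
    by (metis card_subset_eq finite_atLeastLessThan_int)
qed

lemma card_x:
  assumes "moves w \<eta> \<zeta>" "S \<subseteq> {0..<int p}"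
  shows "card {j. j < p \<and> x j \<in> S} = card S"
proof (rule bij_betw_same_card)
  have "x ` {j. j < p \<and> x j \<in> S} = S"
    using bij_x[OF assms(1)] assms(2) unfolding bij_betw_def by (auto simp: image_iff)
  thus "bij_betw x {j. j < p \<and> x j \<in> S} S"
    using bij_x[OF assms(1)] unfolding bij_betw_def by (auto intro: inj_on_subset)
qed

lemma x_surj:
  assumes "moves w \<eta> \<zeta>" "0 \<le> t" "t < int p"
  obtains j where "j < p" "x j = t"
proof -
  have "t \<in> x ` {..<p}" using bij_x[OF assms(1)] assms(2,3) by (simp add: bij_betw_def)
  thus ?thesis using that by auto
qed

lemma x_inj:
  assumes "moves w \<eta> \<zeta>" "i < p" "j < p" "x i = x j"
  shows "i = j"
  using bij_x[OF assms(1)] assms(2-4) by (auto simp: bij_betw_def inj_on_def)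

lemma disjoint_sets: "P0 \<inter> P1 = {}" "P0 \<inter> P2 = {}" "P1 \<inter> P2 = {}"
  by (auto simp: P0_def P1_def P2_def)

lemma card_partition: "card Bad + card P0 + card P1 + card P2 = p"
proof -
  have "P0 \<union> P1 \<union> P2 \<subseteq> {..<p}" by (auto simp: P0_def P1_def P2_def)
  moreover have "card (P0 \<union> P1 \<union> P2) = card P0 + card P1 + card P2"
    using disjoint_sets by (subst card_Un_disjoint, simp, simp, blast)+ simp
  moreover have "card (P0 \<union> P1 \<union> P2) \<le> p" using card_mono[OF _ calculation(1)] by simp
  ultimately show ?thesis unfolding Bad_def by (subst card_Diff_subset) auto
qed

text \<open>Since \<open>x\<close> is a bijection onto the residues, a zone holds at most as many
  times as it has residues. The \<open>b\<close> residues from \<open>a\<close> to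
  \<open>a + b - 1\<close> carry no positive summand at all.\<close>

lemma card_low: 
  assumes "moves w \<eta> \<zeta>"
  shows "int (card P0 + card P1) \<le> a" "int (card Bad + card P0 + card P1) \<ge> a + b" "int (card P2) \<le> int p - a - b"
    and "{j. j < p \<and> a \<le> x j \<and> x j < a + b} \<subseteq> Bad" "card {j. j < p \<and> a \<le> x j \<and> x j < a + b} = nat b"
proof -
  have un: "card (P0 \<union> P1) = card P0 + card P1" using disjoint_sets by (simp add: card_Un_disjoint)
  have "card (P0 \<union> P1) \<le> card {j. j < p \<and> x j \<in> {0..<a}}"
    by (rule card_mono) (use x_range in \<open>auto simp: P0_def P1_def\<close>)
  also have "\<dots> = card {0..<a}" by (rule card_x[OF assms]) (use a_le_b b_small a_pos in auto)
  finally show "int (card P0 + card P1) \<le> a" using un a_pos by simp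
  have "card {j. j < p \<and> x j \<in> {0..<a + b}} \<le> card (Bad \<union> (P0 \<union> P1))"
    by (rule card_mono) (auto simp: P0_def P1_def P2_def Bad_def)
  also have "\<dots> \<le> card Bad + (card P0 + card P1)" using card_Un_le[of Bad "P0 \<union> P1"] un by simp
  also have "card {j. j < p \<and> x j \<in> {0..<a + b}} = card {0..<a + b}"
    by (rule card_x[OF assms]) (use a_le_b b_small a_pos in auto)
  finally show "int (card Bad + card P0 + card P1) \<ge> a + b" using a_pos a_le_b by simp
  have "card P2 \<le> card {j. j < p \<and> x j \<in> {a + b..<int p}}"
    by (rule card_mono) (use x_range in \<open>auto simp: P2_def\<close>)
  also have "\<dots> = card {a + b..<int p}" by (rule card_x[OF assms]) (use a_le_b b_small a_pos in auto)
  finally show "int (card P2) \<le> int p - a - b" using b_small a_le_b a_pos by simp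
  show "{j. j < p \<and> a \<le> x j \<and> x j < a + b} \<subseteq> Bad" by (auto simp: P0_def P1_def P2_def Bad_def)
  have "card {j. j < p \<and> x j \<in> {a..<a + b}} = card {a..<a + b}"
    by (rule card_x[OF assms]) (use a_le_b b_small a_pos in auto)
  thus "card {j. j < p \<and> a \<le> x j \<and> x j < a + b} = nat b" by simp
qed

text \<open>Common start of the three contradictions, with \<open>k = (p - 1) div 3\<close>. An
  excess leaves fewer than \<open>p/3\<close> times for \<open>Bad\<close> and \<open>Neg\<close>
  together, and \<open>P0\<close>, \<open>P1\<close> have at most \<open>a <= k\<close> residues, so
  \<open>P2\<close> must hold the rest. A prime above 6 is not a multiple of 3.\<close>

lemma excess:
  assumes "moves w \<eta> \<zeta>" "\<not> bounded"
  obtains k :: int where "int p = 3 * k + 1 \<or> int p = 3 * k + 2" "2 \<le> k" "b \<le> k"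
    "int (card Bad) + int (card Neg) \<le> k" "k + 1 \<le> int (card P2)"
proof -
  define k where "k = (int p - 1) div 3"
  have u: "3 * (int (card P0) + int (card P1) + int (card P2)) > 2 * int p + 3 * int (card Neg)"
    using assms(2) unfolding bounded_def by (simp add: not_le)
  have s: "int (card Bad) + int (card P0) + int (card P1) + int (card P2) = int p"
    using card_partition by linarith
  have l: "int (card P0) + int (card P1) \<le> a" using card_low(1)[OF assms(1)] by simp
  have 1: "3 * (int (card Bad) + int (card Neg)) < int p" using u s by presburger
  have 4: "3 * k < int p" "int p \<le> 3 * k + 3" unfolding k_def by linarith+
  have "u \<le> k" if "3 * u < int p" for u using that 4(2) by simp
  hence 2: "b \<le> k" "int (card Bad) + int (card Neg) \<le> k" using 1 b_small by simp_all
  have 3: "2 \<le> k" using p_ge 4 by linarith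
  have 5: "3 * k + 1 \<noteq> int p \<Longrightarrow> int p = 3 * k + 2 \<or> int p = 3 * k + 3" using 4 by linarith
  have 6: "int p \<noteq> 3 * k + 3"
  proof
    assume "int p = 3 * k + 3"
    hence "p mod 3 = 0" by presburger
    hence "3 dvd p" by (simp add: mod_eq_0_iff_dvd)
    hence "3 = p" using prime_p unfolding prime_nat_iff by fastforce
    thus False using p_ge by simp
  qed
  have 7: "k + 1 \<le> int (card P2)" using s l 2 4 a_le_b by linarith
  show ?thesis using that[of k] 2 3 5 6 7 by metis
qed

lemma movesI:
  assumes "of_int w = \<eta> + \<zeta>" "coprime w (int p)"
    "\<And>j. j < p \<Longrightarrow> \<exists>k. x j = x 0 + int j * w - int p * k"
    "\<And>j. j < p \<Longrightarrow> \<exists>k::int. Y j = Y 0 + real j * \<eta> - real p * of_int k"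
    "\<And>j. j < p \<Longrightarrow> \<exists>k::int. Z j = Z 0 + real j * \<zeta> - real p * of_int k"
  shows "moves w \<eta> \<zeta>"
  using assms unfolding moves_def by blast

text \<open>Only the steps modulo \<open>p\<close> matter; this frees the choice of their
  representatives.\<close>

lemma moves_shift:
  assumes "moves w \<eta> \<zeta>"
  shows "moves (w + int p * (m + n)) (\<eta> + real p * of_int m) (\<zeta> + real p * of_int n)"
proof -
  obtain fx fy fz :: "nat \<Rightarrow> int"
  where f: "\<And>j. j < p \<Longrightarrow> x j = x 0 + int j * w - int p * fx j"
    "\<And>j. j < p \<Longrightarrow> Y j = Y 0 + real j * \<eta> - real p * of_int (fy j)"
    "\<And>j. j < p \<Longrightarrow> Z j = Z 0 + real j * \<zeta> - real p * of_int (fz j)"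
    using movesE[OF assms] by metis
  have w: "of_int w = \<eta> + \<zeta>" and cop: "coprime w (int p)" using assms by (simp_all add: moves_def)
  show ?thesis
  proof (rule movesI)
    show "of_int (w + int p * (m + n)) = \<eta> + real p * of_int m + (\<zeta> + real p * of_int n)"
      using w by (simp add: algebra_simps)
    show "coprime (w + int p * (m + n)) (int p)"
      using cop by (metis coprime_iff_gcd_eq_1 gcd_add_mult gcd.commute mult.commute add.commute)
    fix j assume j: "j < p"
    show "\<exists>k. x j = x 0 + int j * (w + int p * (m + n)) - int p * k"
      by (rule exI[of _ "fx j + int j * (m + n)"], subst f(1)[OF j]) (simp add: algebra_simps)
    show "\<exists>k. Y j = Y 0 + real j * (\<eta> + real p * of_int m) - real p * real_of_int k"
      by (rule exI[of _ "fy j + int j * m"], subst f(2)[OF j]) (simp add: algebra_simps)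
    show "\<exists>k. Z j = Z 0 + real j * (\<zeta> + real p * of_int n) - real p * real_of_int k"
      by (rule exI[of _ "fz j + int j * n"], subst f(3)[OF j]) (simp add: algebra_simps)
  qed
qed

text \<open>Positive steps whose sum is below \<open>p\<close> make no coordinate go backwards and
  let each wrap at most once.\<close>

lemma stepE:
  assumes "moves \<omega> \<theta> \<zeta>" "0 < \<theta>" "0 < \<zeta>" "\<omega> < int p" "Suc j < p"
  obtains kx ky kz :: int
  where "x (Suc j) = x j + \<omega> - int p * kx" "Y (Suc j) = Y j + \<theta> - real p * of_int ky"
    "Z (Suc j) = Z j + \<zeta> - real p * of_int kz" "F (Suc j) = F j + ky + kz - kx"
    "kx \<in> {0, 1}" "ky \<in> {0, 1}" "kz \<in> {0, 1}"
proof -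
  have j: "j < p" using assms(5) by simp
  have w: "of_int \<omega> = \<theta> + \<zeta>" using assms(1) by (simp add: moves_def)
  have w': "real_of_int \<omega> < real p" using assms(4) by (metis of_int_less_iff of_int_of_nat_eq)
  have P: "real p > 0" using p_ge by simp
  obtain kx ky kz where k: "x (Suc j) = x j + (int (Suc j) - int j) * \<omega> - int p * kx"
    "Y (Suc j) = Y j + (real (Suc j) - real j) * \<theta> - real p * of_int ky"
    "Z (Suc j) = Z j + (real (Suc j) - real j) * \<zeta> - real p * of_int kz" "F (Suc j) = F j + ky + kz - kx"
    using diffE[OF assms(1) j assms(5)] by metis
  have kY: "Y (Suc j) = Y j + \<theta> - real p * of_int ky" and kZ: "Z (Suc j) = Z j + \<zeta> - real p * of_int kz"
    using k(2,3) by simp_all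
  have "real p * of_int kx < real p * of_int 2" "real p * of_int (- 1) < real p * of_int kx"
  proof -
    have xs: "real_of_int (x (Suc j)) = of_int (x j) + of_int \<omega> - real p * of_int kx"
      by (subst k(1)) simp
    have r: "0 \<le> real_of_int (x j)" "real_of_int (x j) < real p" "0 \<le> real_of_int (x (Suc j))"
      "real_of_int (x (Suc j)) < real p"
      using x_range[OF j] x_range[OF assms(5)] by (simp_all add: of_int_less_iff[where ?'a = real, symmetric])
    show "real p * of_int kx < real p * of_int 2" using xs r w w' assms(2,3) by linarith
    show "real p * of_int (- 1) < real p * of_int kx" using xs r w w' assms(2,3) by linarith
  qed
  hence kx: "kx < 2" "- 1 < kx" using int_less_of_mult_less[OF _ P] by blast+
  have "real p * of_int ky < real p * of_int 2" "real p * of_int (- 1) < real p * of_int ky"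
    using kY Y_range[OF j] Y_range[OF assms(5)] w w' assms(2,3) by linarith+
  hence ky: "ky < 2" "- 1 < ky" using int_less_of_mult_less[OF _ P] by blast+
  have "real p * of_int kz < real p * of_int 2" "real p * of_int (- 1) < real p * of_int kz"
    using kZ Z_range[OF j] Z_range[OF assms(5)] w w' assms(2,3) by linarith+
  hence kz: "kz < 2" "- 1 < kz" using int_less_of_mult_less[OF _ P] by blast+
  show ?thesis by (rule that[of kx ky kz]) (use k kx ky kz in auto)
qed

end

section \<open>Long steps: the box is never visited twice in a row\<close>

context walk
begin

lemma full_high:
  assumes "moves w \<eta> \<zeta>" "int (card P2) = int p - a - b" "j < p" "a + b \<le> x j"
  shows "j \<in> P2"
proof -
  have "P2 = {j. j < p \<and> a + b \<le> x j}"
  proof (rule card_subset_eq)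
    have "{j. j < p \<and> a + b \<le> x j} = {j. j < p \<and> x j \<in> {a + b..<int p}}" using x_range by auto
    also have "card \<dots> = card {a + b..<int p}" by (rule card_x[OF assms(1)]) (use a_pos a_le_b in auto)
    also have "\<dots> = card P2" using assms(2) by simp
    finally show "card P2 = card {j. j < p \<and> a + b \<le> x j}" ..
  qed (auto simp: P2_def)
  thus ?thesis using assms by blast
qed

lemma full_low:
  assumes "moves w \<eta> \<zeta>" "int (card P0) + int (card P1) = a" "j < p" "x j < a"
  shows "j \<in> P0 \<union> P1"
proof -
  have "P0 \<union> P1 = {j. j < p \<and> x j < a}"
  proof (rule card_subset_eq)
    have "{j. j < p \<and> x j < a} = {j. j < p \<and> x j \<in> {0..<a}}" using x_range by auto
    also have "card \<dots> = card {0..<a}" by (rule card_x[OF assms(1)]) (use b_small a_pos a_le_b in auto)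
    also have "\<dots> = card P0 + card P1" using assms(2) by simp
    also have "\<dots> = card (P0 \<union> P1)" using disjoint_sets by (simp add: card_Un_disjoint)
    finally show "card (P0 \<union> P1) = card {j. j < p \<and> x j < a}" ..
  qed (auto simp: P0_def P1_def)
  thus ?thesis using assms by blast
qed

text \<open>In at least one coordinate the step carries every point of the box out of it, so no two
  consecutive times are in the box. \<open>F\<close> falls by at most one per step, hence the
  successor of a \<open>P2\<close> time is in \<open>Bad\<close>, and \<open>P2\<close> exceeds
  \<open>Bad\<close> by at most one. Together with \<open>excess\<close> this leaves one extremal
  configuration with two possible steps, \<open>2k + 1\<close> and \<open>2k\<close>.\<close>

lemma bounded_if_large_step:
  assumes m: "moves \<omega> \<theta> \<zeta>" and pos: "0 < \<theta>" "0 < \<zeta>" "\<omega> < int p"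
    and large: "\<not> ((\<theta> < c \<or> real p - c < \<theta>) \<and> (\<zeta> < d \<or> real p - d < \<zeta>))"
    and ab: "[\<omega> = a * b] (mod int p) \<or> [\<omega> = - (a * b)] (mod int p)"
  shows bounded
proof (rule ccontr)
  assume "\<not> bounded"
  then obtain k where k: "int p = 3 * k + 1 \<or> int p = 3 * k + 2" "2 \<le> k" "b \<le> k"
    "int (card Bad) + int (card Neg) \<le> k" "k + 1 \<le> int (card P2)"
    using excess[OF m] by metis
  have w: "of_int \<omega> = \<theta> + \<zeta>" using m by (simp add: moves_def)
  have no_pair: "\<not> (Y j < c \<and> Z j < d \<and> Y (Suc j) < c \<and> Z (Suc j) < d)" if j: "Suc j < p" for j
  proof
    assume T: "Y j < c \<and> Z j < d \<and> Y (Suc j) < c \<and> Z (Suc j) < d"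
    obtain kx ky kz where s: "Y (Suc j) = Y j + \<theta> - real p * of_int ky"
      "Z (Suc j) = Z j + \<zeta> - real p * of_int kz" "ky \<in> {0, 1}" "kz \<in> {0, 1::int}"
      using stepE[OF m pos j] by metis
    have "0 < Y j" "0 < Z j" "0 < Y (Suc j)" "0 < Z (Suc j)"
      using Y_range[OF j] Y_range[of j] Z_range[OF j] Z_range[of j] j by simp_all
    hence "\<theta> < c \<or> real p - c < \<theta>" "\<zeta> < d \<or> real p - d < \<zeta>" using s T by auto
    thus False using large by blast
  qed
  have succ_bad: "Suc j \<in> Bad" if j: "j \<in> P2" "Suc j < p" for j
  proof -
    obtain kx ky kz where s: "F (Suc j) = F j + ky + kz - kx" "kx \<in> {0, 1}" "ky \<in> {0, 1}" "kz \<in> {0, 1::int}"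
      using stepE[OF m pos j(2)] by metis
    have "F (Suc j) \<noteq> 0" using s j(1) by (auto simp: P2_def)
    thus ?thesis using no_pair[OF j(2)] j by (auto simp: Bad_def P0_def P1_def P2_def)
  qed
  define D where "D = Suc ` (P2 - {p - 1})"
  have D: "D \<subseteq> Bad"
  proof
    fix j assume "j \<in> D"
    then obtain i where "j = Suc i" "i \<in> P2" "i \<noteq> p - 1" by (auto simp: D_def)
    thus "j \<in> Bad" using succ_bad[of i] by (auto simp: P2_def)
  qed
  have cD: "card D = card (P2 - {p - 1})" unfolding D_def by (rule card_image) simp
  have cD1: "card P2 \<le> card D + 1" "p - 1 \<notin> P2 \<Longrightarrow> card D = card P2"
    unfolding cD by (auto simp: card_Diff_singleton_if)
  have DB: "card D \<le> card Bad" by (rule card_mono[OF _ D]) simp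
  have part: "int (card Bad) + int (card P0) + int (card P1) + int (card P2) = int p"
    using card_partition by linarith
  have low: "int (card P0) + int (card P1) \<le> a" "int (card Bad) + int (card P0) + int (card P1) \<ge> a + b"
    using card_low[OF m] by simp_all
  \<comment> \<open>No inequality has any slack left. The one element by which \<open>P2\<close>
    exceeds \<open>Bad\<close> is the time without a successor, so \<open>p - 1\<close> lies in
    \<open>P2\<close>.\<close>
  have eqs: "a = k" "b = k" "int p = 3 * k + 1" "int (card Bad) = k" "card D = card Bad"
    "int (card P2) = k + 1" "int (card P0) + int (card P1) = k" "p - 1 \<in> P2"
    using part low k cD1 DB a_le_b by linarith+
  have BadD: "Bad = D" using card_subset_eq[OF _ D eqs(5)] finite_sets(5) by blast
  have BadB: "Bad = {j. j < p \<and> a \<le> x j \<and> x j < a + b}"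
    by (rule card_subset_eq[OF _ card_low(4)[OF m], symmetric]) (use card_low(5)[OF m] eqs finite_sets(5) in auto)
  have highP2: "j \<in> P2" if "j < p" "2 * k \<le> x j" for j
    using full_high[OF m _ that(1)] that eqs by auto
  have P2_hi: "2 * k \<le> x i" "x i < int p" "i < p" if "i \<in> P2" for i
    using that eqs(1,2) x_range[of i] unfolding P2_def by simp_all
  have lowP: "j \<in> P0 \<union> P1" if "j < p" "x j < k" for j
    using full_low[OF m _ that(1)] that eqs by auto
  \<comment> \<open>Every middle residue is entered from a \<open>P2\<close> time, where
    \<open>x >= 2k\<close>, hence by a step that wraps. The two extreme middle residues then confine
    \<omega> to \<open>2k\<close> and \<open>2k + 1\<close>.\<close>
  have before: "\<exists>i. i \<in> P2 \<and> Suc i < p \<and> x (Suc i) = t \<and> x i = t - \<omega> + int p" if t: "k \<le> t" "t < 2 * k" for t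
  proof -
    obtain j where j: "j < p" "x j = t" using x_surj[OF m, of t] t k eqs by auto
    hence "j \<in> D" using BadD BadB t eqs by auto
    then obtain i where i: "j = Suc i" "i \<in> P2" by (auto simp: D_def)
    obtain kx where kx: "x (Suc i) = x i + \<omega> - int p * kx" "kx \<in> {0, 1}"
      using stepE[OF m pos, of i] i j by metis
    have "real_of_int \<omega> > 0" using w pos by simp
    hence "0 < \<omega>" by simp
    moreover have "2 * k \<le> x i" using P2_hi i(2) by blast
    ultimately have "kx = 1" using kx i(1) j(2) t by auto
    thus ?thesis using i j kx by auto
  qed
  have "k < \<omega>" "\<omega> \<le> 2 * k + 1"
  proof -
    obtain i where i: "i \<in> P2" "x i = k - \<omega> + int p" using before[of k] k by auto
    hence "2 * k \<le> x i" "x i < int p" using P2_hi[OF i(1)] by simp_all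
    thus "k < \<omega>" "\<omega> \<le> 2 * k + 1" using i eqs by simp_all
  qed
  moreover have "2 * k - 1 < \<omega>"
  proof -
    obtain i where i: "i \<in> P2" "x i = 2 * k - 1 - \<omega> + int p" using before[of "2 * k - 1"] k by auto
    hence "x i < int p" using P2_hi[OF i(1)] by simp
    thus ?thesis using i eqs by simp
  qed
  ultimately consider "\<omega> = 2 * k + 1" | "\<omega> = 2 * k" by linarith
  thus False
  proof cases
    case 1
    \<comment> \<open>The factor 9 clears the denominators of \<open>k = (p - 1)/3\<close>: modulo
      \<open>p\<close>, \<open>9 * \<omega>\<close> is 3 and \<open>9 * (a * b)\<close> is 1, so
      \<open>p\<close> would divide 2 or 4.\<close>
    have e: "9 * \<omega> = 6 * int p + 3" "9 * (a * b) = int p * (int p - 2) + 1"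
      using eqs 1 by (simp_all add: algebra_simps)
    from ab show False
    proof
      assume "[\<omega> = a * b] (mod int p)"
      hence "int p dvd 9 * (\<omega> - a * b)" by (simp only: cong_iff_dvd_diff dvd_mult)
      also have "9 * (\<omega> - a * b) = 2 + int p * (8 - int p)" using e by (simp add: algebra_simps)
      finally have "int p dvd 2" by (simp add: dvd_add_left_iff)
      thus False using zdvd_imp_le[of "int p" 2] p_ge by simp
    next
      assume "[\<omega> = - (a * b)] (mod int p)"
      hence "int p dvd 9 * (\<omega> - - (a * b))" by (simp only: cong_iff_dvd_diff dvd_mult)
      also have "9 * (\<omega> - - (a * b)) = 4 + int p * (4 + int p)" using e by (simp add: algebra_simps)
      finally have "int p dvd 4" by (simp add: dvd_add_left_iff)
      thus False using zdvd_imp_le[of "int p" 4] p_ge by simp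
    qed
  next
    case 2
    obtain i0 where i0: "i0 < p" "x i0 = 2 * k" using x_surj[OF m, of "2 * k"] eqs k by auto
    \<comment> \<open>From \<open>2k\<close> the step \<open>2k\<close> leads to
      \<open>k - 1\<close>, which is not a middle residue; so the residue \<open>2k\<close> has no
      successor.\<close>
    have "i0 = p - 1"
    proof (rule ccontr)
      assume ne: "i0 \<noteq> p - 1"
      hence s: "Suc i0 < p" "Suc i0 \<in> Bad" using i0 succ_bad[of i0] highP2[of i0] by auto
      obtain kx where kx: "x (Suc i0) = x i0 + \<omega> - int p * kx" "kx \<in> {0, 1}" using stepE[OF m pos s(1)] by metis
      have "k \<le> x (Suc i0)" "x (Suc i0) < 2 * k" using s BadB eqs by auto
      thus False using kx i0(2) 2 eqs(3) k(2) by auto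
    qed
    hence xL: "x (p - 1) = 2 * k" using i0 by simp
    \<comment> \<open>The last four residues are \<open>2k + 2\<close>, \<open>k + 1\<close>,
      \<open>0\<close>, \<open>2k\<close>, and \<open>F\<close> is 2, 0, 2 at the first, third and
      fourth. Hence \<open>Y\<close> and \<open>Z\<close> both wrap in the last step and in neither
      of the two steps before it.\<close>
    define l where "l = p - 4"
    have l: "l < p" "Suc l < p" "Suc (Suc l) < p" "Suc (Suc (Suc l)) < p" "p - 1 = Suc (Suc (Suc l))" 
      using p_ge by (simp_all add: l_def)
    have xL': "x (Suc (Suc (Suc l))) = 2 * k" using xL unfolding l(5) .
    obtain kx ky kz where s3: "x (Suc (Suc (Suc l))) = x (Suc (Suc l)) + \<omega> - int p * kx"
      "Y (Suc (Suc (Suc l))) = Y (Suc (Suc l)) + \<theta> - real p * of_int ky"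
      "Z (Suc (Suc (Suc l))) = Z (Suc (Suc l)) + \<zeta> - real p * of_int kz"
      "F (Suc (Suc (Suc l))) = F (Suc (Suc l)) + ky + kz - kx" "kx \<in> {0, 1}" "ky \<in> {0, 1}" "kz \<in> {0, 1}"
      using stepE[OF m pos l(4)] by metis
    obtain kx' ky' kz' where s2: "x (Suc (Suc l)) = x (Suc l) + \<omega> - int p * kx'"
      "Y (Suc (Suc l)) = Y (Suc l) + \<theta> - real p * of_int ky'"
      "Z (Suc (Suc l)) = Z (Suc l) + \<zeta> - real p * of_int kz'"
      "F (Suc (Suc l)) = F (Suc l) + ky' + kz' - kx'" "kx' \<in> {0, 1}" "ky' \<in> {0, 1}" "kz' \<in> {0, 1}"
      using stepE[OF m pos l(3)] by metis
    obtain kx'' ky'' kz'' where s1: "x (Suc l) = x l + \<omega> - int p * kx''"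
      "Y (Suc l) = Y l + \<theta> - real p * of_int ky''"
      "Z (Suc l) = Z l + \<zeta> - real p * of_int kz''"
      "F (Suc l) = F l + ky'' + kz'' - kx''" "kx'' \<in> {0, 1}" "ky'' \<in> {0, 1}" "kz'' \<in> {0, 1}"
      using stepE[OF m pos l(2)] by metis
    have x2: "x (Suc (Suc l)) = 0" "kx = 0" using s3(1,5) xL' 2 eqs(3) x_range[OF l(3)] by auto
    have x1: "x (Suc l) = k + 1" "kx' = 1" using s2(1,5) x2(1) 2 eqs(3) k(2) x_range[OF l(2)] by auto
    have x0: "x l = 2 * k + 2" "kx'' = 1" using s1(1,5) x1(1) 2 eqs(3) k(2) x_range[OF l(1)] by auto
    have PL: "Suc (Suc (Suc l)) \<in> P2" "l \<in> P2" using highP2[OF l(4)] highP2[OF l(1)] xL' x0(1) by simp_all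
    have "Suc (Suc l) \<notin> P1" using no_pair[OF l(4)] PL by (auto simp: P1_def P2_def)
    hence F2: "F (Suc (Suc l)) = 0" using lowP[OF l(3)] x2 k by (auto simp: P0_def)
    have "F (Suc (Suc (Suc l))) = 2" "F l = 2" using PL by (simp_all add: P2_def)
    hence "ky + kz = 2" "ky' + kz' + ky'' + kz'' = 0"
      using F2 s3(4) s2(4) s1(4) x0(2) x1(2) x2(2) by linarith+
    moreover have "0 \<le> v \<and> v \<le> 1" if "v \<in> {0, 1}" for v :: int using that by auto
    note this[OF s3(6)] this[OF s3(7)] this[OF s2(6)] this[OF s2(7)] this[OF s1(6)] this[OF s1(7)]
    ultimately have "ky = 1" "kz = 1" "ky' = 0" "kz' = 0" "ky'' = 0" "kz'' = 0" by linarith+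
    hence "Y (p - 1) = Y l + 3 * \<theta> - real p" "Z (p - 1) = Z l + 3 * \<zeta> - real p"
      using s1(2,3) s2(2,3) s3(2,3) unfolding l(5) by simp_all
    moreover have "Y l < c" "Z l < d" using PL by (simp_all add: P2_def)
    ultimately have th3: "3 * \<theta> > real p - c" "3 * \<zeta> > real p - d"
      using Y_range[of "p - 1"] Z_range[of "p - 1"] p_ge by simp_all
    \<comment> \<open>The residues \<open>2k + 1\<close>, \<open>k\<close>, \<open>3k\<close> follow
      each other, with \<open>F = 2\<close> at both ends and one wrap of \<open>x\<close>. So
      \<open>Y\<close> and \<open>Z\<close> wrap once in total, and the coordinate that does not
      wrap has twice its step below its side of the box, against \<open>th3\<close>.\<close>
    obtain i where i: "i \<in> P2" "Suc i < p" "x (Suc i) = k" "x i = k - \<omega> + int p"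
    proof -
      have "k < 2 * k" using k(2) by simp
      thus ?thesis using before[of k] that by blast
    qed
    have "Suc i \<noteq> p - 1"
    proof
      assume "Suc i = p - 1"
      hence "x (Suc i) = 2 * k" using xL by (simp only:)
      thus False using i(3) k(2) by linarith
    qed
    hence ii: "Suc (Suc i) < p" using i(2) by linarith
    obtain kx ky kz where t1: "x (Suc i) = x i + \<omega> - int p * kx"
      "Y (Suc i) = Y i + \<theta> - real p * of_int ky" "Z (Suc i) = Z i + \<zeta> - real p * of_int kz"
      "F (Suc i) = F i + ky + kz - kx" "kx \<in> {0, 1}" "ky \<in> {0, 1}" "kz \<in> {0, 1}"
      using stepE[OF m pos i(2)] by metis
    obtain kx' ky' kz' where t2: "x (Suc (Suc i)) = x (Suc i) + \<omega> - int p * kx'"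
      "Y (Suc (Suc i)) = Y (Suc i) + \<theta> - real p * of_int ky'" "Z (Suc (Suc i)) = Z (Suc i) + \<zeta> - real p * of_int kz'"
      "F (Suc (Suc i)) = F (Suc i) + ky' + kz' - kx'" "kx' \<in> {0, 1}" "ky' \<in> {0, 1}" "kz' \<in> {0, 1}"
      using stepE[OF m pos ii] by metis
    have "kx = 1" using t1(1,5) i(3,4) p_ge by auto
    moreover have y2: "x (Suc (Suc i)) = 3 * k" "kx' = 0" using t2(1,5) i(3) 2 eqs(3) k(2) x_range[OF ii] by auto
    have "Suc (Suc i) \<in> P2" using highP2[OF ii] y2(1) k(2) by simp
    hence T: "Y (Suc (Suc i)) < c" "Z (Suc (Suc i)) < d" "0 < Y i" "0 < Z i" "F (Suc (Suc i)) = 2" "F i = 2"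
      using i(1,2) Y_range[of i] Z_range[of i] by (simp_all add: P2_def)
    ultimately have "ky = 0 \<and> ky' = 0 \<or> kz = 0 \<and> kz' = 0" using t1(4,6,7) t2(4,6,7) y2(2) by auto
    hence "2 * \<theta> < c \<or> 2 * \<zeta> < d" using t1(2,3) t2(2,3) T(1-4) by auto
    thus False using th3 c_small d_small c_pos d_pos by linarith
  qed
qed

end

section \<open>Short positive steps in both coordinates\<close>

lemma tight_count:
  fixes m n N a b k P :: int
  assumes "m + n \<le> a + b + 1 + N" "m \<le> a" "n \<le> P - a - b" "2 * P + 3 * N < 3 * (m + n)"
    "P = 3 * k + 1 \<or> P = 3 * k + 2" "a \<le> b" "b \<le> k" "0 \<le> N"
  shows "P = 3 * k + 1 \<and> a = k \<and> b = k \<and> m = k \<and> n = k + 1 \<and> N = 0"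
proof -
  have le: "m + n \<le> 2 * k + 1 + N" using assms(1,6,7) by linarith
  have P: "P = 3 * k + 1" using assms(4,5) le by presburger
  have "2 * k + 1 + N \<le> m + n" using assms(4) P by presburger
  hence mn: "m + n = 2 * k + 1 + N" using le by simp
  hence "a = k" "b = k" using assms(1,6,7) by linarith+
  moreover from this have "N \<le> 0" using mn assms(2,3) P by linarith
  ultimately show ?thesis using mn P assms(2,3,8) by linarith
qed

context walk
begin

text \<open>In unrolled position, the times of \<open>P1\<close> and \<open>P2\<close> fall into
  windows of length \<open>a + b\<close>, one per lap, and at most \<open>a + b\<close> times lie in
  windows altogether. The times of \<open>P0\<close>, with one exception, are traded injectively for
  unoccupied window times or for \<open>Neg\<close> times.\<close>

lemma slow_count:
  assumes m: "moves \<omega> \<theta> \<zeta>" and th: "0 < \<theta>" "\<theta> < c" and ze: "0 < \<zeta>" "\<zeta> < d" and P2: "P2 \<noteq> {}"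
    and nu: "\<And>j. j \<in> P2 \<Longrightarrow> \<nu> < real p - of_int a"
  shows "int (card P0 + card P1 + card P2) \<le> a + b + 1 + int (card Neg)"
proof -
  have w: "of_int \<omega> = \<theta> + \<zeta>" using m by (simp add: moves_def)
  have "0 < real_of_int \<omega>" "real_of_int \<omega> < of_int (a + b)" using w th ze cd by linarith+
  hence om: "0 < \<omega>" "\<omega> < a + b" by (simp_all only: of_int_0_less_iff of_int_less_iff)
  have abp: "a + b < int p" using a_le_b b_small a_pos by linarith
  obtain fx fy fz :: "nat \<Rightarrow> int"
  where fx: "\<And>j. j < p \<Longrightarrow> x j = x 0 + int j * \<omega> - int p * fx j"
    and fy: "\<And>j. j < p \<Longrightarrow> Y j = Y 0 + real j * \<theta> - real p * of_int (fy j)"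
    and fz: "\<And>j. j < p \<Longrightarrow> Z j = Z 0 + real j * \<zeta> - real p * of_int (fz j)"
    and FF: "\<And>j. j < p \<Longrightarrow> F j = F 0 + fy j + fz j - fx j"
    using movesE[OF m] by metis
  have P: "real p > 0" using p_ge by simp
  have fy_mono: "fy i \<le> fy j" if "i \<le> j" "j < p" for i j
  proof -
    have "real i * \<theta> \<le> real j * \<theta>" using that th by (simp add: mult_right_mono)
    hence "real p * of_int (fy i) < real p * of_int (fy j + 1)"
      using fy[of i] fy[of j] Y_range[of i] Y_range[of j] that by (simp add: algebra_simps)
    thus ?thesis using int_less_of_mult_less[OF _ P] by fastforce
  qed
  have fz_mono: "fz i \<le> fz j" if "i \<le> j" "j < p" for i j
  proof -
    have "real i * \<zeta> \<le> real j * \<zeta>" using that ze by (simp add: mult_right_mono)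
    hence "real p * of_int (fz i) < real p * of_int (fz j + 1)"
      using fz[of i] fz[of j] Z_range[of i] Z_range[of j] that by (simp add: algebra_simps)
    thus ?thesis using int_less_of_mult_less[OF _ P] by fastforce
  qed
  define X where "X t = x 0 + t * \<omega>" for t :: int
  have Xx: "X (int j) = x j + int p * fx j" if "j < p" for j using fx[OF that] by (simp add: X_def)
  have X_less: "X s < X t \<longleftrightarrow> s < t" for s t using om by (simp add: X_def)
  have X_add: "X (s + t) = X s + t * \<omega>" for s t by (simp add: X_def algebra_simps)
  \<comment> \<open>Up to a constant \<open>S\<close> counts the laps of \<open>Y\<close> and
    \<open>Z\<close> together, so it never decreases.\<close>
  define S where "S j = F j + fx j" for j
  have S_mono: "S i \<le> S j" if "i \<le> j" "j < p" for i j
    using fy_mono[OF that] fz_mono[OF that] FF[of i] FF[of j] that by (simp add: S_def)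
  have bal: "Y j + Z j = of_int (X (int j)) - \<nu> - real p * of_int (S j - 2)" if "j < p" for j
    using balance[OF that] Xx[OF that] by (simp add: S_def algebra_simps)
  \<comment> \<open>For \<open>M = S j - 2\<close> this is \<open>0 < Y j + Z j < a + b\<close>,
    rewritten by \<open>bal\<close>.\<close>
  define win where "win M t \<longleftrightarrow> \<nu> + real p * of_int M < of_int (X t) \<and> of_int (X t) < \<nu> + real p * of_int M + of_int (a + b)"
    for M t :: int
  have abp': "real_of_int (a + b) < real p" using abp by (metis of_int_less_iff of_int_of_nat_eq)
  have win_unique: "M = M'" if "win M t" "win M' t" for M M' t
  proof -
    have "real p * of_int M < real p * of_int (M' + 1)" "real p * of_int M' < real p * of_int (M + 1)"
      using that abp' unfolding win_def by (simp_all add: algebra_simps)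
    hence "M < M' + 1" "M' < M + 1" using int_less_of_mult_less[OF _ P] by blast+
    thus ?thesis by simp
  qed
  define T where "T = P1 \<union> P2"
  have T_win: "win (S j - 2) (int j)" if "j \<in> T" for j
  proof -
    have "j < p" "Y j < c" "Z j < d" using that by (auto simp: T_def P1_def P2_def)
    thus ?thesis using bal[of j] Y_range[of j] Z_range[of j] cd unfolding win_def by (auto simp: algebra_simps)
  qed
  have T_lt: "j < p" if "j \<in> T" for j using that by (auto simp: T_def P1_def P2_def)
  define W where "W = {j. j < p \<and> (\<exists>M. win M (int j))}"
  have cardW: "int (card W) \<le> a + b"
  proof -
    define lv where "lv j = (SOME M. win M (int j))" for j
    have lv: "win (lv j) (int j)" if "j \<in> W" for j
      using that unfolding lv_def W_def by (auto intro: someI_ex)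
    \<comment> \<open>Subtracting the level moves all windows onto a single one.
      \<open>\<tau> j\<close> is still congruent to \<open>x j\<close>, so distinct times keep
      distinct values.\<close>
    define \<tau> where "\<tau> j = X (int j) - int p * lv j" for j
    have "inj_on \<tau> W"
    proof (rule inj_onI)
      fix i j assume ij: "i \<in> W" "j \<in> W" "\<tau> i = \<tau> j"
      hence l: "i < p" "j < p" by (auto simp: W_def)
      have "x i - x j = int p * (lv i - fx i - lv j + fx j)" using ij(3) Xx[OF l(1)] Xx[OF l(2)] by (simp add: \<tau>_def algebra_simps)
      hence "int p dvd x i - x j" by simp
      moreover have "\<bar>x i - x j\<bar> < int p" using x_range[OF l(1)] x_range[OF l(2)] by auto
      ultimately have "x i - x j = 0" using dvd_imp_le_int[of "x i - x j" "int p"] by fastforce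
      thus "i = j" using x_inj[OF m l] by simp
    qed
    hence "card W = card (\<tau> ` W)" by (simp add: card_image)
    also have "\<dots> \<le> card {t::int. \<nu> < of_int t \<and> of_int t < \<nu> + real (nat (a + b))}"
    proof (rule card_mono[OF card_int_open_le(1)])
      show "\<tau> ` W \<subseteq> {t. \<nu> < of_int t \<and> of_int t < \<nu> + real (nat (a + b))}"
        using lv a_pos a_le_b by (auto simp: \<tau>_def win_def algebra_simps)
    qed
    also have "\<dots> \<le> nat (a + b)" by (rule card_int_open_le(2))
    finally show ?thesis using a_pos a_le_b by simp
  qed
  define E where "E = W - T"
  have TW: "T \<subseteq> W" using T_win T_lt by (auto simp: W_def)
  have finW: "finite W" by (simp add: W_def)
  have cardE: "int (card E) + int (card P1) + int (card P2) \<le> a + b"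
  proof -
    have "card T = card P1 + card P2" using disjoint_sets by (simp add: T_def card_Un_disjoint)
    moreover have "card E = card W - card T" "card T \<le> card W"
      using card_Diff_subset[OF _ TW] card_mono[OF finW TW] finite_subset[OF TW finW] by (simp_all add: E_def)
    ultimately show ?thesis using cardW by linarith
  qed
  \<comment> \<open>The first time in the box separates the laps: windows before it are free of
    \<open>T\<close>, so their times lie in \<open>E\<close>.\<close>
  define jT where "jT = Min T"
  have finT: "finite T" "T \<noteq> {}" using P2 by (auto simp: T_def)
  have jT: "jT \<in> T" "jT < p" and jT_le: "\<And>j. j \<in> T \<Longrightarrow> jT \<le> j"
    using Min_in[OF finT] Min_le[OF finT(1)] T_lt by (simp_all add: jT_def)
  define Mt where "Mt = S jT - 2"
  have jT_win: "win Mt (int jT)" using T_win[OF jT(1)] by (simp add: Mt_def)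
  have nu': "\<nu> < real p - of_int a" using P2 nu by auto
  have P0D: "j < p" "x j < a" "0 \<le> x j" "S j = fx j" "X (int j) = x j + int p * fx j"
    "real_of_int (X (int j)) \<le> \<nu> + real p * of_int (fx j)" "0 \<le> \<nu>" if "j \<in> P0" for j
  proof -
    show l: "j < p" "x j < a" "0 \<le> x j" "S j = fx j" "X (int j) = x j + int p * fx j"
      using that x_range[of j] Xx[of j] by (auto simp: P0_def S_def)
    show *: "real_of_int (X (int j)) \<le> \<nu> + real p * of_int (fx j)"
      using bal[OF l(1)] Y_range[OF l(1)] Z_range[OF l(1)] l(4) by (simp add: algebra_simps)
    have "real_of_int (X (int j)) = of_int (x j) + real p * of_int (fx j)" using l(5) by simp
    moreover have "0 \<le> real_of_int (x j)" using l(3) by simp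
    ultimately show "0 \<le> \<nu>" using * by linarith
  qed
  define LM where "LM M = {j \<in> P0. fx j = M}" for M
  have finL: "finite (LM M)" for M by (simp add: LM_def)
  \<comment> \<open>Only the lap \<open>Mt\<close> needs a sacrificed time. If it has no
    \<open>P0\<close> time, \<open>jl\<close> is an arbitrary value, and removing it from
    \<open>P0\<close> still costs at most one.\<close>
  define jl where "jl = Max (LM Mt)"
  \<comment> \<open>Target range for lap \<open>M\<close>: its own window before lap
    \<open>Mt\<close>, the residues from \<open>b\<close> to \<open>a + b - 1\<close> in lap
    \<open>Mt\<close>, and the preceding window afterwards. The ranges increase with
    \<open>M\<close>, so images of different laps cannot collide.\<close>
  define R where "R M u \<longleftrightarrow>
      (if M < Mt then \<nu> + real p * of_int M < u \<and> u < \<nu> + real p * of_int M + of_int (a + b)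
       else if M = Mt then real p * of_int Mt + of_int b \<le> u \<and> u < real p * of_int Mt + of_int (a + b)
       else \<nu> + real p * of_int (M - 1) < u \<and> u < \<nu> + real p * of_int (M - 1) + of_int (a + b) \<and>
            (M = Mt + 1 \<longrightarrow> real p * of_int M \<le> u))" for M :: int and u :: real
  have spread: "(int j - int i) * \<omega> = x j - x i" if "i \<in> LM M" "j \<in> LM M" for i j M
  proof -
    have "X (int j) - X (int i) = x j - x i" using that P0D(5)[of i] P0D(5)[of j] by (simp add: LM_def)
    thus ?thesis by (simp add: X_def algebra_simps)
  qed
  \<comment> \<open>Two \<open>P0\<close> times of the same lap have residues below
    \<open>a <= b\<close> that differ by a multiple of \<omega>. This keeps \<omega> plus the spread
    of a lap below the window length \<open>a + b\<close>.\<close>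
  have spread_le: "i = j \<or> \<omega> \<le> b" if "i \<in> LM M" "j \<in> LM M" "i \<le> j" for i j M
  proof (rule disjCI)
    assume "\<not> \<omega> \<le> b"
    hence "x j - x i < \<omega>" using that P0D(2)[of j] P0D(3)[of i] a_le_b by (auto simp: LM_def)
    hence "(int j - int i) * \<omega> < 1 * \<omega>" using spread[OF that(1,2)] by simp
    hence "int j - int i < 1" using om by (simp only: mult_less_cancel_right_pos)
    thus "i = j" using that(3) by simp
  qed
  have "\<exists>s::int. \<forall>j\<in>P0 - {jl}. fx j = M \<longrightarrow>
          0 \<le> int j + s \<and> int j + s < int p \<and> nat (int j + s) \<in> E \<union> Neg \<and> R M (of_int (X (int j + s)))" for M
  proof (cases "LM M = {}")
    case True
    thus ?thesis by (auto simp: LM_def)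
  next
    case ne: False
    define j1 where "j1 = Min (LM M)"
    define j2 where "j2 = Max (LM M)"
    have j12: "j1 \<in> LM M" "j2 \<in> LM M" "\<And>j. j \<in> LM M \<Longrightarrow> j1 \<le> j \<and> j \<le> j2"
      using finL[of M] ne by (simp_all add: j1_def j2_def)
    have jj: "j1 \<in> P0" "fx j1 = M" "j2 \<in> P0" "fx j2 = M" using j12 by (auto simp: LM_def)
    consider (A) "M < Mt" | (B) "M = Mt" | (C) "M > Mt" by linarith
    thus ?thesis
    proof cases
      case A
      \<comment> \<open>Least shift that takes the first \<open>P0\<close> time of the lap beyond
        the lower end of window \<open>M\<close>; the spread keeps the others inside. All images
        precede \<open>jT\<close>, hence avoid \<open>T\<close>.\<close>
      define s where "s = \<lfloor>(\<nu> + real p * of_int M - of_int (X (int j1))) / of_int \<omega>\<rfloor> + 1"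
      have s1: "of_int (X (int j1)) + of_int (s - 1) * of_int \<omega> \<le> \<nu> + real p * of_int M"
        "\<nu> + real p * of_int M < of_int (X (int j1)) + of_int s * of_int \<omega>"
      proof -
        define v where "v = (\<nu> + real p * of_int M - of_int (X (int j1))) / of_int \<omega>"
        have v: "v * of_int \<omega> = \<nu> + real p * of_int M - of_int (X (int j1))" using om by (simp add: v_def)
        have "of_int (s - 1) \<le> v" "v < of_int s" unfolding s_def v_def[symmetric] by linarith+
        hence "of_int (s - 1) * of_int \<omega> \<le> v * of_int \<omega>" "v * of_int \<omega> < of_int s * of_int \<omega>"
          using om by (simp_all add: mult_right_mono del: of_int_diff)
        thus "of_int (X (int j1)) + of_int (s - 1) * of_int \<omega> \<le> \<nu> + real p * of_int M"
          "\<nu> + real p * of_int M < of_int (X (int j1)) + of_int s * of_int \<omega>" using v by linarith+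
      qed
      have s0: "s \<ge> 1"
      proof -
        have "0 \<le> (\<nu> + real p * of_int M - of_int (X (int j1))) / of_int \<omega>"
          using P0D(6)[OF jj(1)] jj(2) om by simp
        thus ?thesis unfolding s_def by simp
      qed
      show ?thesis
      proof (intro exI[of _ s] ballI impI)
        fix j assume "j \<in> P0 - {jl}" "fx j = M"
        hence j: "j \<in> LM M" "j \<in> P0" by (auto simp: LM_def)
        have Xj: "X (int j + s) = X (int j1) + s * \<omega> + (x j - x j1)"
          using spread[OF j12(1) j(1)] by (simp add: X_def algebra_simps)
        have Xj': "real_of_int (X (int j + s)) = of_int (X (int j1)) + of_int s * of_int \<omega> + of_int (x j - x j1)"
          unfolding Xj by simp
        have "x j - x j1 \<ge> 0" using spread[OF j12(1) j(1)] j12(3)[OF j(1)] om by (metis mult_nonneg_nonneg diff_ge_0_iff_ge of_nat_mono less_imp_le)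
        moreover have "\<omega> + (x j - x j1) < a + b"
          using spread_le[OF j12(1) j(1)] j12(3)[OF j(1)] P0D(2)[OF j(2)] P0D(3)[OF jj(1)] om by auto
        ultimately have d: "0 \<le> real_of_int (x j - x j1)" "of_int \<omega> + of_int (x j - x j1) < real_of_int (a + b)"
          by (simp_all only: of_int_0_le_iff of_int_less_iff flip: of_int_add)
        have sw: "of_int (s - 1) * of_int \<omega> = of_int s * of_int \<omega> - real_of_int \<omega>" by (simp add: algebra_simps)
        have wn: "win M (int j + s)" unfolding win_def Xj' using s1 d sw by linarith
        have "real_of_int (X (int j + s)) < of_int (X (int jT))"
        proof -
          have "real p * of_int (M + 1) \<le> real p * of_int Mt" using A P by (intro mult_left_mono) simp_all
          thus ?thesis using wn jT_win abp' unfolding win_def by (simp add: algebra_simps)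
        qed
        hence lt: "int j + s < int jT" using X_less by simp
        have "nat (int j + s) \<notin> T"
        proof
          assume "nat (int j + s) \<in> T"
          hence "jT \<le> nat (int j + s)" by (rule jT_le)
          thus False using lt s0 by linarith
        qed
        thus "0 \<le> int j + s \<and> int j + s < int p \<and> nat (int j + s) \<in> E \<union> Neg \<and> R M (of_int (X (int j + s)))"
          using lt jT(2) s0 wn A unfolding R_def win_def[symmetric] E_def W_def by (auto simp: win_def)
      qed
    next
      case B
      \<comment> \<open>Least shift that lifts the first \<open>P0\<close> time of the lap to
        residue \<open>b\<close> or more. With the last time omitted, the others satisfy
        \<open>x j + \<omega> < a\<close>, so their images stay below \<open>a + b\<close>.\<close>
      define s where "s = - ((x j1 - b) div \<omega>)"
      have "x j1 - b = \<omega> * ((x j1 - b) div \<omega>) + (x j1 - b) mod \<omega>" by simp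
      hence "x j1 - b = - (s * \<omega>) + (x j1 - b) mod \<omega>" by (simp add: s_def mult.commute)
      hence s1: "b \<le> x j1 + s * \<omega>" "x j1 + s * \<omega> < b + \<omega>"
        using om pos_mod_bound[of \<omega> "x j1 - b"] pos_mod_sign[of \<omega> "x j1 - b"] by linarith+
      have s0: "s \<ge> 1"
      proof (rule ccontr)
        assume "\<not> 1 \<le> s"
        hence "s * \<omega> \<le> 0" using om by (simp add: mult_nonpos_nonneg)
        thus False using s1 P0D(2)[OF jj(1)] a_le_b by linarith
      qed
      show ?thesis
      proof (intro exI[of _ s] ballI impI)
        fix j assume "j \<in> P0 - {jl}" "fx j = M"
        hence j: "j \<in> LM M" "j \<in> P0" "j \<noteq> j2" using B by (auto simp: LM_def jl_def j2_def)
        have "j < j2" using j12(3)[OF j(1)] j(3) by simp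
        hence "1 * \<omega> \<le> (int j2 - int j) * \<omega>" using om by (intro mult_right_mono) simp_all
        hence last: "x j + \<omega> < a" using spread[OF j(1) j12(2)] P0D(2)[OF jj(3)] by simp
        have Xj: "X (int j + s) = int p * Mt + (x j + s * \<omega>)"
          using P0D(5)[OF j(2)] j(1) B by (simp add: X_add LM_def)
        have "x j1 \<le> x j" using spread[OF j12(1) j(1)] j12(3)[OF j(1)] om
          by (metis mult_nonneg_nonneg diff_ge_0_iff_ge of_nat_mono less_imp_le)
        hence x1: "b \<le> x j + s * \<omega>" "x j + s * \<omega> < a + b"
          using s1 last P0D(3)[OF jj(1)] by linarith+
        have XT: "int p * Mt + (a + b) \<le> X (int jT)"
        proof -
          have "fx jT = Mt \<and> a + b \<le> x jT \<or> fx jT = Mt + 1"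
            using jT(1) by (auto simp: T_def P1_def P2_def Mt_def S_def)
          thus ?thesis using Xx[OF jT(2)] x_range[OF jT(2)] abp by (auto simp: algebra_simps)
        qed
        hence lt: "int j + s < int jT" using Xj x1 X_less[of "int j + s" "int jT"] by linarith
        define t where "t = nat (int j + s)"
        have t: "int t = int j + s" "t < p" "j \<le> t" "t < jT" using lt s0 jT(2) by (auto simp: t_def)
        have "x t + int p * fx t = int p * Mt + (x j + s * \<omega>)" using Xx[OF t(2)] Xj t(1) by simp
        hence q: "(x t + int p * fx t) div int p = (int p * Mt + (x j + s * \<omega>)) div int p" by simp
        have "fx t = Mt" using q x_range[OF t(2)] x1 abp a_pos a_le_b p_ge by simp
        hence ft: "fx t = Mt" "x t = x j + s * \<omega>" using Xx[OF t(2)] Xj t(1) by simp_all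
        have nT: "t \<notin> T" using jT_le[of t] t(4) by auto
        \<comment> \<open>If \<open>x t\<close> exceeds \<nu>, then \<open>t\<close> is a free
          window time. Otherwise \<open>F t\<close> is 0 or 1. When it is 1, only one further lap of
          \<open>Y\<close> or \<open>Z\<close> is completed up to \<open>jT\<close>, so the other
          coordinate rises without wrapping to its value at \<open>jT\<close> and is below its box
          side already at \<open>t\<close>.\<close>
        have "t \<in> E \<union> Neg"
        proof (cases "\<nu> < of_int (x t)")
          case True
          have "real_of_int (X (int t)) = of_int (x t) + real p * of_int Mt" using Xx[OF t(2)] ft by simp
          moreover have "real_of_int (x t) < of_int (a + b)" using ft x1 by (simp only: of_int_less_iff)
          ultimately have "win Mt (int t)" unfolding win_def using True P0D(7)[OF j(2)] by linarith
          thus ?thesis using nT t(2) by (auto simp: E_def W_def)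
        next
          case False
          have St: "Mt \<le> S t" "S t \<le> Mt + 2"
            using S_mono[OF t(3,2)] S_mono[OF less_imp_le[OF t(4)] jT(2)] P0D(4)[OF j(2)] j(1) B by (simp_all add: Mt_def LM_def)
          have "real_of_int (X (int t)) = of_int (x t) + real p * of_int Mt" using Xx[OF t(2)] ft by simp
          hence "real p * of_int (S t - 2) < real p * of_int Mt"
            using bal[OF t(2)] Y_range[OF t(2)] Z_range[OF t(2)] False by linarith
          hence "S t < Mt + 2" using int_less_of_mult_less[OF _ P] by fastforce
          hence Ft: "F t = 0 \<or> F t = 1 \<and> S t = Mt + 1" using St ft by (auto simp: S_def)
          have "Y t < c \<or> Z t < d" if "S t = Mt + 1"
          proof -
            have "fy jT + fz jT = fy t + fz t + 1" using that FF[OF t(2)] FF[OF jT(2)] by (simp add: S_def Mt_def)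
            hence "fy jT = fy t \<or> fz jT = fz t"
              using fy_mono[OF less_imp_le[OF t(4)] jT(2)] fz_mono[OF less_imp_le[OF t(4)] jT(2)] by linarith
            moreover have "real t * \<theta> \<le> real jT * \<theta>" "real t * \<zeta> \<le> real jT * \<zeta>"
              using t(4) th ze by (simp_all add: mult_right_mono)
            moreover have "Y jT < c" "Z jT < d" using jT(1) by (auto simp: T_def P1_def P2_def)
            ultimately show ?thesis using fy[OF t(2)] fy[OF jT(2)] fz[OF t(2)] fz[OF jT(2)] by auto
          qed
          thus ?thesis using Ft ft x1 t(2) by (auto simp: Neg_def)
        qed
        moreover have "R M (of_int (X (int j + s)))"
        proof -
          have "int p * Mt + b \<le> X (int j + s)" "X (int j + s) < int p * Mt + (a + b)" using Xj x1 by simp_all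
          hence "real_of_int (int p * Mt + b) \<le> of_int (X (int j + s))"
            "of_int (X (int j + s)) < real_of_int (int p * Mt + (a + b))"
            by (simp_all only: of_int_le_iff of_int_less_iff)
          thus ?thesis using B by (simp add: R_def)
        qed
        moreover have "0 \<le> int j + s" "int j + s < int p" using t(1,2) by linarith+
        ultimately show "0 \<le> int j + s \<and> int j + s < int p \<and> nat (int j + s) \<in> E \<union> Neg \<and> R M (of_int (X (int j + s)))"
          unfolding t_def by blast
      qed
    next
      case C
      \<comment> \<open>\<open>B\<close> is the upper end of window \<open>M - 1\<close>, below
        which the lap is moved back. Its images avoid \<open>T\<close>: a time of \<open>T\<close>
        in that window has \<open>S t = M + 1\<close>, whereas monotonicity gives
        \<open>S t <= M\<close>.\<close>
      define B where "B = \<nu> + real p * of_int (M - 1) + of_int (a + b)"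
      define s where "s = (if of_int (X (int j2)) < B then 0 else \<lfloor>(of_int (X (int j2)) - B) / of_int \<omega>\<rfloor> + 1)"
      have s1: "of_int (X (int j2)) - of_int s * of_int \<omega> < B" 
        "s = 0 \<or> s \<ge> 1 \<and> B \<le> of_int (X (int j2)) \<and> B - of_int \<omega> \<le> of_int (X (int j2)) - of_int s * of_int \<omega>"
      proof -
        have "of_int (X (int j2)) - of_int s * of_int \<omega> < B \<and> (s = 0 \<or> s \<ge> 1 \<and> B \<le> of_int (X (int j2)) \<and> B - of_int \<omega> \<le> of_int (X (int j2)) - of_int s * of_int \<omega>)"
        proof (cases "of_int (X (int j2)) < B")
          case True
          thus ?thesis by (simp add: s_def)
        next
          case False
          define v where "v = (of_int (X (int j2)) - B) / of_int \<omega>"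
          have v: "v * of_int \<omega> = of_int (X (int j2)) - B" "0 \<le> v" using om False by (simp_all add: v_def)
          have sv: "s = \<lfloor>v\<rfloor> + 1" using False by (simp add: s_def v_def)
          have "of_int (s - 1) \<le> v" "v < of_int s" unfolding sv by linarith+
          hence "of_int (s - 1) * of_int \<omega> \<le> v * of_int \<omega>" "v * of_int \<omega> < of_int s * of_int \<omega>"
            using om by (simp_all add: mult_right_mono del: of_int_diff)
          moreover have "s \<ge> 1" using sv v(2) by simp
          moreover have "of_int (s - 1) * of_int \<omega> = of_int s * of_int \<omega> - real_of_int \<omega>" by (simp add: algebra_simps)
          ultimately show ?thesis using v(1) False by linarith
        qed
        thus "of_int (X (int j2)) - of_int s * of_int \<omega> < B" 
          "s = 0 \<or> s \<ge> 1 \<and> B \<le> of_int (X (int j2)) \<and> B - of_int \<omega> \<le> of_int (X (int j2)) - of_int s * of_int \<omega>" by blast+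
      qed
      \<comment> \<open>In lap \<open>Mt + 1\<close> the \<open>P0\<close> times have a smaller
        \<open>S\<close> than \<open>jT\<close>, so they precede \<open>jT\<close> and are below the
        window end without any shift.\<close>
      have s0: "s = 0" if "M = Mt + 1"
      proof (rule ccontr)
        assume "s \<noteq> 0"
        hence "B \<le> of_int (X (int j2))" using s1(2) by blast
        moreover have "j2 < jT"
        proof (rule ccontr)
          assume "\<not> j2 < jT"
          hence "S jT \<le> S j2" using S_mono[of jT j2] P0D(1)[OF jj(3)] by simp
          thus False using P0D(4)[OF jj(3)] jj(4) that by (simp add: Mt_def)
        qed
        hence "X (int j2) < X (int jT)" using X_less by simp
        hence "real_of_int (X (int j2)) < of_int (X (int jT))" by (simp only: of_int_less_iff)
        moreover have "M - 1 = Mt" using that by simp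
        ultimately show False using jT_win unfolding win_def B_def by simp
      qed
      show ?thesis
      proof (intro exI[of _ "- s"] ballI impI)
        fix j assume "j \<in> P0 - {jl}" "fx j = M"
        hence j: "j \<in> LM M" "j \<in> P0" "fx j = M" by (auto simp: LM_def)
        have Xj: "X (int j + - s) = X (int j2) - s * \<omega> - (x j2 - x j)"
          using spread[OF j(1) j12(2)] by (simp add: X_def algebra_simps)
        have Xj': "real_of_int (X (int j + - s)) = of_int (X (int j2)) - of_int s * of_int \<omega> - of_int (x j2 - x j)"
          unfolding Xj by simp
        have "x j2 - x j \<ge> 0" using spread[OF j(1) j12(2)] j12(3)[OF j(1)] om
          by (metis mult_nonneg_nonneg diff_ge_0_iff_ge of_nat_mono less_imp_le)
        moreover have "\<omega> + (x j2 - x j) < a + b"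
          using spread_le[OF j(1) j12(2)] j12(3)[OF j(1)] P0D(3)[OF j(2)] P0D(2)[OF jj(3)] om by auto
        ultimately have d: "0 \<le> real_of_int (x j2 - x j)" "of_int \<omega> + of_int (x j2 - x j) < real_of_int (a + b)"
          by (simp_all only: of_int_0_le_iff of_int_less_iff flip: of_int_add)
        have XM: "real p * of_int M \<le> of_int (X (int j))"
        proof -
          have "int p * M \<le> X (int j)" using P0D(3,5)[OF j(2)] j(3) by simp
          hence "real_of_int (int p * M) \<le> of_int (X (int j))" by (simp only: of_int_le_iff)
          thus ?thesis by simp
        qed
        have low: "\<nu> + real p * of_int (M - 1) < of_int (X (int j + - s))"
        proof (cases "s = 0")
          case True
          thus ?thesis using XM nu' a_pos by (simp add: algebra_simps)
        next
          case False
          thus ?thesis using s1(2) d unfolding Xj' B_def by linarith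
        qed
        have wn: "win (M - 1) (int j + - s)" unfolding win_def
          using low s1(1) d unfolding Xj' B_def by linarith
        have ge: "0 \<le> int j + - s"
        proof (cases "s = 0")
          case False
          hence "M - 1 > Mt" using s0 C by linarith
          hence "real p * of_int (Mt + 1) \<le> real p * of_int (M - 1)" using P by (intro mult_left_mono) simp_all
          hence "real_of_int (X (int jT)) < of_int (X (int j + - s))"
            using wn jT_win abp' unfolding win_def by (simp add: algebra_simps)
          hence "int jT < int j + - s" using X_less by simp
          thus ?thesis by simp
        qed simp
        have sn: "s \<ge> 0" using s1(2) by auto
        define t where "t = nat (int j + - s)"
        have t: "int t = int j + - s" "t \<le> j" "t < p" using ge sn P0D(1)[OF j(2)] by (auto simp: t_def)
        have "t \<notin> T"
        proof
          assume "t \<in> T"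
          hence "win (S t - 2) (int t)" by (rule T_win)
          hence "S t - 2 = M - 1" using wn win_unique t(1) by metis
          moreover have "S t \<le> M" using S_mono[OF t(2) P0D(1)[OF j(2)]] P0D(4)[OF j(2)] j(3) by simp
          ultimately show False by simp
        qed
        hence "t \<in> E \<union> Neg" using wn t by (auto simp: E_def W_def)
        moreover have "R M (of_int (X (int j + - s)))"
          using C wn XM s0 unfolding R_def win_def by auto
        moreover have "int j + - s < int p" using t(1,3) by linarith
        ultimately show "0 \<le> int j + - s \<and> int j + - s < int p \<and> nat (int j + - s) \<in> E \<union> Neg \<and> R M (of_int (X (int j + - s)))"
          using ge unfolding t_def by blast
      qed
    qed
  qed
  then obtain sh :: "int \<Rightarrow> int" where sh: "\<And>j. j \<in> P0 - {jl} \<Longrightarrow>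
      0 \<le> int j + sh (fx j) \<and> int j + sh (fx j) < int p \<and> nat (int j + sh (fx j)) \<in> E \<union> Neg \<and>
      R (fx j) (of_int (X (int j + sh (fx j))))"
    by metis
  have R_less: "u < u'" if "R M u" "R M' u'" "M < M'" "0 \<le> \<nu>" for M M' u u'
  proof -
    have e: "real p * of_int (M + 1) \<le> real p * of_int M'" using that(3) P by (intro mult_left_mono) simp_all
    have f: "real p * of_int (M + 1) \<le> real p * of_int (M' - 1)" if "M + 1 < M'" using that P by (intro mult_left_mono) simp_all
    consider "M' < Mt" | "M' = Mt" | "M = Mt" "M' = Mt + 1" | "M = Mt" "Mt + 1 < M'" | "M < Mt" "Mt < M'" | "Mt < M"
      using that(3) by linarith
    thus ?thesis
    proof cases
      case 5
      hence "M + 1 < M'" by simp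
      thus ?thesis using that(1,2) 5 f abp' unfolding R_def by (simp add: algebra_simps)
    qed (use that(1-4) e f abp' nu' a_pos in \<open>auto simp: R_def algebra_simps split: if_splits\<close>)
  qed
  define h where "h j = nat (int j + sh (fx j))" for j
  have "inj_on h (P0 - {jl})"
  proof (rule inj_onI)
    fix i j assume ij: "i \<in> P0 - {jl}" "j \<in> P0 - {jl}" "h i = h j"
    have "0 \<le> int i + sh (fx i)" "0 \<le> int j + sh (fx j)" using sh[OF ij(1)] sh[OF ij(2)] by blast+
    hence e: "int i + sh (fx i) = int j + sh (fx j)" using ij(3) unfolding h_def by (simp only: eq_nat_nat_iff)
    have "0 \<le> \<nu>" using P0D(7) ij by blast
    hence "fx i = fx j" using R_less sh[OF ij(1)] sh[OF ij(2)] e by (metis linorder_neqE less_irrefl)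
    thus "i = j" using e by simp
  qed
  moreover have "h ` (P0 - {jl}) \<subseteq> E \<union> Neg" using sh by (auto simp: h_def)
  ultimately have "card (P0 - {jl}) \<le> card (E \<union> Neg)"
    using card_inj_on_le[of h "P0 - {jl}" "E \<union> Neg"] finW by (simp add: E_def)
  also have "\<dots> \<le> card E + card Neg" by (rule card_Un_le)
  finally have "card P0 \<le> card E + card Neg + 1" by (auto simp: card_Diff_singleton_if split: if_splits)
  thus ?thesis using cardE by linarith
qed

end

context walk
begin

text \<open>The count of \<open>slow_count\<close> allows an excess only when
  \<open>a = b = k\<close>, \<open>p = 3k + 1\<close>, \<open>Neg\<close> is empty and the low and
  high residues are all positive. Then \<open>c = d = k\<close>, and residues near the zone borders
  contradict each other, differently for \<open>\<omega> <= k\<close> and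
  \<open>\<omega> > k\<close>.\<close>

lemma bounded_if_slow:
  assumes m: "moves \<omega> \<theta> \<zeta>" and th: "0 < \<theta>" "\<theta> < c" and ze: "0 < \<zeta>" "\<zeta> < d"
  shows bounded
proof (rule ccontr)
  assume nb: "\<not> bounded"
  then obtain k where k: "int p = 3 * k + 1 \<or> int p = 3 * k + 2" "2 \<le> k" "b \<le> k"
    "int (card Bad) + int (card Neg) \<le> k" "k + 1 \<le> int (card P2)"
    using excess[OF m] by metis
  have w: "of_int \<omega> = \<theta> + \<zeta>" using m by (simp add: moves_def)
  have "0 < real_of_int \<omega>" "real_of_int \<omega> < of_int (a + b)" using w th ze cd by linarith+
  hence om: "0 < \<omega>" "\<omega> < a + b" by (simp_all only: of_int_0_less_iff of_int_less_iff)
  have pos: "0 < \<theta>" "0 < \<zeta>" "\<omega> < int p" using th ze om a_le_b b_small a_pos by linarith+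
  have P2x: "\<nu> < of_int (x j)" "of_int (x j) < \<nu> + of_int (a + b)" if "j \<in> P2" for j
    using that balance[of j] Y_range[of j] Z_range[of j] cd by (auto simp: P2_def)
  \<comment> \<open>\<open>P2\<close> has more than \<open>k\<close> times, so they cannot all sit
    in the top \<open>k\<close> residues, and \<nu> is below the \<open>x\<close> of each of
    them.\<close>
  have nu: "\<nu> < real p - of_int a"
  proof -
    have "\<exists>j\<in>P2. x j < int p - k"
    proof (rule ccontr)
      assume "\<not> ?thesis"
      hence "P2 \<subseteq> {j. j < p \<and> x j \<in> {int p - k..<int p}}" using x_range by (force simp: P2_def)
      hence "card P2 \<le> card {j. j < p \<and> x j \<in> {int p - k..<int p}}" by (intro card_mono) auto
      also have "\<dots> = card {int p - k..<int p}" by (rule card_x[OF m]) (use k in auto)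
      finally show False using k by simp
    qed
    then obtain j where "j \<in> P2" "x j < int p - k" by blast
    hence "\<nu> < of_int (x j)" "x j < int p - a" using P2x k a_le_b by auto
    moreover from this(2) have "real_of_int (x j) < of_int (int p - a)" by (simp only: of_int_less_iff)
    ultimately show ?thesis by simp
  qed
  have "P2 \<noteq> {}" using k by auto
  hence cnt: "int (card P0 + card P1 + card P2) \<le> a + b + 1 + int (card Neg)"
    by (rule slow_count[OF m th ze]) (rule nu)
  have "int (2 * p + 3 * card Neg) < int (3 * (card P0 + card P1 + card P2))"
    using nb unfolding bounded_def by (simp only: of_nat_less_iff not_le)
  hence "2 * int p + 3 * int (card Neg) < 3 * (int (card P0 + card P1) + int (card P2))" by simp
  moreover have "int (card P0 + card P1) + int (card P2) \<le> a + b + 1 + int (card Neg)" using cnt by simp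
  ultimately have "int p = 3 * k + 1 \<and> a = k \<and> b = k \<and> int (card P0 + card P1) = k \<and>
      int (card P2) = k + 1 \<and> int (card Neg) = 0"
    using tight_count card_low(1,3)[OF m] k(1,3) a_le_b of_nat_0_le_iff[of "card Neg", where ?'a = int] by blast
  hence eqs: "a = k" "b = k" "int p = 3 * k + 1" "int (card P0) + int (card P1) = k" "int (card P2) = k + 1" "card Neg = 0"
    by (unfold of_nat_add of_nat_eq_0_iff, blast+)
  have c: "c = of_int k" "d = of_int k" using c_le d_le cd eqs by simp_all
  have ab: "real_of_int (a + b) = 2 * of_int k" using eqs(1,2) by simp
  have highP2: "j \<in> P2" if "j < p" "2 * k \<le> x j" for j
    by (rule full_high[OF m _ that(1)]) (use that(2) eqs(1,2,3,5) in simp_all)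
  have lowP: "j \<in> P0 \<union> P1" if "j < p" "x j < k" for j
    by (rule full_low[OF m _ that(1)]) (use that(2) eqs(1,4) in simp_all)
  show False
  proof (cases "\<omega> \<le> k")
    case True
    obtain i1 where i1: "i1 < p" "x i1 = 3 * k" using x_surj[OF m, of "3 * k"] k(2) eqs(3) by auto
    obtain i2 where i2: "i2 < p" "x i2 = 2 * k" using x_surj[OF m, of "2 * k"] k(2) eqs(3) by auto
    have "i1 \<in> P2" "i2 \<in> P2" using highP2 i1 i2 k(2) by simp_all
    hence nu1: "of_int k < \<nu>" and nu2: "\<nu> < 2 * of_int k"
      using P2x(2)[of i1] P2x(1)[of i2] unfolding i1(2) i2(2) ab by simp_all
    have P1x: "of_int (x j) < \<nu> - of_int k - 1" if "j \<in> P1" for j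
    proof -
      have j: "j < p" "F j = 1" "Y j < of_int k" "Z j < of_int k" using that[unfolded P1_def] c by simp_all
      have "real p = 3 * of_int k + 1" using eqs(3) by (metis of_int_1 of_int_add of_int_mult of_int_numeral of_int_of_nat_eq)
      thus ?thesis using balance[OF j(1)] j by simp
    qed
    obtain fx fy fz :: "nat \<Rightarrow> int"
    where fx: "\<And>j. j < p \<Longrightarrow> x j = x 0 + int j * \<omega> - int p * fx j" and fx0: "fx 0 = 0"
      using movesE[OF m] by metis
    have fx_step: "fx (Suc i) = fx i \<or> fx (Suc i) = fx i + 1 \<and> F (Suc i) \<ge> F i - 1 \<and> x i \<ge> int p - \<omega>"
      "F (Suc i) \<ge> F i - (fx (Suc i) - fx i)" if si: "Suc i < p" for i
    proof -
      obtain kx ky kz where s: "x (Suc i) = x i + \<omega> - int p * kx" "F (Suc i) = F i + ky + kz - kx"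
        "kx \<in> {0, 1}" "ky \<in> {0, 1}" "kz \<in> {0, 1}"
        using stepE[OF m pos si] by metis
      have "int p * (fx (Suc i) - fx i) = int p * kx"
        using s(1) fx[OF si] fx[of i] si by (simp add: algebra_simps)
      hence "kx = fx (Suc i) - fx i" using p_ge by simp
      thus "fx (Suc i) = fx i \<or> fx (Suc i) = fx i + 1 \<and> F (Suc i) \<ge> F i - 1 \<and> x i \<ge> int p - \<omega>"
        "F (Suc i) \<ge> F i - (fx (Suc i) - fx i)"
        using s x_range[OF si] by auto
    qed
    \<comment> \<open>\<open>F\<close> falls only when \<open>x\<close> wraps. As
      \<open>\<omega> <= k\<close>, a wrap starts at a residue above \<open>2k\<close>, thus in
      \<open>P2\<close> with \<open>F = 2\<close>, and leaves \<open>F\<close> at least 1. So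
      \<open>F = 0\<close> does not occur after the first lap.\<close>
    have P0_first: "fx j = 0" if "j \<in> P0" for j
    proof -
      have *: "i < p \<Longrightarrow> fx i = 0 \<or> F i \<ge> 1" for i
      proof (induction i)
        case 0
        thus ?case using fx0 by simp
      next
        case (Suc i)
        show ?case
        proof (cases "fx (Suc i) = fx i")
          case True
          thus ?thesis using Suc fx_step(2)[OF Suc.prems] by auto
        next
          case False
          hence *: "F (Suc i) \<ge> F i - 1" "x i \<ge> int p - \<omega>" using fx_step(1)[OF Suc.prems] by auto
          hence "i \<in> P2" using highP2[of i] Suc.prems \<open>\<omega> \<le> k\<close> eqs(3) by auto
          thus ?thesis using * by (simp add: P2_def)
        qed
      qed
      have "j < p" "F j = 0" using that by (simp_all add: P0_def)
      with *[of j] show ?thesis by simp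
    qed
    \<comment> \<open>The residue \<open>k - 1\<close> is too large for \<open>P1\<close>, so it is
      in \<open>P0\<close>. Its successor lies among the residues of \<open>Neg\<close>, which is
      empty; a \<open>Y\<close> or \<open>Z\<close> that has just wrapped is still inside the box,
      so \<open>F\<close> must jump to 2. This pushes \<nu> below
      \<open>k + \<omega> - 1\<close>.\<close>
    obtain j where j: "j < p" "x j = k - 1" using x_surj[OF m, of "k - 1"] k(2) eqs(3) by auto
    have "j \<notin> P1" using P1x[of j] nu2 unfolding j(2) by auto
    hence jP0: "j \<in> P0" using lowP[OF j(1)] unfolding j(2) by auto
    have xj: "x j = x 0 + int j * \<omega>" using fx[OF j(1)] P0_first[OF jP0] by simp
    have "Suc j < p"
    proof (rule ccontr)
      assume "\<not> Suc j < p"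
      hence "int j = 3 * k" using j(1) eqs(3) by linarith
      moreover have "int j * 1 \<le> int j * \<omega>" using om by (intro mult_left_mono) auto
      moreover have "0 \<le> x 0" using x_range[of 0] p_ge by simp
      ultimately show False using xj j(2) k(2) by linarith
    qed
    then obtain kx ky kz where s: "x (Suc j) = x j + \<omega> - int p * kx"
      "Y (Suc j) = Y j + \<theta> - real p * of_int ky" "Z (Suc j) = Z j + \<zeta> - real p * of_int kz"
      "F (Suc j) = F j + ky + kz - kx" "kx \<in> {0, 1}" "ky \<in> {0, 1}" "kz \<in> {0, 1}"
      using stepE[OF m pos] by metis
    have sj: "Suc j < p" by fact
    have "kx = 0" using s(1,5) j(2) True k(2) eqs(3) x_range[OF sj] by auto
    hence xs: "x (Suc j) = k - 1 + \<omega>" using s(1) j(2) by simp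
    have "Suc j \<notin> Neg" using eqs(6) by simp
    hence nN: "F (Suc j) \<noteq> 0" "F (Suc j) = 1 \<Longrightarrow> \<not> Y (Suc j) < c \<and> \<not> Z (Suc j) < d"
      using sj xs True om(1) eqs(1,2) unfolding Neg_def by auto
    have Fj: "F j = 0" using jP0 by (simp add: P0_def)
    have "F (Suc j) = 2"
    proof (rule ccontr)
      assume "F (Suc j) \<noteq> 2"
      hence "F (Suc j) = 1" "ky = 1 \<or> kz = 1" using nN(1) s Fj \<open>kx = 0\<close> by auto
      hence "Y (Suc j) \<le> \<theta> \<or> Z (Suc j) \<le> \<zeta>" using s(2,3) Y_range[OF j(1)] Z_range[OF j(1)] by auto
      thus False using nN(2) \<open>F (Suc j) = 1\<close> th ze by auto
    qed
    hence "\<nu> < of_int (k - 1 + \<omega>)" using balance[OF sj] Y_range[OF sj] Z_range[OF sj] xs by simp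
    hence nu3: "\<nu> < of_int k + of_int \<omega> - 1" by simp
    hence om2: "\<omega> \<ge> 2" using nu1 om by linarith
    \<comment> \<open>If \<open>k - 2\<close> were in \<open>P0\<close> too, both residues would
      belong to the first lap and differ by a multiple of \<open>\<omega> >= 2\<close>. As a
      \<open>P1\<close> residue it forces \<nu> above \<open>2k - 1\<close>.\<close>
    obtain i where i: "i < p" "x i = k - 2" using x_surj[OF m, of "k - 2"] k(2) eqs(3) by auto
    have "i \<notin> P0"
    proof
      assume "i \<in> P0"
      hence "x i = x 0 + int i * \<omega>" using fx[OF i(1)] P0_first by simp
      hence "(int j - int i) * \<omega> = 1" using xj i(2) j(2) by (simp add: algebra_simps)
      hence "\<omega> dvd 1" by (metis dvd_triv_right)
      thus False using om2 zdvd_imp_le[of \<omega> 1] by simp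
    qed
    hence "i \<in> P1" using lowP[OF i(1)] i(2) by auto
    hence "real_of_int (k - 2) < \<nu> - of_int k - 1" using P1x[of i] unfolding i(2) by simp
    hence "2 * real_of_int k - 1 < of_int k + of_int \<omega> - 1" using nu3 by simp
    thus False using True by simp
  next
    case False
    \<comment> \<open>Displacement of \<open>x\<close> over two steps, less than \<open>k\<close> in
      absolute value. If both ends are in \<open>P2\<close>, then \<open>Y\<close> and
      \<open>Z\<close> do not wrap in between, so \<open>2 * \<theta> < c\<close> and
      \<open>2 * \<zeta> < d\<close>, contradicting \<open>\<omega> > k\<close>.\<close>
    define \<delta> where "\<delta> = 2 * \<omega> - int p"
    have de: "1 - k \<le> \<delta>" "\<delta> \<le> k - 3" using False om(2) eqs(1-3) by (auto simp: \<delta>_def)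
    have key: "\<not> i + 2 < p" if i: "i < p" "2 * k \<le> x i" "2 * k \<le> x i + \<delta>" "x i + \<delta> \<le> 3 * k" for i
    proof
      assume i2: "i + 2 < p"
      obtain kx ky kz where s: "x (i + 2) = x i + (int (i + 2) - int i) * \<omega> - int p * kx"
        "Y (i + 2) = Y i + (real (i + 2) - real i) * \<theta> - real p * of_int ky"
        "Z (i + 2) = Z i + (real (i + 2) - real i) * \<zeta> - real p * of_int kz"
        using diffE[OF m i(1) i2] by metis
      have "x (i + 2) - (x i + \<delta>) = int p * (1 - kx)" using s(1) by (simp add: \<delta>_def algebra_simps)
      moreover have "\<bar>x (i + 2) - (x i + \<delta>)\<bar> < int p" using x_range[OF i2] i(2-4) k(2) eqs(3) by auto
      ultimately have "x (i + 2) - (x i + \<delta>) = 0"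
        using dvd_imp_le_int[of "x (i + 2) - (x i + \<delta>)" "int p"] by fastforce
      hence "x (i + 2) = x i + \<delta>" by simp
      hence "i + 2 \<in> P2" "i \<in> P2" using highP2[OF i(1)] highP2[OF i2] i(2,3) by simp_all
      hence T: "Y (i + 2) < c" "Z (i + 2) < d" "Y i < c" "Z i < d" by (auto simp: P2_def)
      have P: "real p > 0" using p_ge by simp
      have s': "Y (i + 2) = Y i + 2 * \<theta> - real p * of_int ky" "Z (i + 2) = Z i + 2 * \<zeta> - real p * of_int kz"
        using s(2,3) by simp_all
      have "real p * of_int ky < real p * of_int 1" "real p * of_int kz < real p * of_int 1"
        using s' T Y_range[OF i2] Z_range[OF i2] th ze c_small d_small by linarith+
      hence "ky < 1" "kz < 1" using int_less_of_mult_less[OF _ P] by blast+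
      hence "real p * of_int ky \<le> 0" "real p * of_int kz \<le> 0" using P by (simp_all add: mult_nonneg_nonpos)
      hence "2 * \<theta> < c" "2 * \<zeta> < d" using s' T Y_range[OF i(1)] Z_range[OF i(1)] by linarith+
      hence "2 * real_of_int \<omega> < 2 * of_int k" using w c by simp
      thus False using False by simp
    qed
    \<comment> \<open>Two adjacent residues to which \<open>key\<close> applies must occupy the last
      two times. Being neighbours in time, they would make \<omega> congruent to 1 or -1.\<close>
    obtain t where t: "2 * k \<le> t" "t + 1 \<le> 3 * k" "2 * k \<le> t + \<delta>" "t + 1 + \<delta> \<le> 3 * k"
    proof (cases "\<delta> \<ge> 0")
      case True
      show ?thesis by (rule that[of "2 * k"]) (use True de k(2) in auto)
    next
      case False
      show ?thesis by (rule that[of "3 * k - 1"]) (use False de k(2) in auto)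
    qed
    obtain i where i: "i < p" "x i = t" using x_surj[OF m, of t] t k(2) eqs(3) by auto
    obtain i' where i': "i' < p" "x i' = t + 1" using x_surj[OF m, of "t + 1"] t k(2) eqs(3) by auto
    have "\<not> i + 2 < p" "\<not> i' + 2 < p" using key[of i] key[of i'] i i' t by auto
    moreover have "i \<noteq> i'" using i i' by auto
    ultimately consider "i' = Suc i" | "i = Suc i'" using i i' by linarith
    thus False
    proof cases
      case 1
      then obtain kx where "x i' = x i + \<omega> - int p * kx" "kx \<in> {0, 1}" using stepE[OF m pos, of i] i' by metis
      thus False using i(2) i'(2) False om(2) eqs(1-3) k(2) by auto
    next
      case 2
      then obtain kx where "x i = x i' + \<omega> - int p * kx" "kx \<in> {0, 1}" using stepE[OF m pos, of i'] i by metis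
      thus False using i(2) i'(2) False om(2) eqs(1-3) k(2) by auto
    qed
  qed
qed

end

section \<open>\<open>Y\<close> advancing slowly while \<open>Z\<close> retreats\<close>

lemma nearly_tight_count:
  fixes m n B N a b k P :: int
  assumes "m + n + B = P" "B + N \<le> k" "n \<le> B + 2" "a + b \<le> B + m" "m \<le> a" "a \<le> b" "b \<le> k" "3 * k < P" "0 \<le> N"
  shows "N = 0" "m = a" "B < n" "a = b \<or> b = a + 1 \<and> b = k \<and> P = 3 * k + 1 \<and> n = B + 2 \<and> n = k + 2"
proof -
  have "P \<le> m + 2 * B + 2" using assms by linarith
  hence *: "3 * k + 1 \<le> m + 2 * k - 2 * N + 2" using assms by linarith
  show N: "N = 0" using * assms by linarith
  show m: "m = a" using * assms by linarith
  show "B < n" using assms N m by linarith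
  show "a = b \<or> b = a + 1 \<and> b = k \<and> P = 3 * k + 1 \<and> n = B + 2 \<and> n = k + 2"
    using * assms N m by linarith
qed

context walk
begin

text \<open>Going back just far enough for \<open>Y\<close> to leave the box leads from a
  \<open>P2\<close> time to a \<open>Bad\<close> time. Only \<open>P2\<close> times near the
  beginning have no such partner; the resulting deficit is at most \<open>d1 - v\<close> and at most
  2. The few configurations compatible with an excess are excluded by the times at which residues
  near \<open>a\<close> occur.\<close>

lemma bounded_if_fast:
  assumes m: "moves w \<eta> (- \<zeta>)" and w_pos: "0 < w" and ze: "0 < \<zeta>" and eta: "\<eta> < c"
  shows bounded
proof (rule ccontr)
  assume nb: "\<not> bounded"
  then obtain k where k: "int p = 3 * k + 1 \<or> int p = 3 * k + 2" "2 \<le> k" "b \<le> k"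
    "int (card Bad) + int (card Neg) \<le> k" "k + 1 \<le> int (card P2)"
    using excess[OF m] by metis
  have w: "of_int w = \<eta> - \<zeta>" using m by (simp add: moves_def)
  have w1: "1 \<le> real_of_int w" using w_pos by simp
  hence eta1: "1 < \<eta>" "\<zeta> < c" "of_int w < \<eta>" using w ze eta by linarith+
  have "real_of_int w < of_int b" using eta1 eta c_le by linarith
  hence wb: "w < b" by simp
  have P: "real p > 0" using p_ge by simp
  obtain fx fy fz :: "nat \<Rightarrow> int"
  where fx: "\<And>j. j < p \<Longrightarrow> x j = x 0 + int j * w - int p * fx j"
    and fy: "\<And>j. j < p \<Longrightarrow> Y j = Y 0 + real j * \<eta> - real p * of_int (fy j)"
    and fz: "\<And>j. j < p \<Longrightarrow> Z j = Z 0 + real j * - \<zeta> - real p * of_int (fz j)"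
    and FF: "\<And>j. j < p \<Longrightarrow> F j = F 0 + fy j + fz j - fx j" and fx0: "fx 0 = 0"
    using movesE[OF m] by metis
  have fx_mono: "fx i \<le> fx j" if "i \<le> j" "j < p" for i j
  proof -
    have "int i * w \<le> int j * w" using that w_pos by (simp add: mult_right_mono)
    hence "int p * fx i < int p * (fx j + 1)"
      using fx[of i] fx[of j] x_range[of i] x_range[of j] that by (simp add: algebra_simps)
    thus ?thesis using p_ge by simp
  qed
  have fy_mono: "fy i \<le> fy j" if "i \<le> j" "j < p" for i j
  proof -
    have "real i * \<eta> \<le> real j * \<eta>" using that eta1 by (simp add: mult_right_mono)
    hence "real p * of_int (fy i) < real p * of_int (fy j + 1)"
      using fy[of i] fy[of j] Y_range[of i] Y_range[of j] that by (simp add: algebra_simps)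
    hence "fy i < fy j + 1" using int_less_of_mult_less[OF _ P] by blast
    thus ?thesis by simp
  qed
  have fz_anti: "fz j \<le> fz i" if "i \<le> j" "j < p" for i j
  proof -
    have "real i * \<zeta> \<le> real j * \<zeta>" using that ze by (simp add: mult_right_mono)
    hence "real p * of_int (fz j) < real p * of_int (fz i + 1)"
      using fz[of i] fz[of j] Z_range[of i] Z_range[of j] that by (simp add: algebra_simps)
    hence "fz j < fz i + 1" using int_less_of_mult_less[OF _ P] by blast
    thus ?thesis by simp
  qed
  define U where "U j = Y 0 + real j * \<eta>" for j :: nat
  have UY: "U j = Y j + real p * of_int (fy j)" if "j < p" for j using fy[OF that] by (simp add: U_def)
  have U_diff: "U j - U i = (real j - real i) * \<eta>" for i j by (simp add: U_def algebra_simps)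
  have P2D: "j < p" "0 < Y j" "Y j < c" "F j = 2" "a + b \<le> x j"
    "real p * of_int (fy j) < U j" "U j < real p * of_int (fy j) + c" if "j \<in> P2" for j
    using that Y_range[of j] UY[of j] by (auto simp: P2_def)
  \<comment> \<open>Going back loses one lap of \<open>Y\<close>, but loses no lap of the retreating
    \<open>Z\<close> and gains none of \<open>x\<close>. So \<open>F t\<close> is at least
    \<open>F j - 1 = 1\<close>, while \<open>Y t\<close> is outside the box.\<close>
  have bad: "t \<in> Bad" "fy t = fy j - 1"
    if j: "j \<in> P2" and t: "t \<le> j" "U t \<le> real p * of_int (fy j)" "real p * of_int (fy j - 1) + c \<le> U t" for j t
  proof -
    have tp: "t < p" using P2D(1)[OF j] t by simp
    have "real p * of_int (fy t) < real p * of_int (fy j)" "real p * of_int (fy j - 1) < real p * of_int (fy t + 1)"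
      using UY[OF tp] Y_range[OF tp] t c_pos unfolding of_int_add of_int_diff distrib_left right_diff_distrib
      by linarith+
    hence "fy t < fy j" "fy j - 1 < fy t + 1" using int_less_of_mult_less[OF _ P] by blast+
    thus ft: "fy t = fy j - 1" by simp
    have "\<not> Y t < c" using UY[OF tp] t ft by (simp add: algebra_simps)
    moreover have "F t \<noteq> 0"
      using FF[OF tp] FF[OF P2D(1)[OF j]] ft fx_mono[OF t(1) P2D(1)[OF j]] fz_anti[OF t(1) P2D(1)[OF j]] P2D(4)[OF j]
      by simp
    ultimately show "t \<in> Bad" using tp by (auto simp: Bad_def P0_def P1_def P2_def)
  qed
  \<comment> \<open>The least number of steps in which \<open>Y\<close> advances by \<open>c\<close>
    or more. Because \<open>w < \<eta>\<close> and \<open>c <= b\<close>, this gives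
    \<open>(d1 - 1) * w < b\<close> and hence \<open>d1 <= b\<close>.\<close>
  define d1 where "d1 = nat \<lceil>c / \<eta>\<rceil>"
  have d1: "c \<le> real d1 * \<eta>" "(real d1 - 1) * \<eta> < c"
  proof -
    have "0 < c / \<eta>" using c_pos eta1 by simp
    hence "c / \<eta> \<le> real d1" "real d1 - 1 < c / \<eta>" unfolding d1_def by linarith+
    thus "c \<le> real d1 * \<eta>" "(real d1 - 1) * \<eta> < c"
      using eta1(1) by (simp_all add: divide_le_eq less_divide_eq split: if_splits)
  qed
  have d1_pos: "1 \<le> d1"
  proof (rule ccontr)
    assume "\<not> 1 \<le> d1"
    hence "d1 = 0" by simp
    thus False using d1(1) c_pos by simp
  qed
  have d1_w: "(int d1 - 1) * w < b"
  proof -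
    have "(real d1 - 1) * of_int w \<le> (real d1 - 1) * \<eta>" using d1_pos eta1 by (intro mult_left_mono) auto
    hence "real_of_int ((int d1 - 1) * w) < of_int b" using d1(2) c_le by simp
    thus ?thesis by (simp only: of_int_less_iff)
  qed
  have d1_b: "int d1 \<le> b"
  proof -
    have "(int d1 - 1) * 1 \<le> (int d1 - 1) * w" using d1_pos w_pos by (intro mult_left_mono) auto
    thus ?thesis using d1_w by simp
  qed
  have shift: "j - d1 \<in> Bad" "fy (j - d1) = fy j - 1" if j: "j \<in> P2" "d1 \<le> j" for j
  proof -
    have "U j - U (j - d1) = real d1 * \<eta>" using U_diff[of j "j - d1"] j(2) by (simp add: of_nat_diff)
    moreover have "real d1 * \<eta> < 2 * c" using d1(2) eta by (simp add: algebra_simps)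
    ultimately have "U (j - d1) \<le> real p * of_int (fy j)" "real p * of_int (fy j - 1) + c \<le> U (j - d1)"
      using P2D(6,7)[OF j(1)] d1(1) c_small by (simp_all add: algebra_simps)
    thus "j - d1 \<in> Bad" "fy (j - d1) = fy j - 1" using bad[OF j(1), of "j - d1"] by simp_all
  qed
  have ne: "P2 \<noteq> {}" using k by auto
  define v where "v = Min P2"
  have v: "v \<in> P2" "\<And>j. j \<in> P2 \<Longrightarrow> v \<le> j" using ne by (simp_all add: v_def)
  \<comment> \<open>The unpaired times are those of \<open>P2\<close> below \<open>d1\<close>, all
    in \<open>v..<d1\<close>. Truncated subtraction makes the deficit 0 once
    \<open>v >= d1\<close>.\<close>
  have cnt1: "card P2 \<le> card Bad + (d1 - v)"
  proof -
    have "P2 \<subseteq> (P2 - {v..<d1}) \<union> {v..<d1}" by auto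
    hence "card P2 \<le> card ((P2 - {v..<d1}) \<union> {v..<d1})" by (intro card_mono) auto
    also have "\<dots> \<le> card (P2 - {v..<d1}) + card {v..<d1}" by (rule card_Un_le)
    also have "card (P2 - {v..<d1}) \<le> card Bad"
    proof (rule card_inj_on_le[of "\<lambda>j. j - d1"])
      have ge: "d1 \<le> j" if "j \<in> P2 - {v..<d1}" for j using that v(2)[of j] by auto
      show "inj_on (\<lambda>j. j - d1) (P2 - {v..<d1})"
        by (rule inj_onI) (use ge in \<open>metis eq_diff_iff\<close>)
      show "(\<lambda>j. j - d1) ` (P2 - {v..<d1}) \<subseteq> Bad" using ge shift(1) by blast
    qed simp
    finally show ?thesis by simp
  qed
  define Pf where "Pf = {j \<in> P2. fy j = fy v}"
  define PO where "PO = P2 - Pf"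
  have finP: "finite Pf" "finite PO" by (simp_all add: Pf_def PO_def)
  have span: "(real j - real i) * \<eta> < c" if "i \<in> P2" "j \<in> P2" "fy i = fy j" for i j
    using P2D(6)[OF that(1)] P2D(7)[OF that(2)] that(3) U_diff[of j i] by simp
  have "PO \<noteq> {}"
  proof
    assume "PO = {}"
    hence all: "fy j = fy v" if "j \<in> P2" for j using that by (auto simp: PO_def Pf_def)
    have "P2 \<subseteq> {v..<v + d1}"
    proof
      fix j assume j: "j \<in> P2"
      have "(real j - real v) * \<eta> < real d1 * \<eta>" using span[OF v(1) j] all[OF j] d1(1) by simp
      hence "real j - real v < real d1" using eta1 by simp
      thus "j \<in> {v..<v + d1}" using v(2)[OF j] by auto
    qed
    hence "card P2 \<le> d1" using card_mono[of "{v..<v + d1}" P2] by simp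
    thus False using d1_b k by linarith
  qed
  define u where "u = Min PO"
  have u: "u \<in> PO" using finP \<open>PO \<noteq> {}\<close> by (simp add: u_def)
  hence uP: "u \<in> P2" "fy u \<noteq> fy v" by (auto simp: PO_def Pf_def)
  define Pm where "Pm = {j \<in> PO. fy j = fy u}"
  define u' where "u' = Max Pm"
  define v' where "v' = Max Pf"
  have Pm: "finite Pm" "u \<in> Pm" "\<And>j. j \<in> Pm \<Longrightarrow> u \<le> j \<and> j \<le> u'" "u' \<in> Pm"
  proof -
    show f: "finite Pm" "u \<in> Pm" using finP u by (simp_all add: Pm_def)
    show "u' \<in> Pm" unfolding u'_def using f by (intro Max_in) auto
    fix j assume "j \<in> Pm"
    thus "u \<le> j \<and> j \<le> u'" using finP f unfolding u_def u'_def by (auto simp: Pm_def)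
  qed
  have Pf: "v \<in> Pf" "\<And>j. j \<in> Pf \<Longrightarrow> v \<le> j \<and> j \<le> v'" "v' \<in> Pf"
  proof -
    show f: "v \<in> Pf" using v by (simp add: Pf_def)
    show "v' \<in> Pf" unfolding v'_def using f finP by (intro Max_in) auto
    fix j assume "j \<in> Pf"
    thus "v \<le> j \<and> j \<le> v'" using finP v(2)[of j] unfolding v'_def by (auto simp: Pf_def)
  qed
  have u'P: "u' \<in> P2" "fy u' = fy u" "u \<le> u'" using Pm(3,4) by (auto simp: Pm_def PO_def)
  have v'P: "v' \<in> P2" "fy v' = fy v" "v \<le> v'" using Pf(2,3) by (auto simp: Pf_def)
  have far: "real d1 * \<eta> + c < (real j - real v) * \<eta> + c" "d1 \<le> j" if j: "j \<in> PO" for j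
  proof -
    have jP: "j \<in> P2" "fy j \<noteq> fy v" using j by (auto simp: PO_def Pf_def)
    have "fy v + 1 \<le> fy j" using fy_mono[OF v(2)[OF jP(1)] P2D(1)[OF jP(1)]] jP(2) by simp
    hence "real p * of_int (fy v + 1) \<le> real p * of_int (fy j)" using P by (intro mult_left_mono) simp_all
    hence "real p - c < U j - U v" using P2D(6)[OF jP(1)] P2D(7)[OF v(1)] by (simp add: algebra_simps)
    moreover have "real d1 * \<eta> < 2 * c" using d1(2) eta by (simp add: algebra_simps)
    ultimately have *: "real d1 * \<eta> < (real j - real v) * \<eta>" using c_small U_diff[of j v] by linarith
    thus "real d1 * \<eta> + c < (real j - real v) * \<eta> + c" by simp
    have "real d1 < real j - real v" using * eta1 by simp
    thus "d1 \<le> j" by linarith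
  qed
  \<comment> \<open>For the second lap of \<open>Y\<close> that meets \<open>P2\<close>, the shift
    by \<open>d1\<close> is replaced by \<open>n\<close> consecutive \<open>Bad\<close> times ending
    at \<open>u' - d1\<close>. They pay for that lap and for the first one, up to one time each,
    which is the deficit 2. They fit because \<open>Y\<close> spends more than \<open>2c\<close> of
    every lap outside the box.\<close>
  define n where "n = (u' - u) + (v' - v)"
  define Blk where "Blk = (\<lambda>i. u' - d1 - i) ` {..<n}"
  have n_real: "real n = (real u' - real u) + (real v' - real v)" using u'P(3) v'P(3) by (simp add: n_def of_nat_diff)
  have d1u: "d1 + n \<le> u' + 1"
  proof -
    have "fy v + 1 \<le> fy u" using fy_mono[OF v(2)[OF uP(1)] P2D(1)[OF uP(1)]] uP(2) by simp
    hence "real p * of_int (fy v + 1) \<le> real p * of_int (fy u)" using P by (intro mult_left_mono) simp_all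
    hence "real p - c < U u - U v" using P2D(6)[OF uP(1)] P2D(7)[OF v(1)] by (simp add: algebra_simps)
    moreover have "(real v' - real v) * \<eta> < c" by (rule span[OF v(1) v'P(1)]) (simp add: v'P)
    ultimately have "(real d1 - 1 + (real v' - real v)) * \<eta> < (real u - real v) * \<eta>"
      using d1(2) c_small U_diff[of u v] by (simp add: algebra_simps)
    hence "real d1 - 1 + (real v' - real v) < real u - real v" using eta1 by simp
    thus ?thesis using u'P(3) v'P(3) unfolding n_def by linarith
  qed
  have Blk: "t \<in> Bad" "fy t = fy u - 1" if tB: "t \<in> Blk" for t
  proof -
    obtain i where i: "i < n" "t = u' - d1 - i" using tB by (auto simp: Blk_def)
    have tr: "real t = real u' - real d1 - real i" using i d1u by (simp add: of_nat_diff)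
    have "U u' - U t = (real d1 + real i) * \<eta>" using U_diff[of u' t] tr by simp
    moreover have "real d1 * \<eta> \<le> (real d1 + real i) * \<eta>" using eta1 by (intro mult_right_mono) auto
    ultimately have 1: "U t \<le> real p * of_int (fy u')" using P2D(7)[OF u'P(1)] d1(1) by linarith
    have "(real d1 + real i) * \<eta> \<le> (real d1 + real n - 1) * \<eta>" using eta1 i(1) by (intro mult_right_mono) auto
    moreover have "U u' - (real d1 + real n - 1) * \<eta> = U u - (real d1 - 1) * \<eta> - (real v' - real v) * \<eta>"
      using U_diff[of u' u] unfolding n_real by (simp add: algebra_simps)
    moreover have "(real v' - real v) * \<eta> < c" by (rule span[OF v(1) v'P(1)]) (simp add: v'P)
    ultimately have "real p * of_int (fy u) - 2 * c < U t"
      using \<open>U u' - U t = (real d1 + real i) * \<eta>\<close> d1(2) P2D(6)[OF uP(1)] by linarith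
    hence 2: "real p * of_int (fy u' - 1) + c \<le> U t" using c_small u'P(2) by (simp add: algebra_simps)
    show "t \<in> Bad" "fy t = fy u - 1" using bad[OF u'P(1) _ 1 2] i u'P(2) by simp_all
  qed
  have cnt2: "card P2 \<le> card Bad + 2"
  proof -
    define Im where "Im = (\<lambda>j. j - d1) ` (PO - Pm)"
    have ge: "d1 \<le> j" if "j \<in> PO - Pm" for j using far(2) that by blast
    have "inj_on (\<lambda>j. j - d1) (PO - Pm)" by (rule inj_onI) (use ge in \<open>metis eq_diff_iff\<close>)
    hence c1: "card Im = card (PO - Pm)" by (simp add: Im_def card_image)
    have Im: "t \<in> Bad \<and> fy t \<noteq> fy u - 1" if tI: "t \<in> Im" for t
    proof -
      obtain j where j: "j \<in> PO - Pm" "t = j - d1" using tI by (auto simp: Im_def)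
      hence "j \<in> P2" "fy j \<noteq> fy u" by (auto simp: PO_def Pm_def)
      thus ?thesis using shift[of j] ge[OF j(1)] j(2) by simp
    qed
    have "inj_on (\<lambda>i. u' - d1 - i) {..<n}" by (rule inj_onI) (use d1u in auto)
    hence c2: "card Blk = n" by (simp add: Blk_def card_image)
    have "Im \<inter> Blk = {}" using Im Blk(2) by blast
    moreover have "finite Im" "finite Blk" using finP by (simp_all add: Im_def Blk_def)
    ultimately have "card (PO - Pm) + n = card (Im \<union> Blk)" using c1 c2 by (simp add: card_Un_disjoint)
    also have "\<dots> \<le> card Bad" by (rule card_mono) (use Im Blk(1) in auto)
    finally have c3: "card (PO - Pm) + n \<le> card Bad" .
    have "card Pm \<le> card {u..u'}" by (rule card_mono) (use Pm(3) in auto)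
    moreover have "card Pf \<le> card {v..v'}" by (rule card_mono) (use Pf(2) in auto)
    moreover have "card PO = card (PO - Pm) + card Pm"
      using card_Diff_subset[of Pm PO] Pm(1) card_mono[of PO Pm] finP by (simp add: Pm_def)
    moreover have "card P2 = card PO + card Pf"
      using card_Diff_subset[of Pf P2] finP card_mono[of P2 Pf] by (simp add: PO_def Pf_def)
    ultimately show ?thesis using c3 u'P(3) v'P(3) by (simp add: n_def)
  qed
  have "int (card P0 + card P1) + int (card P2) + int (card Bad) = int p" using card_partition by linarith
  moreover have "int (card P2) \<le> int (card Bad) + 2" using cnt2 by linarith
  moreover have "a + b \<le> int (card Bad) + int (card P0 + card P1)" using card_low(2)[OF m] by simp
  moreover have "3 * k < int p" using k(1) by linarith
  ultimately have res: "int (card Neg) = 0" "int (card P0 + card P1) = a" "int (card Bad) < int (card P2)"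
    "a = b \<or> b = a + 1 \<and> b = k \<and> int p = 3 * k + 1 \<and> int (card P2) = int (card Bad) + 2 \<and> int (card P2) = k + 2"
    using nearly_tight_count[OF _ k(4) _ _ card_low(1)[OF m] a_le_b k(3) _ of_nat_0_le_iff, of "card P2"] by blast+
  have noNeg: "F j \<noteq> 0" "F j = 1 \<Longrightarrow> c \<le> Y j \<and> d \<le> Z j" if "j < p" "b \<le> x j" "x j < a + b" for j
  proof -
    have "Neg = {}" using res(1) by simp
    hence "j \<notin> Neg" by simp
    thus "F j \<noteq> 0" "F j = 1 \<Longrightarrow> c \<le> Y j \<and> d \<le> Z j" using that unfolding Neg_def by auto
  qed
  have lowP: "j \<in> P0 \<union> P1" if "j < p" "x j < a" for j
    by (rule full_low[OF m _ that]) (use res(2) in simp)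
  have ahead: "x (i + h) = x i + int h * w" if ih: "i + h < p" "0 \<le> x i + int h * w" "x i + int h * w < int p" for i h
  proof -
    obtain kx where "x (i + h) = x i + (int (i + h) - int i) * w - int p * kx"
      using diffE[OF m _ ih(1), of i] ih(1) by auto
    hence "x (i + h) - (x i + int h * w) = int p * - kx" by simp
    moreover have "\<bar>x (i + h) - (x i + int h * w)\<bar> < int p" using x_range[OF ih(1)] ih by auto
    ultimately have "x (i + h) - (x i + int h * w) = 0"
      using dvd_imp_le_int[of "x (i + h) - (x i + int h * w)" "int p"] by fastforce
    thus ?thesis by simp
  qed
  have start: "a + b \<le> x 0 + int v * w"
  proof -
    have "0 \<le> fx v" using fx_mono[of 0 v] fx0 P2D(1)[OF v(1)] by simp
    hence "0 \<le> int p * fx v" by simp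
    thus ?thesis using P2D(5)[OF v(1)] fx[OF P2D(1)[OF v(1)]] by linarith
  qed
  \<comment> \<open>The walk closes up: \<open>p\<close> steps move \<open>x\<close> by a multiple
    of \<open>p\<close>, so time 0 acts as the successor of time \<open>p - 1\<close>.\<close>
  have first: "x 0 = x i + w" if "Suc i = p" "x i + w < int p" for i
  proof -
    have ip: "i < p" using that by simp
    have "x i + w - x 0 = int (Suc i) * w - int p * fx i" using fx[OF ip] by (simp add: algebra_simps)
    also have "\<dots> = int p * (w - fx i)" using that(1) by (simp add: algebra_simps)
    finally have "int p dvd x i + w - x 0" by simp
    moreover have "\<bar>x i + w - x 0\<bar> < int p" using x_range[OF ip] x_range[of 0] that(2) w_pos p_ge by auto
    ultimately have "x i + w - x 0 = 0" using dvd_imp_le_int[of "x i + w - x 0" "int p"] by fastforce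
    thus ?thesis by simp
  qed
  have abp: "a + b < int p" using a_le_b b_small a_pos by linarith
  \<comment> \<open>With \<open>Neg\<close> empty, landing there requires \<open>F\<close> nonzero,
    and \<open>F = 1\<close> only with \<open>Y >= c\<close> and \<open>Z >= d\<close>. From
    \<open>P0\<close> this needs a wrap of \<open>Y\<close> that ends at \<open>c\<close> or beyond,
    so \<open>h * \<eta> >= c\<close>; from \<open>P1\<close> it is impossible, since
    \<open>Z\<close> only falls from below \<open>d\<close>.\<close>
  have leap: "c \<le> real h * \<eta> \<and> 2 \<le> h" if h: "h \<in> {1, 2}" "i + h < p" "x i < a" "b \<le> x i + int h * w" "x i + int h * w < a + b" for i h
  proof -
    have ip: "i < p" using h by simp
    obtain ky kz where s: "Y (i + h) = Y i + (real (i + h) - real i) * \<eta> - real p * of_int ky"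
      "Z (i + h) = Z i + (real (i + h) - real i) * - \<zeta> - real p * of_int kz"
      "F (i + h) = F i + (fy (i + h) - fy i) + (fz (i + h) - fz i) - (fx (i + h) - fx i)"
      "ky = fy (i + h) - fy i" "kz = fz (i + h) - fz i"
    proof -
      show ?thesis
        by (rule that[of "fy (i + h) - fy i" "fz (i + h) - fz i"])
           (use fy[OF ip] fy[OF h(2)] fz[OF ip] fz[OF h(2)] FF[OF ip] FF[OF h(2)] in \<open>simp_all add: algebra_simps\<close>)
    qed
    have xh: "x (i + h) = x i + int h * w" using ahead[OF h(2)] h x_range[OF ip] w_pos abp by simp
    have "int p * fx (i + h) = int p * fx i"
      using xh fx[OF ip] fx[OF h(2)] unfolding of_nat_add distrib_right by linarith
    hence fxh: "fx (i + h) = fx i" using p_ge by simp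
    have nn: "F (i + h) \<noteq> 0" "F (i + h) = 1 \<Longrightarrow> c \<le> Y (i + h) \<and> d \<le> Z (i + h)"
      using noNeg[OF h(2)] xh h by auto
    have hr: "real h * \<eta> < 2 * c" "0 < real h * \<eta>" "0 < real h * \<zeta>" using h(1) eta eta1 c_pos ze by auto
    have sY: "Y (i + h) = Y i + real h * \<eta> - real p * of_int ky" using s(1) by simp
    have sZ: "Z (i + h) = Z i - real h * \<zeta> - real p * of_int kz" using s(2) by simp
    have kyb: "0 \<le> ky" "kz \<le> 0" using s(4,5) fy_mono[of i "i + h"] fz_anti[of i "i + h"] h(2) by simp_all
    have "real p * of_int ky < real p * of_int 2"
      using sY Y_range[OF ip] Y_range[OF h(2)] hr c_small c_pos by linarith
    hence "ky < 2" using int_less_of_mult_less[OF _ P] by blast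
    from lowP[OF ip h(3)] show ?thesis
    proof
      assume "i \<in> P0"
      hence "ky + kz \<noteq> 0" using nn(1) s(3-5) fxh by (simp add: P0_def)
      moreover have "ky + kz \<ge> 0" using F_nonneg[OF h(2)] s(3-5) fxh \<open>i \<in> P0\<close> by (simp add: P0_def)
      ultimately have "ky = 1" "kz = 0" using kyb \<open>ky < 2\<close> by linarith+
      hence "F (i + h) = 1" using s(3-5) fxh \<open>i \<in> P0\<close> by (simp add: P0_def)
      hence "c \<le> Y (i + h)" using nn(2) by simp
      moreover have "Y (i + h) \<le> real h * \<eta>" using sY \<open>ky = 1\<close> Y_range[OF ip] by simp
      ultimately have "c \<le> real h * \<eta>" by simp
      moreover have "h \<noteq> 1" using calculation eta by auto
      ultimately show ?thesis using h(1) by auto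
    next
      assume iP: "i \<in> P1"
      hence T: "F i = 1" "Y i < c" "Z i < d" by (simp_all add: P1_def)
      have "real p * of_int ky < real p * of_int 1" using sY T Y_range[OF h(2)] hr c_small by linarith
      hence "ky < 1" using int_less_of_mult_less[OF _ P] by blast
      hence "ky = 0" using kyb by simp
      hence "F (i + h) = 1 + kz" using s(3-5) fxh T by simp
      hence "kz = 0" "F (i + h) = 1" using nn(1) F_nonneg[OF h(2)] kyb by linarith+
      hence "d \<le> Z (i + h)" "Z (i + h) = Z i - real h * \<zeta>" using nn(2) sZ by simp_all
      thus ?thesis using T hr by simp
    qed
  qed
  have no_leap: False if "Suc i < p" "x i < a" "b \<le> x i + w" "x i + w < a + b" for i
    using leap[of 1 i] that by simp
  from res(4) show False
  proof
    \<comment> \<open>A step from residue \<open>a - 1\<close> would be a leap of length one, so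
      \<open>a - 1\<close> comes at the last time. If \<open>w = 1\<close>, the walk starts at
      \<open>a\<close>, reaches \<open>P2\<close> not before time \<open>b >= d1\<close>, and the
      deficit vanishes. If \<open>w >= 2\<close>, residue \<open>a - 2\<close> would have to come
      last as well.\<close>
    assume ab: "a = b"
    show False
    proof (cases "w = 1")
      case True
      obtain i where i: "i < p" "x i = a - 1" using x_surj[OF m, of "a - 1"] a_pos abp a_le_b by auto
      have "\<not> Suc i < p" using no_leap[of i] i ab True a_pos by auto
      hence "x 0 = a" using first[of i] i True abp a_pos a_le_b by auto
      hence "b \<le> int v" using start True by simp
      hence "d1 - v = 0" using d1_b by linarith
      thus False using cnt1 res(3) by simp
    next
      case False
      hence w2: "2 \<le> w" using w_pos by simp
      obtain i where i: "i < p" "x i = a - 1" using x_surj[OF m, of "a - 1"] a_pos abp a_le_b by auto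
      obtain i' where i': "i' < p" "x i' = a - 2" using x_surj[OF m, of "a - 2"] w2 wb ab abp a_le_b by auto
      have "\<not> Suc i < p" using no_leap[of i] i ab w2 wb by auto
      moreover have "\<not> Suc i' < p" using no_leap[of i'] i' ab w2 wb by auto
      ultimately have "i = i'" using i i' by simp
      thus False using i i' by simp
    qed
  next
    \<comment> \<open>Here the deficit is exactly 2, so \<open>cnt1\<close> forces \<open>P2\<close>
      to be met at least two steps before time \<open>d1\<close>.\<close>
    assume ab: "b = a + 1 \<and> b = k \<and> int p = 3 * k + 1 \<and> int (card P2) = int (card Bad) + 2 \<and> int (card P2) = k + 2"
    hence d1v: "v + 2 \<le> d1" using cnt1 by linarith
    obtain i where i: "i < p" "x i = a - 1" using x_surj[OF m, of "a - 1"] a_pos abp a_le_b by auto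
    show False
    proof (cases "w = 1")
      case False
      hence w2: "2 \<le> w" using w_pos by simp
      have "\<not> Suc i < p" using no_leap[of i] i ab w2 wb by auto
      hence "x 0 = a - 1 + w" using first[of i] i w2 wb abp by auto
      hence "a + b \<le> a - 1 + (int v + 1) * w" using start by (simp add: algebra_simps)
      moreover have "(int v + 1) * w \<le> (int d1 - 1) * w" using d1v w_pos by (intro mult_right_mono) auto
      ultimately show False using d1_w by simp
    next
      case True
      have s1: "Suc i < p"
      proof (rule ccontr)
        assume "\<not> Suc i < p"
        hence "x 0 = a" using first[of i] i True abp a_pos a_le_b by auto
        hence "b \<le> int v" using start True by simp
        thus False using d1_b d1v by linarith
      qed
      have x1: "x (Suc i) = a" using ahead[of i 1] s1 i True abp a_pos a_le_b by simp
      have s2: "i + 2 < p"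
      proof (rule ccontr)
        assume "\<not> i + 2 < p"
        hence "x 0 = a + 1" using first[of "Suc i"] s1 x1 True abp a_pos a_le_b by auto
        hence "b - 1 \<le> int v" using start True by simp
        thus False using d1_b d1v by linarith
      qed
      \<comment> \<open>Two unit steps from \<open>a - 1\<close> to \<open>a + 1 = b\<close> form a
        leap. With \<open>c <= 2 * \<eta>\<close>, \<open>P2\<close> times cannot be two steps
        apart, yet each of the three residues \<open>2k - 1\<close>, \<open>2k\<close>,
        \<open>2k + 1\<close> would have such a partner unless it is at one of the last two
        times.\<close>
      have c2: "c \<le> 2 * \<eta>" using leap[of 2 i] s2 i True ab a_pos a_le_b by simp
      have k3: "3 \<le> k"
      proof -
        have "a = k - 1" "b = k" "int p = 3 * k + 1" using ab by auto
        thus ?thesis using region by simp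
      qed
      have full: "j \<in> P2" if "j < p" "a + b \<le> x j" for j
      proof (rule full_high[OF m _ that])
        have "b = a + 1" "b = k" "int p = 3 * k + 1" "int (card P2) = k + 2" using ab by blast+
        thus "int (card P2) = int p - a - b" by linarith
      qed
      have key: "\<not> j + 2 < p" if j: "j < p" "2 * k - 1 \<le> x j" "x j \<le> 2 * k + 1" for j
      proof
        assume j2: "j + 2 < p"
        have "x (j + 2) = x j + 2" using ahead[of j 2] j j2 True ab k3 by simp
        hence "j \<in> P2" "j + 2 \<in> P2" using full[OF j(1)] full[OF j2] j ab by simp_all
        hence T: "Y j < c" "Y (j + 2) < c" "0 < Y j" "0 < Y (j + 2)" using P2D by simp_all
        have s: "Y (j + 2) = Y j + 2 * \<eta> - real p * of_int (fy (j + 2) - fy j)"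
          using fy[OF j(1)] fy[OF j2] by (simp add: algebra_simps)
        have "real p * of_int (fy (j + 2) - fy j) < real p * of_int 1" using s T eta c_small by linarith
        hence "fy (j + 2) - fy j < 1" using int_less_of_mult_less[OF _ P] by blast
        hence "fy (j + 2) = fy j" using fy_mono[of j "j + 2"] j2 by simp
        thus False using s T c2 by simp
      qed
      obtain j1 where j1: "j1 < p" "x j1 = 2 * k - 1" using x_surj[OF m, of "2 * k - 1"] ab k3 by auto
      obtain j2 where j2: "j2 < p" "x j2 = 2 * k" using x_surj[OF m, of "2 * k"] ab k3 by auto
      obtain j3 where j3: "j3 < p" "x j3 = 2 * k + 1" using x_surj[OF m, of "2 * k + 1"] ab k3 by auto
      have "\<not> j1 + 2 < p" "\<not> j2 + 2 < p" "\<not> j3 + 2 < p" using key[of j1] key[of j2] key[of j3] j1 j2 j3 by simp_all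
      moreover have "j1 \<noteq> j2" "j1 \<noteq> j3" "j2 \<noteq> j3" using j1 j2 j3 by auto
      ultimately show False using j1(1) j2(1) j3(1) by linarith
    qed
  qed
qed

end

section \<open>Symmetries of the walk and reduction of an arbitrary step\<close>

lemma walk_swap:
  assumes "walk p a b c d x F Y Z \<nu>"
  shows "walk p a b d c x F Z Y \<nu>"
    and "walk.bounded p a b d c x F Z Y \<longleftrightarrow> walk.bounded p a b c d x F Y Z"
    and "walk.moves p x Y Z w \<eta> \<zeta> \<Longrightarrow> walk.moves p x Z Y w \<zeta> \<eta>"
proof -
  interpret A: walk p a b c d x F Y Z \<nu> by fact
  show "walk p a b d c x F Z Y \<nu>"
    using assms unfolding walk_def by (simp add: add.commute)
  then interpret B: walk p a b d c x F Z Y \<nu> .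
  have "B.P1 = A.P1" "B.P2 = A.P2" "B.Neg = A.Neg" "B.P0 = A.P0"
    by (auto simp: A.P0_def A.P1_def A.P2_def A.Neg_def B.P0_def B.P1_def B.P2_def B.Neg_def)
  thus "B.bounded \<longleftrightarrow> A.bounded" by (simp add: A.bounded_def B.bounded_def)
  show "A.moves w \<eta> \<zeta> \<Longrightarrow> B.moves w \<zeta> \<eta>"
    unfolding A.moves_def B.moves_def by (simp add: add.commute)
qed

text \<open>The zones depend on positions and not on their order, so running time backwards keeps
  all counts and only negates the steps.\<close>

lemma walk_reverse:
  assumes "walk p a b c d x F Y Z \<nu>"
  defines "r \<equiv> \<lambda>j. p - 1 - j"
  shows "walk p a b c d (x \<circ> r) (F \<circ> r) (Y \<circ> r) (Z \<circ> r) \<nu>"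
    and "walk.bounded p a b c d (x \<circ> r) (F \<circ> r) (Y \<circ> r) (Z \<circ> r) \<longleftrightarrow> walk.bounded p a b c d x F Y Z"
    and "walk.moves p x Y Z w \<eta> \<zeta> \<Longrightarrow> walk.moves p (x \<circ> r) (Y \<circ> r) (Z \<circ> r) (- w) (- \<eta>) (- \<zeta>)"
proof -
  interpret A: walk p a b c d x F Y Z \<nu> by fact
  have p0: "0 < p" using A.p_ge by simp
  have rl: "r j < p" if "j < p" for j using that by (simp add: r_def)
  show W: "walk p a b c d (x \<circ> r) (F \<circ> r) (Y \<circ> r) (Z \<circ> r) \<nu>"
    using A.prime_p A.a_pos A.a_le_b A.b_small A.c_le A.d_le A.cd A.region A.x_range[OF rl] A.Y_range[OF rl]
      A.Z_range[OF rl] A.F_nonneg[OF rl] A.balance[OF rl] by unfold_locales simp_all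
  then interpret B: walk p a b c d "x \<circ> r" "F \<circ> r" "Y \<circ> r" "Z \<circ> r" \<nu> .
  have card: "card {j. j < p \<and> Q (r j)} = card {j. j < p \<and> Q j}" for Q
  proof (rule bij_betw_same_card)
    show "bij_betw r {j. j < p \<and> Q (r j)} {j. j < p \<and> Q j}"
      by (rule bij_betw_byWitness[where f' = r]) (use p0 in \<open>auto simp: r_def\<close>)
  qed
  have "card B.P0 = card A.P0" unfolding A.P0_def B.P0_def using card[of "\<lambda>j. x j < a \<and> F j = 0"] by simp
  moreover have "card B.P1 = card A.P1" unfolding A.P1_def B.P1_def
    using card[of "\<lambda>j. x j < a \<and> F j = 1 \<and> Y j < c \<and> Z j < d"] by simp
  moreover have "card B.P2 = card A.P2" unfolding A.P2_def B.P2_def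
    using card[of "\<lambda>j. a + b \<le> x j \<and> F j = 2 \<and> Y j < c \<and> Z j < d"] by simp
  moreover have "card B.Neg = card A.Neg" unfolding A.Neg_def B.Neg_def
    using card[of "\<lambda>j. b \<le> x j \<and> x j < a + b \<and> (F j = 0 \<or> F j = 1 \<and> (Y j < c \<or> Z j < d))"] by simp
  ultimately show "B.bounded \<longleftrightarrow> A.bounded" by (simp add: A.bounded_def B.bounded_def)
  assume m: "A.moves w \<eta> \<zeta>"
  have r0: "r 0 < p" "real (r 0) = real p - 1" "int (r 0) = int p - 1" using p0 by (auto simp: r_def of_nat_diff)
  have rj: "real (r j) = real p - 1 - real j" "int (r j) = int p - 1 - int j" if "j < p" for j
    using that by (auto simp: r_def of_nat_diff)
  show "B.moves (- w) (- \<eta>) (- \<zeta>)"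
  proof (rule B.movesI)
    show "of_int (- w) = - \<eta> + - \<zeta>" using m by (simp add: A.moves_def)
    show "coprime (- w) (int p)" using m by (simp add: A.moves_def)
    fix j assume j: "j < p"
    obtain kx ky kz where k: "x (r j) = x (r 0) + (int (r j) - int (r 0)) * w - int p * kx"
      "Y (r j) = Y (r 0) + (real (r j) - real (r 0)) * \<eta> - real p * of_int ky"
      "Z (r j) = Z (r 0) + (real (r j) - real (r 0)) * \<zeta> - real p * of_int kz"
      using A.diffE[OF m r0(1) rl[OF j]] by metis
    show "\<exists>k. (x \<circ> r) j = (x \<circ> r) 0 + int j * - w - int p * k"
      by (rule exI[of _ kx]) (use k(1) r0 rj[OF j] in simp)
    show "\<exists>k. (Y \<circ> r) j = (Y \<circ> r) 0 + real j * - \<eta> - real p * real_of_int k"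
      by (rule exI[of _ ky]) (use k(2) r0 rj[OF j] in simp)
    show "\<exists>k. (Z \<circ> r) j = (Z \<circ> r) 0 + real j * - \<zeta> - real p * real_of_int k"
      by (rule exI[of _ kz]) (use k(3) r0 rj[OF j] in simp)
  qed
qed

text \<open>A step \<theta> close to \<open>p\<close> is the backward step
  \<open>\<theta> - p\<close>. After reversing time, \<open>Y\<close> advances by
  \<open>p - \<theta> < c\<close> and \<open>Z\<close> retreats by \<zeta>.\<close>

lemma bounded_if_wrapping_up:
  assumes W: "walk p a b c d x F Y Z \<nu>" and m: "walk.moves p x Y Z \<omega> \<theta> \<zeta>"
    and "\<omega> < int p" "real p - c < \<theta>" "0 < \<zeta>"
  shows "walk.bounded p a b c d x F Y Z"
proof -
  interpret A: walk p a b c d x F Y Z \<nu> by fact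
  define r where "r = (\<lambda>j. p - 1 - j)"
  interpret B: walk p a b c d "x \<circ> r" "F \<circ> r" "Y \<circ> r" "Z \<circ> r" \<nu>
    unfolding r_def by (rule walk_reverse(1)[OF W])
  have "A.moves (\<omega> - int p) (\<theta> - real p) \<zeta>" using A.moves_shift[OF m, of "- 1" 0] by simp
  hence "B.moves (- (\<omega> - int p)) (- (\<theta> - real p)) (- \<zeta>)"
    unfolding r_def by (rule walk_reverse(3)[OF W])
  hence B.bounded by (rule B.bounded_if_fast) (use assms in simp_all)
  thus A.bounded unfolding r_def by (simp only: walk_reverse(2)[OF W])
qed

context walk
begin

lemma bounded_positive:
  assumes m: "moves \<omega> \<theta> \<zeta>" and pos: "0 < \<theta>" "0 < \<zeta>" "\<omega> < int p"
    and ab: "[\<omega> = a * b] (mod int p) \<or> [\<omega> = - (a * b)] (mod int p)"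
  shows bounded
proof -
  have W: "walk p a b c d x F Y Z \<nu>" by (rule walk_axioms)
  have w: "of_int \<omega> = \<theta> + \<zeta>" using m by (simp add: moves_def)
  have w': "real_of_int \<omega> < real p" using pos(3) by (metis of_int_less_iff of_int_of_nat_eq)
  consider "\<not> ((\<theta> < c \<or> real p - c < \<theta>) \<and> (\<zeta> < d \<or> real p - d < \<zeta>))" | "\<theta> < c" "\<zeta> < d"
    | "real p - c < \<theta>" | "real p - d < \<zeta>" by blast
  thus ?thesis
  proof cases
    case 1
    thus ?thesis by (rule bounded_if_large_step[OF m pos _ ab])
  next
    case 2
    thus ?thesis using bounded_if_slow[OF m] pos by simp
  next
    case 3
    thus ?thesis using bounded_if_wrapping_up[OF W m] pos by simp
  next
    case 4
    have "walk.bounded p a b d c x F Z Y"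
      using bounded_if_wrapping_up[OF walk_swap(1)[OF W] walk_swap(3)[OF W m]] 4 pos by simp
    thus ?thesis by (simp only: walk_swap(2)[OF W])
  qed
qed

text \<open>Both steps are reduced into the open interval from 0 to \<open>p\<close>. If their sum
  exceeds \<open>p\<close>, time is reversed and \<open>p\<close> added to each, which gives the sum
  \<open>2p - \<omega> < p\<close>. Reversal flips the sign of the step, which is why the congruence
  is stated up to sign.\<close>

theorem bounded_if_moves:
  assumes m: "moves w \<eta> \<zeta>" and ab: "[w = a * b] (mod int p) \<or> [w = - (a * b)] (mod int p)"
    and ni: "\<And>n::int. \<eta> \<noteq> real p * of_int n" "\<And>n::int. \<zeta> \<noteq> real p * of_int n"
  shows bounded
proof -
  have W: "walk p a b c d x F Y Z \<nu>" by (rule walk_axioms)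
  have P: "real p > 0" using p_ge by simp
  have frac: "\<exists>n::int. 0 < t + real p * of_int n \<and> t + real p * of_int n < real p"
    if t: "\<And>n::int. t \<noteq> real p * of_int n" for t
  proof -
    define u where "u = t / real p"
    have u: "t = real p * u" using P by (simp add: u_def)
    hence "u \<noteq> of_int \<lfloor>u\<rfloor>" using t by metis
    hence "0 < u - of_int \<lfloor>u\<rfloor>" "u - of_int \<lfloor>u\<rfloor> < 1" by linarith+
    hence "0 < real p * (u - of_int \<lfloor>u\<rfloor>)" "real p * (u - of_int \<lfloor>u\<rfloor>) < real p" using P by simp_all
    thus ?thesis by (intro exI[of _ "- \<lfloor>u\<rfloor>"]) (simp add: u algebra_simps)
  qed
  obtain n1 n2 :: int where n: "0 < \<eta> + real p * of_int n1" "\<eta> + real p * of_int n1 < real p"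
    "0 < \<zeta> + real p * of_int n2" "\<zeta> + real p * of_int n2 < real p"
    using frac[OF ni(1)] frac[OF ni(2)] by blast
  define \<omega> \<theta> \<tau> where "\<omega> = w + int p * (n1 + n2)" and "\<theta> = \<eta> + real p * of_int n1" and "\<tau> = \<zeta> + real p * of_int n2"
  have m': "moves \<omega> \<theta> \<tau>" unfolding \<omega>_def \<theta>_def \<tau>_def by (rule moves_shift[OF m])
  have ab': "[\<omega> = a * b] (mod int p) \<or> [\<omega> = - (a * b)] (mod int p)"
    using ab by (simp add: \<omega>_def cong_def)
  show ?thesis
  proof (cases "\<omega> < int p")
    case True
    show ?thesis by (rule bounded_positive[OF m' _ _ True ab']) (use n in \<open>simp_all add: \<theta>_def \<tau>_def\<close>)
  next
    case False
    have "\<omega> \<noteq> int p"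
    proof
      assume "\<omega> = int p"
      hence "coprime (int p) (int p)" using m' by (simp add: moves_def)
      thus False using p_ge by simp
    qed
    define r where "r = (\<lambda>j. p - 1 - j)"
    interpret B: walk p a b c d "x \<circ> r" "F \<circ> r" "Y \<circ> r" "Z \<circ> r" \<nu>
      unfolding r_def by (rule walk_reverse(1)[OF W])
    have "B.moves (- \<omega>) (- \<theta>) (- \<tau>)" unfolding r_def by (rule walk_reverse(3)[OF W m'])
    hence mB: "B.moves (- \<omega> + int p * (1 + 1)) (- \<theta> + real p * of_int 1) (- \<tau> + real p * of_int 1)"
      by (rule B.moves_shift)
    have "[- \<omega> = a * b] (mod int p) \<or> [- \<omega> = - (a * b)] (mod int p)"
      using ab' cong_minus_minus_iff[of \<omega> "a * b" "int p"] cong_minus_minus_iff[of \<omega> "- (a * b)" "int p"] by auto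
    hence abB: "[- \<omega> + int p * (1 + 1) = a * b] (mod int p) \<or> [- \<omega> + int p * (1 + 1) = - (a * b)] (mod int p)"
      unfolding cong_def by (simp only: mod_mult_self2)
    have B.bounded
      by (rule B.bounded_positive[OF mB _ _ _ abB])
         (use n False \<open>\<omega> \<noteq> int p\<close> in \<open>simp_all add: \<theta>_def \<tau>_def\<close>)
    thus ?thesis unfolding r_def by (simp only: walk_reverse(2)[OF W])
  qed
qed

end

section \<open>From the cyclotomic polynomial to backward differences\<close>

lemma prod_cyclotomic:
  assumes "n > 0"
  shows "(\<Prod>d | d dvd n. cyclotomic d) = monom 1 n - 1"
proof -
  have pos: "d > 0" if "d dvd n" for d using that assms by (auto intro!: Nat.gr0I)
  have "map_poly of_int (\<Prod>d | d dvd n. cyclotomic d) = (\<Prod>d | d dvd n. cyclotomic_complex d)"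
    unfolding map_poly_of_int_prod by (intro prod.cong refl map_poly_of_int_cyclotomic) (use pos in auto)
  also have "\<dots> = monom 1 n - 1" by (rule prod_cyclotomic_complex[OF assms])
  also have "\<dots> = map_poly of_int (monom 1 n - 1)" by (rule poly_eqI) (simp add: coeff_map_poly)
  finally show ?thesis by (simp only: map_poly_of_int_eq_iff)
qed

lemma divisors_prime_mult:
  fixes p n :: nat
  assumes "prime p"
  shows "{d. d dvd p * n} = {d. d dvd n} \<union> (\<lambda>d. p * d) ` {d. d dvd n}"
proof (intro equalityI subsetI)
  fix d assume "d \<in> {d. d dvd p * n}"
  hence d: "d dvd p * n" by simp
  show "d \<in> {d. d dvd n} \<union> (\<lambda>d. p * d) ` {d. d dvd n}"
  proof (cases "p dvd d")
    case True
    then obtain e where "d = p * e" by (elim dvdE)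
    moreover have "p \<noteq> 0" using assms by auto
    ultimately show ?thesis using d by auto
  next
    case False
    with assms have "coprime p d" by (rule prime_imp_coprime)
    hence "coprime d p" by (simp add: coprime_commute)
    thus ?thesis using d by (simp add: coprime_dvd_mult_right_iff)
  qed
qed auto

lemma prod_divisors_prime_mult:
  fixes p n :: nat
  assumes "prime p" "\<not> p dvd n" "n > 0"
  shows "(\<Prod>d | d dvd p * n. f d) = (\<Prod>d | d dvd n. f d) * (\<Prod>d | d dvd n. f (p * d))"
proof -
  have "p \<noteq> 0" using assms by auto
  have "{d. d dvd n} \<inter> (\<lambda>d. p * d) ` {d. d dvd n} = {}" using assms by (auto dest: dvd_mult_left)
  moreover have "inj_on (\<lambda>d. p * d) {d. d dvd n}" using \<open>p \<noteq> 0\<close> by (simp add: inj_on_def)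
  ultimately show ?thesis
    unfolding divisors_prime_mult[OF assms(1)] using assms(3)
    by (subst prod.union_disjoint) (auto simp: prod.reindex)
qed

text \<open>Sorting the divisors of \<open>p * n\<close> by divisibility by \<open>p\<close> gives
  \<open>\<Psi> (p * n) = \<Psi> n * G n\<close>. In the instances \<open>n = 1, q, r, q * r\<close>
  the smaller cyclotomic factors balance. Keeping products on both sides avoids polynomial
  division.\<close>

lemma cyclotomic_pqr_identity:
  fixes p q r :: nat
  assumes "prime p" "prime q" "prime r" "p \<noteq> q" "p \<noteq> r" "q \<noteq> r"
  shows "(1 - monom 1 1) * ((1 - monom 1 (p * q)) * ((1 - monom 1 (p * r)) * ((1 - monom 1 (q * r)) * cyclotomic (p * q * r)))) =
    (1 - monom 1 (p * q * r)) * ((1 - monom 1 p) * ((1 - monom 1 q) * (1 - monom 1 r)))"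
proof -
  define \<Psi> :: "nat \<Rightarrow> int poly" where "\<Psi> n = monom 1 n - 1" for n
  define G where "G n = (\<Prod>d | d dvd n. cyclotomic (p * d))" for n
  have nd: "\<not> p dvd q" "\<not> p dvd r" "\<not> q dvd r" "\<not> p dvd q * r"
    using assms by (auto simp: primes_dvd_imp_eq prime_dvd_mult_iff)
  have pos: "p > 0" "q > 0" "r > 0" "p > 1" "q > 1" "r > 1" using assms(1-3)[THEN prime_gt_1_nat] by simp_all
  have \<Psi>G: "\<Psi> (p * n) = \<Psi> n * G n" if "\<not> p dvd n" "n > 0" for n
    using prod_divisors_prime_mult[OF assms(1) that, of cyclotomic] prod_cyclotomic[of n] prod_cyclotomic[of "p * n"] that pos
    by (simp add: \<Psi>_def G_def)
  have div: "{d. d dvd q} = {1, q}" "{d. d dvd r} = {1, r}"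
    using assms by (auto simp: prime_nat_iff)
  have divqr: "{d. d dvd q * r} = {1, r, q, q * r}"
    unfolding divisors_prime_mult[OF assms(2)] div(2) by auto
  have G: "G 1 = cyclotomic p" "G q = cyclotomic p * cyclotomic (p * q)" "G r = cyclotomic p * cyclotomic (p * r)"
    "G (q * r) = cyclotomic p * cyclotomic (p * r) * cyclotomic (p * q) * cyclotomic (p * q * r)"
    unfolding G_def div divqr using pos assms(6) by (simp_all add: mult_ac)
  have "\<Psi> (p * q * r) = \<Psi> (q * r) * G (q * r)" "\<Psi> (p * q) = \<Psi> q * G q" "\<Psi> (p * r) = \<Psi> r * G r" "\<Psi> p = \<Psi> 1 * G 1"
    using \<Psi>G[of "q * r"] \<Psi>G[of q] \<Psi>G[of r] \<Psi>G[of 1] nd pos by (simp_all add: mult.assoc)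
  hence "\<Psi> 1 * (\<Psi> (p * q) * (\<Psi> (p * r) * (\<Psi> (q * r) * cyclotomic (p * q * r)))) =
    \<Psi> (p * q * r) * (\<Psi> p * (\<Psi> q * \<Psi> r))"
    unfolding G by (simp add: mult_ac)
  moreover have "1 - monom 1 n = - \<Psi> n" for n by (simp add: \<Psi>_def)
  ultimately show ?thesis by simp
qed

text \<open>Multiplication of a power series by \<open>1 - x^k\<close>, on coefficient functions
  over all integers, so that no case distinction on \<open>k <= m\<close> arises.\<close>

definition bdiff :: "int \<Rightarrow> (int \<Rightarrow> int) \<Rightarrow> int \<Rightarrow> int" where
  "bdiff k f m = f m - f (m - k)"

definition pcoeff :: "int poly \<Rightarrow> int \<Rightarrow> int" where
  "pcoeff P m = (if m < 0 then 0 else coeff P (nat m))"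

lemma cyclotomic_coeff_eq: "cyclotomic_coeff n = pcoeff (cyclotomic n)"
  by (rule ext) (simp add: cyclotomic_coeff_def pcoeff_def)

lemma pcoeff_mult: "pcoeff ((1 - monom 1 k) * P) = bdiff (int k) (pcoeff P)"
proof
  fix m
  show "pcoeff ((1 - monom 1 k) * P) m = bdiff (int k) (pcoeff P) m"
    by (auto simp: pcoeff_def bdiff_def left_diff_distrib coeff_monom_mult nat_diff_distrib)
qed

lemma bdiff_commute: "bdiff k (bdiff l f) = bdiff l (bdiff k f)"
  by (rule ext) (simp add: bdiff_def algebra_simps)

lemma bdiff_minus: "bdiff k (\<lambda>m. f m - g m) = (\<lambda>m. bdiff k f m - bdiff k g m)"
  by (rule ext) (simp add: bdiff_def)

lemma bdiff_neg: "\<lbrakk>\<And>m. m < 0 \<Longrightarrow> f m = 0; m < 0; 0 \<le> k\<rbrakk> \<Longrightarrow> bdiff k f m = 0"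
  by (simp add: bdiff_def)

lemma bdiff_cong: "\<lbrakk>\<And>m. m < M \<Longrightarrow> f m = g m; m < M; 0 \<le> k\<rbrakk> \<Longrightarrow> bdiff k f m = bdiff k g m"
  by (simp add: bdiff_def)

text \<open>Plays the part of dividing by \<open>1 - x^k\<close>: values are recovered recursively
  from smaller indices, so the argument can be cut off at any bound \<open>M\<close>.\<close>

lemma bdiff_eq_0:
  assumes neg: "\<And>m. m < 0 \<Longrightarrow> f m = 0" and z: "\<And>m. m < M \<Longrightarrow> bdiff k f m = 0" and k: "0 < k" and m: "m < M"
  shows "f m = 0"
proof (cases "m < 0")
  case False
  have "int n < M \<Longrightarrow> f (int n) = 0" for n
  proof (induction n rule: less_induct)
    case (less n)
    have "f (int n) = f (int n - k)" using z[OF less.prems] by (simp add: bdiff_def)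
    also have "\<dots> = 0"
    proof (cases "int n - k < 0")
      case False
      hence "f (int (nat (int n - k))) = 0" using less k by (intro less.IH) auto
      thus ?thesis using False by simp
    qed (rule neg)
    finally show ?case .
  qed
  from this[of "nat m"] show ?thesis using m False by simp
qed (rule neg)

text \<open>Telescoping; this is the polynomial \<open>(1 - x^n) / (1 - x)\<close> at the level of
  coefficients.\<close>

lemma bdiff_window: "bdiff 1 (\<lambda>m. \<Sum>i<n. f (m - int i)) = bdiff (int n) f"
proof
  fix m
  have "(\<Sum>i<n. f (m - int i)) - (\<Sum>i<n. f (m - 1 - int i)) = f m - f (m - int n)"
    by (induction n) (simp_all add: algebra_simps)
  thus "bdiff 1 (\<lambda>m. \<Sum>i<n. f (m - int i)) m = bdiff (int n) f m" by (simp add: bdiff_def)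
qed

section \<open>Reduced residues and the indicator \<open>chi\<close>\<close>

locale triple =
  fixes p q r X U V :: int
  assumes gt1: "1 < p" "1 < q" "1 < r"
    and cop: "coprime p q" "coprime p r" "coprime q r"
    and X: "[q * r * X = 1] (mod p)" and U: "[p * r * U = 1] (mod q)" and V: "[p * q * V = 1] (mod r)"
begin

definition x where "x m = m * X mod p"
definition y where "y m = m * U mod q"
definition z where "z m = m * V mod r"
definition F where "F m = (x m * (q * r) + y m * (p * r) + z m * (p * q) - m) div (p * q * r)"
text \<open>Below \<open>p * q * r\<close> these are the coefficients of the reciprocal of
  \<open>(1 - x^(pq)) (1 - x^(pr)) (1 - x^(qr))\<close>: a representation by \<open>q r\<close>,
  \<open>p r\<close>, \<open>p q\<close> with nonnegative multipliers is then automatically reduced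
  and unique.\<close>

definition chi :: "int \<Rightarrow> int" where "chi m = of_bool (F m = 0)"

lemma x_range: "0 \<le> x m" "x m < p" and y_range: "0 \<le> y m" "y m < q" and z_range: "0 \<le> z m" "z m < r"
  using gt1 by (simp_all add: x_def y_def z_def)

lemma F_eq: "x m * (q * r) + y m * (p * r) + z m * (p * q) = m + p * q * r * F m"
proof -
  define S where "S = x m * (q * r) + y m * (p * r) + z m * (p * q) - m"
  have "[x m * (q * r) = m] (mod p)"
  proof -
    have "[x m * (q * r) = m * X * (q * r)] (mod p)" by (simp add: x_def cong_def mod_mult_left_eq)
    also have "m * X * (q * r) = m * (q * r * X)" by simp
    also have "[m * (q * r * X) = m * 1] (mod p)" by (intro cong_mult cong_refl X)
    finally show ?thesis by simp
  qed
  hence p: "p dvd S" by (auto simp: S_def cong_iff_dvd_diff algebra_simps intro: dvd_add) 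
  have "[y m * (p * r) = m] (mod q)"
  proof -
    have "[y m * (p * r) = m * U * (p * r)] (mod q)" by (simp add: y_def cong_def mod_mult_left_eq)
    also have "m * U * (p * r) = m * (p * r * U)" by simp
    also have "[m * (p * r * U) = m * 1] (mod q)" by (intro cong_mult cong_refl U)
    finally show ?thesis by simp
  qed
  hence q: "q dvd S" by (auto simp: S_def cong_iff_dvd_diff algebra_simps intro: dvd_add)
  have "[z m * (p * q) = m] (mod r)"
  proof -
    have "[z m * (p * q) = m * V * (p * q)] (mod r)" by (simp add: z_def cong_def mod_mult_left_eq)
    also have "m * V * (p * q) = m * (p * q * V)" by simp
    also have "[m * (p * q * V) = m * 1] (mod r)" by (intro cong_mult cong_refl V)
    finally show ?thesis by simp
  qed
  hence r: "r dvd S" by (auto simp: S_def cong_iff_dvd_diff algebra_simps intro: dvd_add)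
  have "p * q * r dvd S" using p q r cop by (intro divides_mult) (auto simp: coprime_mult_left_iff)
  thus ?thesis unfolding F_def S_def[symmetric] using S_def by (simp add: dvd_mult_div_cancel)
qed

lemma pqr_pos: "0 < p * q * r" using gt1 by simp

lemma F_unique: "x m * (q * r) + y m * (p * r) + z m * (p * q) = m + p * q * r * k \<Longrightarrow> F m = k"
  using F_eq[of m] pqr_pos by auto

lemma sum_nonneg: "0 \<le> x m * (q * r) + y m * (p * r) + z m * (p * q)"
  using x_range[of m] y_range[of m] z_range[of m] gt1 by simp

lemma F_nonneg: "m < p * q * r \<Longrightarrow> 0 \<le> F m"
proof (rule ccontr)
  assume m: "m < p * q * r" and "\<not> 0 \<le> F m"
  hence "p * q * r * F m \<le> p * q * r * (- 1)" using pqr_pos by (intro mult_left_mono) auto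
  thus False using F_eq[of m] sum_nonneg[of m] m by simp
qed

lemma chi_neg: "m < 0 \<Longrightarrow> chi m = 0"
  using F_eq[of m] sum_nonneg[of m] by (auto simp: chi_def)

lemma mod_minus_one:
  fixes n t :: int
  assumes "1 < n" "[s = 1] (mod n)"
  shows "(t - s) mod n = (if t mod n = 0 then n - 1 else t mod n - 1)"
proof -
  have "(t - s) mod n = (t mod n - 1) mod n"
    by (rule mod_diff_cong) (use assms(2) in \<open>simp_all add: cong_def\<close>)
  also have "\<dots> = (if t mod n = 0 then n - 1 else t mod n - 1)"
  proof (cases "t mod n = 0")
    case True
    thus ?thesis using assms(1) by (simp add: zmod_minus1)
  next
    case False
    moreover have "0 \<le> t mod n" "t mod n < n" using assms(1) by simp_all
    ultimately show ?thesis by (simp add: mod_pos_pos_trivial)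
  qed
  finally show ?thesis .
qed

lemma shift_qr:
  "x (m - q * r) = (if x m = 0 then p - 1 else x m - 1)" "y (m - q * r) = y m" "z (m - q * r) = z m"
  "F (m - q * r) = F m + of_bool (x m = 0)"
proof -
  have "x (m - q * r) = (m * X - q * r * X) mod p" by (simp add: x_def algebra_simps)
  also have "\<dots> = (if x m = 0 then p - 1 else x m - 1)" unfolding x_def by (rule mod_minus_one[OF gt1(1) X])
  finally show x: "x (m - q * r) = (if x m = 0 then p - 1 else x m - 1)" .
  have "(m - q * r) * U = m * U + q * (- (r * U))" "(m - q * r) * V = m * V + r * (- (q * V))" by (simp_all add: algebra_simps)
  thus yz: "y (m - q * r) = y m" "z (m - q * r) = z m" by (simp_all only: y_def z_def mod_mult_self2)
  show "F (m - q * r) = F m + of_bool (x m = 0)"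
    by (rule F_unique) (use F_eq[of m] in \<open>auto simp: x yz algebra_simps\<close>)
qed

lemma shift_pr:
  "x (m - p * r) = x m" "y (m - p * r) = (if y m = 0 then q - 1 else y m - 1)" "z (m - p * r) = z m"
  "F (m - p * r) = F m + of_bool (y m = 0)"
proof -
  have "y (m - p * r) = (m * U - p * r * U) mod q" by (simp add: y_def algebra_simps)
  also have "\<dots> = (if y m = 0 then q - 1 else y m - 1)" unfolding y_def by (rule mod_minus_one[OF gt1(2) U])
  finally show y: "y (m - p * r) = (if y m = 0 then q - 1 else y m - 1)" .
  have "(m - p * r) * X = m * X + p * (- (r * X))" "(m - p * r) * V = m * V + r * (- (p * V))" by (simp_all add: algebra_simps)
  thus xz: "x (m - p * r) = x m" "z (m - p * r) = z m" by (simp_all only: x_def z_def mod_mult_self2)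
  show "F (m - p * r) = F m + of_bool (y m = 0)"
    by (rule F_unique) (use F_eq[of m] in \<open>auto simp: y xz algebra_simps\<close>)
qed

lemma shift_pq:
  "x (m - p * q) = x m" "y (m - p * q) = y m" "z (m - p * q) = (if z m = 0 then r - 1 else z m - 1)"
  "F (m - p * q) = F m + of_bool (z m = 0)"
proof -
  have "z (m - p * q) = (m * V - p * q * V) mod r" by (simp add: z_def algebra_simps)
  also have "\<dots> = (if z m = 0 then r - 1 else z m - 1)" unfolding z_def by (rule mod_minus_one[OF gt1(3) V])
  finally show z: "z (m - p * q) = (if z m = 0 then r - 1 else z m - 1)" .
  have "(m - p * q) * X = m * X + p * (- (q * X))" "(m - p * q) * U = m * U + q * (- (p * U))" by (simp_all add: algebra_simps)
  thus xy: "x (m - p * q) = x m" "y (m - p * q) = y m" by (simp_all only: x_def y_def mod_mult_self2)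
  show "F (m - p * q) = F m + of_bool (z m = 0)"
    by (rule F_unique) (use F_eq[of m] in \<open>auto simp: z xy algebra_simps\<close>)
qed

text \<open>Each difference pins one residue to 0. If the residue is positive, the shift leaves
  \<open>F\<close> unchanged and the terms cancel; if it is 0, the shift raises the nonnegative
  \<open>F\<close> by one and only the unshifted term can survive.\<close>

lemma bdiff_chi:
  assumes m: "m < p * q * r"
  shows "bdiff (p * q) (bdiff (p * r) (bdiff (q * r) chi)) m = of_bool (m = 0)"
proof -
  have 1: "bdiff (q * r) chi m = of_bool (F m = 0 \<and> x m = 0)" if "m < p * q * r" for m
    using F_nonneg[OF that] by (auto simp: bdiff_def chi_def shift_qr)
  have 2: "bdiff (p * r) (bdiff (q * r) chi) m = of_bool (F m = 0 \<and> x m = 0 \<and> y m = 0)" if that: "m < p * q * r" for m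
  proof -
    have "0 < p * r" using gt1 by simp
    hence lt: "m - p * r < p * q * r" using that by linarith
    have "bdiff (p * r) (bdiff (q * r) chi) m =
        of_bool (F m = 0 \<and> x m = 0) - of_bool (F (m - p * r) = 0 \<and> x (m - p * r) = 0)"
      by (simp only: bdiff_def[of "p * r"] 1[OF that] 1[OF lt])
    also have "\<dots> = of_bool (F m = 0 \<and> x m = 0 \<and> y m = 0)"
      using F_nonneg[OF that] unfolding shift_pr(1,4) by (cases "y m = 0") auto
    finally show ?thesis .
  qed
  have "0 < p * q" using gt1 by simp
  hence lt: "m - p * q < p * q * r" using m by linarith
  have "bdiff (p * q) (bdiff (p * r) (bdiff (q * r) chi)) m = of_bool (F m = 0 \<and> x m = 0 \<and> y m = 0) -
      of_bool (F (m - p * q) = 0 \<and> x (m - p * q) = 0 \<and> y (m - p * q) = 0)"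
    by (simp only: bdiff_def[of "p * q"] 2[OF m] 2[OF lt])
  also have "\<dots> = of_bool (F m = 0 \<and> x m = 0 \<and> y m = 0 \<and> z m = 0)"
    using F_nonneg[OF m] unfolding shift_pq(1,2,4) by (cases "z m = 0") auto
  also have "(F m = 0 \<and> x m = 0 \<and> y m = 0 \<and> z m = 0) \<longleftrightarrow> m = 0"
    using F_eq[of m] by (auto simp: F_def x_def y_def z_def)
  finally show ?thesis .
qed

end

text \<open>Below \<open>p * q * r\<close> the factor \<open>1 - x^(pqr)\<close> has no effect, so
  the coefficients and the window sums have the same image under the four differences of
  \<open>D\<close>. These are undone one at a time by \<open>bdiff_eq_0\<close>.\<close>

lemma cyclotomic_coeff_window:
  fixes p q r :: nat
  assumes "prime p" "prime q" "prime r" "p \<noteq> q" "p \<noteq> r" "q \<noteq> r"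
    and "triple (int p) (int q) (int r) X U V" and n: "n < int (p * q * r)"
  shows "cyclotomic_coeff (p * q * r) n =
    (\<Sum>i<p. bdiff (int q) (bdiff (int r) (triple.chi (int p) (int q) (int r) X U V)) (n - int i))"
proof -
  interpret triple "int p" "int q" "int r" X U V by fact
  define M where "M = int (p * q * r)"
  have M: "M = int p * int q * int r" by (simp add: M_def)
  define A where "A = pcoeff (cyclotomic (p * q * r))"
  define B where "B = (\<lambda>m. \<Sum>i<p. bdiff (int q) (bdiff (int r) chi) (m - int i))"
  define \<delta> where "\<delta> = pcoeff 1"
  have d: "\<delta> m = of_bool (m = 0)" for m by (auto simp: \<delta>_def pcoeff_def)
  define D where "D f = bdiff 1 (bdiff (int (p * q)) (bdiff (int (p * r)) (bdiff (int (q * r)) f)))" for f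
  have DA: "D A = bdiff M (bdiff (int p) (bdiff (int q) (bdiff (int r) \<delta>)))"
  proof -
    have "D A = pcoeff ((1 - monom 1 1) * ((1 - monom 1 (p * q)) * ((1 - monom 1 (p * r)) * ((1 - monom 1 (q * r)) * cyclotomic (p * q * r)))))"
      unfolding pcoeff_mult D_def A_def by simp
    also have "\<dots> = pcoeff ((1 - monom 1 (p * q * r)) * ((1 - monom 1 p) * ((1 - monom 1 q) * ((1 - monom 1 r) * 1))))"
      unfolding cyclotomic_pqr_identity[OF assms(1-6)] by simp
    also have "\<dots> = bdiff M (bdiff (int p) (bdiff (int q) (bdiff (int r) \<delta>)))"
      unfolding pcoeff_mult \<delta>_def M_def by simp
    finally show ?thesis .
  qed
  define C where "C = bdiff (int (p * q)) (bdiff (int (p * r)) (bdiff (int (q * r)) chi))"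
  have C: "C m = \<delta> m" if "m < M" for m
    unfolding C_def d using bdiff_chi[of m] that by (simp add: M)
  have DB: "D B = bdiff (int p) (bdiff (int q) (bdiff (int r) C))"
  proof -
    have "D B = bdiff (int (p * q)) (bdiff (int (p * r)) (bdiff (int (q * r)) (bdiff 1 B)))"
      unfolding D_def by (simp only: bdiff_commute[where k = 1])
    also have "bdiff 1 B = bdiff (int p) (bdiff (int q) (bdiff (int r) chi))"
      unfolding B_def by (rule bdiff_window)
    finally show ?thesis unfolding C_def by (simp only: bdiff_commute)
  qed
  have "D A m = D B m" if m: "m < M" for m
  proof -
    have \<delta>0: "\<delta> m = 0" if "m < 0" for m using that by (simp add: d)
    have "D A m = bdiff (int p) (bdiff (int q) (bdiff (int r) \<delta>)) m - bdiff (int p) (bdiff (int q) (bdiff (int r) \<delta>)) (m - M)"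
      unfolding DA by (simp add: bdiff_def)
    also have "bdiff (int p) (bdiff (int q) (bdiff (int r) \<delta>)) (m - M) = 0"
      by (intro bdiff_neg \<delta>0) (use m in auto)
    also have "bdiff (int p) (bdiff (int q) (bdiff (int r) \<delta>)) m = D B m"
      unfolding DB by (rule bdiff_cong[where M = M] C[symmetric] m | simp)+
    finally show ?thesis by simp
  qed
  hence D0: "D (\<lambda>m. A m - B m) m = 0" if "m < M" for m
    using that unfolding D_def bdiff_minus by simp
  have neg: "A m - B m = 0" if "m < 0" for m
    using that chi_neg by (simp add: A_def B_def pcoeff_def bdiff_def)
  have pos: "int p > 0" "int q > 0" "int r > 0" using gt1 by simp_all
  have ppos: "0 < int (p * q)" "0 < int (p * r)" "0 < int (q * r)" using pos by simp_all
  have "A m - B m = 0" if m: "m < M" for m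
  proof -
    let ?h = "\<lambda>m. A m - B m"
    have n1: "bdiff (int (q * r)) ?h m = 0" if "m < 0" for m by (rule bdiff_neg) (use neg that in auto)
    have n2: "bdiff (int (p * r)) (bdiff (int (q * r)) ?h) m = 0" if "m < 0" for m by (rule bdiff_neg) (use n1 that in auto)
    have n3: "bdiff (int (p * q)) (bdiff (int (p * r)) (bdiff (int (q * r)) ?h)) m = 0" if "m < 0" for m by (rule bdiff_neg) (use n2 that in auto)
    have h3: "bdiff (int (p * q)) (bdiff (int (p * r)) (bdiff (int (q * r)) ?h)) m = 0" if "m < M" for m
      by (rule bdiff_eq_0[where k = 1, OF n3 _ _ that]) (use D0 in \<open>simp_all add: D_def\<close>)
    have h2: "bdiff (int (p * r)) (bdiff (int (q * r)) ?h) m = 0" if "m < M" for m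
      by (rule bdiff_eq_0[OF n2 h3 ppos(1) that])
    have h1: "bdiff (int (q * r)) ?h m = 0" if "m < M" for m
      by (rule bdiff_eq_0[OF n1 h2 ppos(2) that])
    show ?thesis by (rule bdiff_eq_0[OF neg h1 ppos(3) m])
  qed
  from this[of n] show ?thesis using n by (simp add: A_def B_def M_def cyclotomic_coeff_eq)
qed

section \<open>Effect of the shifts by \<open>q\<close> and \<open>r\<close>\<close>

context triple
begin

lemma mod_diff_cases:
  fixes n u v :: int
  assumes "0 \<le> v" "v < n" "0 < n"
  shows "(u - v) mod n = u mod n - v + n * of_bool (u mod n < v)"
proof -
  have "(u - v) mod n = (u mod n - v) mod n" by (simp add: mod_diff_left_eq)
  also have "\<dots> = u mod n - v + n * of_bool (u mod n < v)"
  proof (cases "u mod n < v")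
    case True
    have "(u mod n - v) mod n = (u mod n - v + n) mod n" by simp
    also have "\<dots> = u mod n - v + n" using True assms by (intro mod_pos_pos_trivial) (use pos_mod_sign[of n u] in linarith)+
    finally show ?thesis using True by simp
  next
    case False
    have "(u mod n - v) mod n = u mod n - v"
      using False assms pos_mod_bound[of n u] by (intro mod_pos_pos_trivial) linarith+
    thus ?thesis using False by simp
  qed
  finally show ?thesis .
qed

text \<open>The pair \<open>A, C\<close> represents the shift by \<open>\<plusminus> q\<close>: it is a solution of
  \<open>A r + C p = p r \<plusminus> 1\<close>.\<close>

lemma shift_q:
  assumes s: "A * r + C * p = p * r + s" and A: "0 \<le> A" "A < p" and C: "0 \<le> C" "C < r"
  shows "x (m - s * q) = x m - A + p * of_bool (x m < A)" "y (m - s * q) = y m"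
    "z (m - s * q) = z m - C + r * of_bool (z m < C)"
    "F (m - s * q) = F m - 1 + of_bool (x m < A) + of_bool (z m < C)"
proof -
  have "[s * q * X = A] (mod p)"
  proof -
    have "s = A * r + p * (C - r)" using s by (simp add: algebra_simps)
    hence "s * q * X = (A * r + p * (C - r)) * q * X" by (rule arg_cong[where f = "\<lambda>v. v * q * X"])
    hence "s * q * X = A * (q * r * X) + p * ((C - r) * q * X)" by (simp add: algebra_simps)
    hence "[s * q * X = A * (q * r * X)] (mod p)" by (simp add: cong_def)
    also have "[A * (q * r * X) = A * 1] (mod p)" by (intro cong_mult cong_refl X)
    finally show ?thesis by simp
  qed
  hence "[m * X - s * q * X = m * X - A] (mod p)" by (intro cong_diff cong_refl)
  hence "(m * X - s * q * X) mod p = (m * X - A) mod p" by (simp only: cong_def)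
  thus x: "x (m - s * q) = x m - A + p * of_bool (x m < A)"
    using mod_diff_cases[OF A, of "m * X"] gt1 by (simp add: x_def left_diff_distrib)
  have "[s * q * V = C] (mod r)"
  proof -
    have "s = C * p + r * (A - p)" using s by (simp add: algebra_simps)
    hence "s * q * V = (C * p + r * (A - p)) * q * V" by (rule arg_cong[where f = "\<lambda>v. v * q * V"])
    hence "s * q * V = C * (p * q * V) + r * ((A - p) * q * V)" by (simp add: algebra_simps)
    hence "[s * q * V = C * (p * q * V)] (mod r)" by (simp add: cong_def)
    also have "[C * (p * q * V) = C * 1] (mod r)" by (intro cong_mult cong_refl V)
    finally show ?thesis by simp
  qed
  hence "[m * V - s * q * V = m * V - C] (mod r)" by (intro cong_diff cong_refl)
  hence "(m * V - s * q * V) mod r = (m * V - C) mod r" by (simp only: cong_def)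
  thus z: "z (m - s * q) = z m - C + r * of_bool (z m < C)"
    using mod_diff_cases[OF C, of "m * V"] gt1 by (simp add: z_def left_diff_distrib)
  have "(m - s * q) * U = m * U + q * (- (s * U))" by (simp add: algebra_simps)
  thus y: "y (m - s * q) = y m" by (simp only: y_def mod_mult_self2)
  have sq: "s * q = q * (A * r + C * p) - p * q * r" using s by (simp add: algebra_simps)
  show "F (m - s * q) = F m - 1 + of_bool (x m < A) + of_bool (z m < C)"
    by (rule F_unique, unfold x y z) (use F_eq[of m] sq in \<open>simp add: algebra_simps\<close>)
qed

lemma swap: "triple p r q X V U"
  using gt1 cop X U V by unfold_locales (simp_all add: coprime_commute mult_ac)

lemma swap_F: "triple.F p r q X V U m = F m"
proof -
  interpret T: triple p r q X V U by (rule swap)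
  show ?thesis unfolding T.F_def F_def T.y_def T.z_def y_def z_def by (simp add: algebra_simps)
qed

lemma shift_r:
  assumes t: "B * q + D * p = p * q + t" and B: "0 \<le> B" "B < p" and D: "0 \<le> D" "D < q"
  shows "x (m - t * r) = x m - B + p * of_bool (x m < B)" "z (m - t * r) = z m"
    "y (m - t * r) = y m - D + q * of_bool (y m < D)"
    "F (m - t * r) = F m - 1 + of_bool (x m < B) + of_bool (y m < D)"
proof -
  interpret T: triple p r q X V U by (rule swap)
  have e: "T.y n = z n" "T.z n = y n" for n by (simp_all add: T.y_def T.z_def y_def z_def)
  show "x (m - t * r) = x m - B + p * of_bool (x m < B)" "z (m - t * r) = z m"
    "y (m - t * r) = y m - D + q * of_bool (y m < D)"
    "F (m - t * r) = F m - 1 + of_bool (x m < B) + of_bool (y m < D)"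
    using T.shift_q[OF t B D, of m] by (simp_all only: e swap_F)
qed

end

section \<open>Pointwise bound for the second difference\<close>

lemma second_difference_bool:
  fixes f :: int
  assumes "0 \<le> f" "0 \<le> f - 1 + of_bool P + of_bool e" "0 \<le> f - 1 + of_bool Q + of_bool g"
    "0 \<le> f - 2 + of_bool R + of_bool e + of_bool g" and "P \<longrightarrow> R" "Q \<longrightarrow> R"
  shows "of_bool (f = 0) - of_bool (f - 1 + of_bool P + of_bool e = 0)
      - of_bool (f - 1 + of_bool Q + of_bool g = 0) + of_bool (f - 2 + of_bool R + of_bool e + of_bool g = 0)
    \<le> (of_bool (P \<and> Q \<and> f = 0) + of_bool (P \<and> Q \<and> f = 1 \<and> \<not> e \<and> \<not> g)
    + of_bool (\<not> R \<and> f = 2 \<and> \<not> e \<and> \<not> g)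
    - of_bool (\<not> P \<and> \<not> Q \<and> R \<and> (f = 0 \<or> f = 1 \<and> (\<not> e \<or> \<not> g))) :: int)"
proof -
  consider "f = 0" | "f = 1" | "f = 2" | "f \<ge> 3" using assms(1) by linarith
  thus ?thesis
  proof cases
    \<comment> \<open>At \<open>f = 0\<close> the nonnegativity of the three shifted values excludes
      the combinations of wraps that would violate the bound.\<close>
    case 1 show ?thesis using assms(2-) unfolding 1 by (cases P; cases Q; cases R; cases e; cases g) simp_all
  next
    case 2 show ?thesis using assms(5,6) unfolding 2 by (cases P; cases Q; cases R; cases e; cases g) simp_all
  next
    case 3 show ?thesis using assms(5,6) unfolding 3 by (cases P; cases Q; cases R; cases e; cases g) simp_all
  next
    case 4 thus ?thesis by (cases P; cases Q; cases R; cases e; cases g) simp_all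
  qed
qed

lemma second_difference_cases:
  fixes f a b x :: int
  assumes ab: "0 < a" "0 < b"
    and nonneg: "0 \<le> f" "0 \<le> f - 1 + of_bool (x < a) + of_bool e" "0 \<le> f - 1 + of_bool (x < b) + of_bool g"
      "0 \<le> f - 2 + of_bool (x < a + b) + of_bool e + of_bool g"
  shows "of_bool (f = 0) - of_bool (f - 1 + of_bool (x < a) + of_bool e = 0)
      - of_bool (f - 1 + of_bool (x < b) + of_bool g = 0) + of_bool (f - 2 + of_bool (x < a + b) + of_bool e + of_bool g = 0)
    \<le> (of_bool (x < min a b \<and> f = 0) + of_bool (x < min a b \<and> f = 1 \<and> \<not> e \<and> \<not> g)
    + of_bool (a + b \<le> x \<and> f = 2 \<and> \<not> e \<and> \<not> g)
    - of_bool (max a b \<le> x \<and> x < a + b \<and> (f = 0 \<or> f = 1 \<and> (\<not> e \<or> \<not> g))) :: int)"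
proof -
  have mm: "x < min a b \<longleftrightarrow> x < a \<and> x < b" "max a b \<le> x \<longleftrightarrow> \<not> x < a \<and> \<not> x < b" "a + b \<le> x \<longleftrightarrow> \<not> x < a + b"
    by auto
  have imp: "x < a \<longrightarrow> x < a + b" "x < b \<longrightarrow> x < a + b" using ab by auto
  show ?thesis using second_difference_bool[OF nonneg imp] unfolding mm by (simp only: conj_assoc)
qed

lemma of_int_divide_less:
  fixes N M k :: int
  assumes "0 < M" "N < k * M"
  shows "real_of_int N / of_int M < of_int k"
proof -
  have "real_of_int N < of_int (k * M)" using assms by (simp only: of_int_less_iff)
  thus ?thesis using assms by (simp add: pos_divide_less_eq)
qed

lemma of_int_less_divide:
  fixes N M k l :: int
  assumes "0 < M" "k * M < N + l * M"
  shows "real_of_int k < of_int N / of_int M + of_int l"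
proof -
  have "real_of_int ((k - l) * M) < of_int N" using assms by (simp only: of_int_less_iff left_diff_distrib)
  hence "real_of_int (k - l) < of_int N / of_int M" using assms by (simp add: pos_less_divide_eq)
  thus ?thesis by simp
qed

section \<open>Counting over \<open>p\<close> consecutive indices\<close>

locale window = triple "int p" "int q" "int r" X U V
  for p q r :: nat and X U V :: int +
  fixes s t A B C D n0 :: int
  assumes prime_p: "prime p" and pq: "p < q" and qr: "q < r"
    and s: "s = 1 \<or> s = - 1" and t: "t = 1 \<or> t = - 1"
    and s_eq: "A * int r + C * int p = int p * int r + s" and t_eq: "B * int q + D * int p = int p * int q + t"
    and A: "0 < A" "A < int p" and B: "0 < B" "B < int p" and C: "0 \<le> C" "C < int r" and D: "0 \<le> D" "D < int q"
    and AB: "A + B \<le> int p"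
    and n0: "n0 < int p * int q * int r" "n0 - s * int q < int p * int q * int r"
      "n0 - t * int r < int p * int q * int r" "n0 - s * int q - t * int r < int p * int q * int r"
begin

text \<open>Up to the sign \<open>s * t\<close> and a translation this is
  \<open>bdiff q (bdiff r chi)\<close>. Signed shifts make both a residue and its complement
  available, so that \<open>A + B <= p\<close> can be arranged.\<close>

definition G where "G m = chi m - chi (m - s * int q) - chi (m - t * int r) + chi (m - s * int q - t * int r)"

definition Q0 where "Q0 = {j. j < p \<and> x (n0 - int j) < min A B \<and> F (n0 - int j) = 0}"
definition Q1 where "Q1 = {j. j < p \<and> x (n0 - int j) < min A B \<and> F (n0 - int j) = 1 \<and>
   D \<le> y (n0 - int j) \<and> C \<le> z (n0 - int j)}"
definition Q2 where "Q2 = {j. j < p \<and> A + B \<le> x (n0 - int j) \<and> F (n0 - int j) = 2 \<and>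
   D \<le> y (n0 - int j) \<and> C \<le> z (n0 - int j)}"
definition QN where "QN = {j. j < p \<and> max A B \<le> x (n0 - int j) \<and> x (n0 - int j) < A + B \<and>
   (F (n0 - int j) = 0 \<or> F (n0 - int j) = 1 \<and> (D \<le> y (n0 - int j) \<or> C \<le> z (n0 - int j)))}"

lemma G_le:
  assumes "j < p"
  shows "G (n0 - int j) \<le> of_bool (j \<in> Q0) + of_bool (j \<in> Q1) + of_bool (j \<in> Q2) - of_bool (j \<in> QN)"
proof -
  define m where "m = n0 - int j"
  let ?f = "F m" and ?x = "x m" and ?e = "z m < C" and ?g = "y m < D"
  have F1: "F (m - s * int q) = ?f - 1 + of_bool (?x < A) + of_bool ?e"
    and F2: "F (m - t * int r) = ?f - 1 + of_bool (?x < B) + of_bool ?g"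
    using shift_q(4)[OF s_eq, of m] shift_r(4)[OF t_eq, of m] A B C D by auto
  have F12: "F (m - s * int q - t * int r) = ?f - 2 + of_bool (?x < A + B) + of_bool ?e + of_bool ?g"
  proof -
    have "F (m - s * int q - t * int r) = F (m - s * int q) - 1 + of_bool (x (m - s * int q) < B) + of_bool (y (m - s * int q) < D)"
      using shift_r(4)[OF t_eq, of "m - s * int q"] B D by auto
    \<comment> \<open>Because \<open>A + B <= p\<close>, the two shifts together wrap
      \<open>x\<close> at most once, and they do so exactly when \<open>x m < A + B\<close>.\<close>
    moreover have "of_bool (x (m - s * int q) < B) + of_bool (?x < A) = (of_bool (?x < A + B) :: int)"
      using shift_q(1)[OF s_eq, of m] A B C AB x_range[of m] by (auto simp: of_bool_def)
    moreover have "y (m - s * int q) = y m" using shift_q(2)[OF s_eq, of m] A C by auto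
    ultimately show ?thesis using F1 by simp
  qed
  have nn: "0 \<le> ?f" "0 \<le> F (m - s * int q)" "0 \<le> F (m - t * int r)" "0 \<le> F (m - s * int q - t * int r)"
    using n0 by (auto intro!: F_nonneg simp: m_def)
  have "G m \<le> of_bool (?x < min A B \<and> ?f = 0) + of_bool (?x < min A B \<and> ?f = 1 \<and> \<not> ?e \<and> \<not> ?g)
    + of_bool (A + B \<le> ?x \<and> ?f = 2 \<and> \<not> ?e \<and> \<not> ?g)
    - of_bool (max A B \<le> ?x \<and> ?x < A + B \<and> (?f = 0 \<or> ?f = 1 \<and> (\<not> ?e \<or> \<not> ?g)))"
    using second_difference_cases[OF A(1) B(1) nn[unfolded F1 F2 F12]] unfolding G_def chi_def F1 F2 F12 .
  thus ?thesis using assms unfolding m_def Q0_def Q1_def Q2_def QN_def by (simp add: not_less conj_commute disj_commute)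
qed

lemma fin: "finite Q0" "finite Q1" "finite Q2" "finite QN" by (simp_all add: Q0_def Q1_def Q2_def QN_def)

lemma sum_G_le: "(\<Sum>j<p. G (n0 - int j)) \<le> int (card Q0) + int (card Q1) + int (card Q2) - int (card QN)"
proof -
  have card: "(\<Sum>j<p. of_bool (j \<in> Q)) = int (card Q)" if "Q \<subseteq> {..<p}" for Q
    using that by (simp add: Int_absorb1)
  have "(\<Sum>j<p. G (n0 - int j)) \<le> (\<Sum>j<p. of_bool (j \<in> Q0) + of_bool (j \<in> Q1) + of_bool (j \<in> Q2) - of_bool (j \<in> QN))"
    by (intro sum_mono G_le) simp
  also have "\<dots> = int (card Q0) + int (card Q1) + int (card Q2) - int (card QN)"
    unfolding sum_subtractf sum.distrib by (subst (1 2 3 4) card) (auto simp: Q0_def Q1_def Q2_def QN_def)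
  finally show ?thesis .
qed

lemma coprime_X: "coprime X (int p)"
  using X by (metis coprime_iff_invertible_int mult.commute)

lemma inj_x: "inj_on (\<lambda>j. x (n0 - int j)) {..<p}"
proof (rule inj_onI)
  fix i j assume ij: "i \<in> {..<p}" "j \<in> {..<p}" and "x (n0 - int i) = x (n0 - int j)"
  hence "[(n0 - int i) * X = (n0 - int j) * X] (mod int p)" by (simp add: x_def cong_def)
  hence "[n0 - int i = n0 - int j] (mod int p)" by (simp only: cong_mult_rcancel[OF coprime_X])
  hence "[n0 - (n0 - int i) = n0 - (n0 - int j)] (mod int p)" by (rule cong_diff[OF cong_refl])
  hence "[int i = int j] (mod int p)" by (simp only: diff_diff_eq2 add_diff_cancel_left')
  thus "i = j" using ij by (simp add: cong_int_iff cong_less_modulus_unique_nat)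
qed

lemma card_le_of_x:
  assumes "Q \<subseteq> {..<p}" "\<And>j. j \<in> Q \<Longrightarrow> x (n0 - int j) \<in> T" "finite T"
  shows "card Q \<le> card T"
  using assms inj_on_subset[OF inj_x assms(1)] by (intro card_inj_on_le[where f = "\<lambda>j. x (n0 - int j)"]) auto

lemma card_Q01: "int (card Q0) + int (card Q1) \<le> min A B"
proof -
  have "card Q0 + card Q1 = card (Q0 \<union> Q1)"
    using fin by (subst card_Un_disjoint) (auto simp: Q0_def Q1_def)
  also have "\<dots> \<le> card {0..<min A B}"
    by (rule card_le_of_x) (auto simp: Q0_def Q1_def x_range)
  finally have "card Q0 + card Q1 \<le> nat (min A B)" by simp
  moreover have "int (nat (min A B)) = min A B" using A B by simp
  ultimately show ?thesis by linarith
qed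

lemma sum_G_le_1: "(\<Sum>j<p. G (n0 - int j)) \<le> int p - max A B"
proof -
  have "card Q2 \<le> card {A + B..<int p}" by (rule card_le_of_x) (auto simp: Q2_def x_range)
  hence "int (card Q2) \<le> int p - (A + B)" using AB by simp
  thus ?thesis using sum_G_le card_Q01 by linarith
qed

text \<open>On \<open>Q2\<close>, \<open>F = 2\<close> together with \<open>D <= y\<close> and
  \<open>C <= z\<close> confines \<open>x\<close> to an open interval of length
  \<open>A + B\<close>. This replaces the estimate \<open>p - A - B\<close> used in
  \<open>sum_G_le_1\<close>.\<close>

lemma sum_G_le_2: "(\<Sum>j<p. G (n0 - int j)) \<le> 2 * min A B + max A B"
proof -
  \<comment> \<open>The numerator serves the whole window at once: the lower end uses
    \<open>p r + p q > p + q + r\<close> to absorb any \<open>j < p\<close>, and the upper end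
    absorbs the signed shifts, at most \<open>r\<close> and \<open>q\<close> in size.\<close>
  define u where "u = real_of_int (n0 + int r + int q + 1) / of_int (int q * int r)"
  have qr_pos: "0 < int q * int r" using gt1 by simp
  let ?T = "{k::int. u < of_int k \<and> of_int k < u + real (nat (A + B))}"
  have "x (n0 - int j) \<in> ?T" if j: "j \<in> Q2" for j
  proof -
    let ?m = "n0 - int j"
    have jp: "j < p" and F: "F ?m = 2" and yz: "D \<le> y ?m" "C \<le> z ?m" using j by (auto simp: Q2_def)
    have eq: "x ?m * (int q * int r) = ?m + 2 * (int p * int q * int r) - y ?m * (int p * int r) - z ?m * (int p * int q)"
      using F_eq[of ?m] F by simp
    have "y ?m * (int p * int r) \<le> (int q - 1) * (int p * int r)" "z ?m * (int p * int q) \<le> (int r - 1) * (int p * int q)"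
      using y_range z_range gt1 by (intro mult_right_mono; simp)+
    hence "x ?m * (int q * int r) \<ge> ?m + int p * int r + int p * int q" using eq by (simp add: algebra_simps)
    moreover have "int p * int r + int p * int q > int p + int r + int q"
    proof -
      have "(int p - 1) * (int r + int q - 1) \<ge> 1 * (int r + int q - 1)" using gt1 by (intro mult_right_mono) auto
      moreover have "int r + int q - 1 > 1" using gt1 by linarith
      ultimately show ?thesis by (simp add: algebra_simps)
    qed
    ultimately have "n0 + int r + int q + 1 < x ?m * (int q * int r)" using jp by linarith
    hence lower: "u < of_int (x ?m)" unfolding u_def by (rule of_int_divide_less[OF qr_pos])
    have "D * (int p * int r) \<le> y ?m * (int p * int r)" "C * (int p * int q) \<le> z ?m * (int p * int q)"
      using yz by (intro mult_right_mono; simp)+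
    moreover have "D * (int p * int r) = int p * int q * int r + t * int r - B * (int q * int r)"
      using arg_cong[OF t_eq, of "\<lambda>v. v * int r"] by (simp add: algebra_simps)
    moreover have "C * (int p * int q) = int p * int q * int r + s * int q - A * (int q * int r)"
      using arg_cong[OF s_eq, of "\<lambda>v. v * int q"] by (simp add: algebra_simps)
    moreover have "- (t * int r) \<le> int r" "- (s * int q) \<le> int q" using s t by auto
    ultimately have "x ?m * (int q * int r) < n0 + int r + int q + 1 + (A + B) * (int q * int r)"
      using eq by (simp add: distrib_right)
    hence "of_int (x ?m) < u + of_int (A + B)" unfolding u_def by (rule of_int_less_divide[OF qr_pos])
    also have "of_int (A + B) = real (nat (A + B))" using A B by simp
    finally show ?thesis using lower by simp
  qed
  hence "card Q2 \<le> card ?T" using card_int_open_le(1) by (intro card_le_of_x) (auto simp: Q2_def)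
  also have "\<dots> \<le> nat (A + B)" by (rule card_int_open_le(2))
  finally have "int (card Q2) \<le> A + B" using A B by simp
  thus ?thesis using sum_G_le card_Q01 by linarith
qed

end

section \<open>Real coordinates of the walk\<close>

lemma box_balance:
  fixes P Q R x y z n j f :: real
  assumes "x * (Q * R) + y * (P * R) + z * (P * Q) = n - j + P * Q * R * f" and "0 < Q" "0 < R"
  shows "(P * (Q - y) - 2 - j / R) / Q + (P * (R - z) - 2) / R = x - (n / (Q * R) + 2 / Q + 2 / R) + P * (2 - f)"
proof -
  have "n = x * (Q * R) + y * (P * R) + z * (P * Q) + j - P * Q * R * f" using assms(1) by simp
  hence "n / (Q * R) = (x * (Q * R) + y * (P * R) + z * (P * Q) + j - P * Q * R * f) / (Q * R)" by (rule arg_cong[where f = "\<lambda>v. v / (Q * R)"])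
  also have "\<dots> = x + P * y / Q + P * z / R + j / (Q * R) - P * f" using assms(2,3) by (simp add: field_simps)
  finally have n: "n / (Q * R) = x + P * y / Q + P * z / R + j / (Q * R) - P * f" .
  show ?thesis unfolding n using assms(2,3) by (simp add: field_simps)
qed

text \<open>The inequality amounts to \<open>P * (D - y) < t + 2 + e\<close>, whose right side lies
  between 1 and 4, with 4 excluded. The offset 2 makes this true for both signs \<open>t\<close>,
  and \<open>4 <= P\<close> separates \<open>D - y <= 0\<close> from
  \<open>D - y >= 1\<close>.\<close>

lemma box_less_iff:
  fixes P Q e t :: real and y B D :: int
  assumes "of_int B * Q + of_int D * P = P * Q + t" "0 < Q" "4 \<le> P" "- 1 \<le> t" "t \<le> 1" "0 \<le> e" "e < 1"
  shows "(P * (Q - of_int y) - 2 - e) / Q < of_int B \<longleftrightarrow> D \<le> y"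
proof -
  have "(P * (Q - of_int y) - 2 - e) / Q < of_int B \<longleftrightarrow> P * of_int (D - y) < t + 2 + e"
    using assms(1,2) by (simp add: pos_divide_less_eq algebra_simps) linarith
  also have "\<dots> \<longleftrightarrow> D \<le> y"
  proof
    assume less: "P * of_int (D - y) < t + 2 + e"
    show "D \<le> y"
    proof (rule ccontr)
      assume "\<not> D \<le> y"
      hence "P * 1 \<le> P * of_int (D - y)" using assms(3) by (intro mult_left_mono) auto
      thus False using less assms by linarith
    qed
  next
    assume "D \<le> y"
    hence "P * of_int (D - y) \<le> 0" using assms(3) by (intro mult_nonneg_nonpos) auto
    thus "P * of_int (D - y) < t + 2 + e" using assms by linarith
  qed
  finally show ?thesis .
qed

lemma box_range:
  fixes P Q e y :: real
  assumes "0 \<le> y" "y \<le> Q - 1" "4 \<le> P" "0 \<le> e" "e < 1"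
  shows "0 < (P * (Q - y) - 2 - e) / Q" "(P * (Q - y) - 2 - e) / Q \<le> P"
proof -
  have 1: "P * 1 \<le> P * (Q - y)" "P * (Q - y) \<le> P * Q" using assms by (intro mult_left_mono; simp)+
  have "0 < P * (Q - y) - 2 - e" "P * (Q - y) - 2 - e \<le> P * Q" "0 < Q" using 1 assms by linarith+
  thus "0 < (P * (Q - y) - 2 - e) / Q" "(P * (Q - y) - 2 - e) / Q \<le> P"
    by (simp_all only: divide_pos_pos pos_divide_le_eq)
qed

lemma two_thirds_bound:
  fixes S :: int and a b c d p :: nat
  assumes "3 * (a + b + c) \<le> 2 * p + 3 * d" "S \<le> int a + int b + int c - int d"
  shows "3 * S \<le> 2 * int p"
proof -
  have "3 * S \<le> 3 * (int a + int b + int c - int d)" using assms(2) by simp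
  also have "\<dots> = int (3 * (a + b + c)) - 3 * int d" by simp
  also have "\<dots> \<le> int (2 * p + 3 * d) - 3 * int d" using assms(1) by (simp only: diff_right_mono of_nat_le_iff)
  also have "\<dots> = 2 * int p" by simp
  finally show ?thesis .
qed

context triple
begin

lemma mod_step:
  fixes n T m j :: int
  shows "\<exists>k. (m - j) * T mod n = m * T mod n - j * (1 * T mod n) + n * k"
proof -
  have "(m - j) * T mod n = (m - j) * T - n * ((m - j) * T div n)" "m * T mod n = m * T - n * (m * T div n)"
    "1 * T mod n = 1 * T - n * (1 * T div n)" by (simp_all only: minus_mult_div_eq_mod)
  hence "(m - j) * T mod n = m * T mod n - j * (1 * T mod n) + n * (m * T div n - (m - j) * T div n - j * (1 * T div n))"
    by (simp only:) (simp add: algebra_simps)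
  thus ?thesis by blast
qed

lemma steps:
  shows "\<exists>k. x (m - j) = x m - j * x 1 + p * k" "\<exists>k. y (m - j) = y m - j * y 1 + q * k"
    "\<exists>k. z (m - j) = z m - j * z 1 + r * k"
  unfolding x_def y_def z_def by (rule mod_step)+

end

context window
begin

text \<open>The residue \<open>y\<close> rescaled to a circle of length \<open>p\<close> and
  reversed, so that \<open>D <= y\<close> becomes the lower part. The term \<open>j / r\<close>
  compensates for \<open>m = n0 - j\<close>, which makes \<nu> independent of \<open>j\<close> and
  keeps the step constant.\<close>

definition Y where "Y j = (real p * (real q - of_int (y (n0 - int j))) - 2 - real j / real r) / real q" for j
definition Z where "Z j = (real p * (real r - of_int (z (n0 - int j))) - 2) / real r" for j
definition \<nu> where "\<nu> = of_int n0 / (real q * real r) + 2 / real q + 2 / real r"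

lemma Y_less_iff: "\<lbrakk>4 \<le> p; j < p\<rbrakk> \<Longrightarrow> Y j < of_int B \<longleftrightarrow> D \<le> y (n0 - int j)"
  unfolding Y_def
proof (rule box_less_iff[where t = "of_int t"])
  show "of_int B * real q + of_int D * real p = real p * real q + of_int t"
    using arg_cong[OF t_eq, of real_of_int] by simp
qed (use t pq qr gt1 in auto)

lemma Z_less_iff: "4 \<le> p \<Longrightarrow> Z j < of_int A \<longleftrightarrow> C \<le> z (n0 - int j)"
  using box_less_iff[where t = "of_int s" and e = 0 and Q = "real r" and P = "real p" and B = A and D = C and y = "z (n0 - int j)"]
    arg_cong[OF s_eq, of real_of_int] s gt1 unfolding Z_def by auto

lemma walk:
  assumes "3 * max A B < int p" "2 * int p < 3 * (2 * min A B + max A B)"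
  shows "walk p (min A B) (max A B) (of_int B) (of_int A) (\<lambda>j. x (n0 - int j)) (\<lambda>j. F (n0 - int j)) Y Z \<nu>"
proof
  have p4: "4 \<le> p" using assms(1) A B by linarith
  show "prime p" by (rule prime_p)
  show "0 < min A B" "min A B \<le> max A B" using A B by auto
  show "3 * max A B < int p" "2 * int p < 3 * (2 * min A B + max A B)" by (fact assms)+
  show "real_of_int B \<le> of_int (max A B)" "real_of_int A \<le> of_int (max A B)" by simp_all
  show "real_of_int B + of_int A = of_int (min A B + max A B)" by (simp add: min_def max_def)
  fix j assume j: "j < p"
  have jr: "0 \<le> real j / real r" "real j / real r < 1" using j pq qr by simp_all
  show "0 \<le> x (n0 - int j) \<and> x (n0 - int j) < int p" by (simp add: x_range)
  have "real_of_int (y (n0 - int j)) \<le> real q - 1" "real_of_int (z (n0 - int j)) \<le> real r - 1"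
    using y_range(2)[of "n0 - int j"] z_range(2)[of "n0 - int j"] by linarith+
  thus "0 < Y j \<and> Y j \<le> real p" "0 < Z j \<and> Z j \<le> real p"
    using box_range[of "of_int (y (n0 - int j))" "real q" "real p" "real j / real r"]
      box_range[of "of_int (z (n0 - int j))" "real r" "real p" 0] p4 jr y_range(1)[of "n0 - int j"] z_range(1)[of "n0 - int j"]
    unfolding Y_def Z_def by auto
  show "0 \<le> F (n0 - int j)" using n0(1) by (intro F_nonneg) simp
  show "Y j + Z j = of_int (x (n0 - int j)) - \<nu> + real p * of_int (2 - F (n0 - int j))"
    unfolding Y_def Z_def \<nu>_def of_int_diff of_int_numeral
    by (rule box_balance) (use arg_cong[OF F_eq[of "n0 - int j"], of real_of_int] gt1 in simp_all)
qed

text \<open>Moving \<open>m\<close> down by 1 subtracts the residues of 1, which therefore give the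
  steps. The summand \<open>1 / (q r)\<close> in \<eta> comes from \<open>j / r\<close> in
  \<open>Y\<close>.\<close>

definition w where "w = int p * F 1 - x 1"
definition \<eta> where "\<eta> = real p * of_int (y 1) / real q - 1 / (real q * real r)"
definition \<zeta> where "\<zeta> = real p * of_int (z 1) / real r"

lemma w_cong: "[w = - X] (mod int p)"
proof -
  have "w = - x 1 + int p * F 1" by (simp add: w_def)
  hence "w mod int p = (- x 1) mod int p" by (simp only: mod_mult_self2)
  also have "\<dots> = (- X) mod int p" by (simp add: x_def mod_minus_eq)
  finally show ?thesis by (simp add: cong_def)
qed

lemma moves:
  assumes W: "walk p a b c d (\<lambda>j. x (n0 - int j)) G' Y Z \<nu>'"
  shows "walk.moves p (\<lambda>j. x (n0 - int j)) Y Z w \<eta> \<zeta>"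
  unfolding walk.moves_def[OF W]
proof (intro conjI allI impI)
  have qr0: "real q > 0" "real r > 0" using gt1 by simp_all
  have "real_of_int (x 1) * (real q * real r) + of_int (y 1) * (real p * real r) + of_int (z 1) * (real p * real q) =
      1 + real p * real q * real r * of_int (F 1)"
    using arg_cong[OF F_eq[of 1], of real_of_int] by simp
  hence "real p * of_int (y 1) * real r - 1 + real p * of_int (z 1) * real q = (real p * of_int (F 1) - of_int (x 1)) * (real q * real r)"
    by (simp add: algebra_simps)
  moreover have "\<eta> + \<zeta> = (real p * of_int (y 1) * real r - 1 + real p * of_int (z 1) * real q) / (real q * real r)"
    using qr0 by (simp add: \<eta>_def \<zeta>_def field_simps)
  ultimately show "of_int w = \<eta> + \<zeta>" using qr0 by (simp add: w_def)
  have "coprime (- X) (int p)" using coprime_X by simp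
  thus "coprime w (int p)" using w_cong by (metis cong_imp_coprime cong_sym)
  fix j assume j: "j < p"
  obtain k where "x (n0 - int j) = x n0 - int j * x 1 + int p * k" using steps(1) by blast
  hence "x (n0 - int j) = x (n0 - int 0) + int j * w - int p * (int j * F 1 - k)"
    by (simp add: w_def algebra_simps)
  thus "\<exists>k. x (n0 - int j) = x (n0 - int 0) + int j * w - int p * k" by blast
  obtain k where k: "y (n0 - int j) = y n0 - int j * y 1 + int q * k" using steps(2) by blast
  have "Y j = Y 0 + real j * \<eta> - real p * of_int k"
    unfolding Y_def \<eta>_def k using qr0 by (simp add: field_simps)
  thus "\<exists>k::int. Y j = Y 0 + real j * \<eta> - real p * of_int k" by blast
  obtain k where k: "z (n0 - int j) = z n0 - int j * z 1 + int r * k" using steps(3) by blast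
  have "Z j = Z 0 + real j * \<zeta> - real p * of_int k"
    unfolding Z_def \<zeta>_def k using qr0 by (simp add: field_simps)
  thus "\<exists>k::int. Z j = Z 0 + real j * \<zeta> - real p * of_int k" by blast
qed

text \<open>Lets the step be placed strictly between 0 and \<open>p\<close>. Clearing denominators
  in an equality would make \<open>p\<close> divide 1.\<close>

lemma \<eta>_not_multiple: "\<eta> \<noteq> real p * of_int n"
proof
  assume eq: "\<eta> = real p * of_int n"
  have qr0: "real q > 0" "real r > 0" using gt1 by simp_all
  have "\<eta> * (real q * real r) = real p * of_int (y 1) * real r - 1"
    using qr0 by (simp add: \<eta>_def field_simps)
  hence "real_of_int (int p * y 1 * int r - int p * n * (int q * int r)) = of_int 1" by (simp add: eq)
  hence "int p * y 1 * int r - int p * n * (int q * int r) = 1" by (simp only: of_int_eq_iff)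
  hence "int p * (y 1 * int r - n * (int q * int r)) = 1" by (simp add: algebra_simps)
  hence "int p dvd 1" by (metis dvd_triv_left)
  thus False using gt1 by simp
qed

lemma \<zeta>_not_multiple: "\<zeta> \<noteq> real p * of_int n"
proof
  assume eq: "\<zeta> = real p * of_int n"
  have "real r > 0" "real p > 0" using gt1 by simp_all
  hence "real_of_int (z 1) = of_int (n * int r)" using eq by (simp add: \<zeta>_def field_simps)
  hence "z 1 = n * int r" by (simp only: of_int_eq_iff)
  hence "int r dvd V mod int r" by (simp add: z_def)
  hence "int r dvd V" by (simp add: dvd_mod_iff)
  hence "int r dvd int p * int q * V" by simp
  hence "int r dvd 1" using V cong_dvd_iff by blast
  thus False using gt1 by simp
qed

text \<open>\<open>A\<close> and \<open>B\<close> invert \<open>r\<close> and \<open>q\<close> up to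
  the signs, and \<open>X\<close> inverts their product. With \<open>w_cong\<close> this relates the
  step of the walk to \<open>min A B * max A B\<close> up to sign.\<close>

lemma AB_cong: "[A * B = s * t * X] (mod int p)"
proof -
  have "[A * int r = s] (mod int p)" using s_eq by (auto simp: cong_iff_lin algebra_simps intro: exI[of _ "C - int r"])
  moreover have "[B * int q = t] (mod int p)" using t_eq by (auto simp: cong_iff_lin algebra_simps intro: exI[of _ "D - int q"])
  ultimately have "[A * int r * (B * int q) * X = s * t * X] (mod int p)" by (intro cong_mult cong_refl)
  moreover have "A * int r * (B * int q) * X = A * B * (int q * int r * X)" by simp
  moreover have "[A * B * (int q * int r * X) = A * B * 1] (mod int p)" by (intro cong_mult cong_refl X)
  ultimately show ?thesis by (metis cong_sym cong_trans mult.right_neutral)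
qed

lemma sum_G_le_3: "3 * (\<Sum>j<p. G (n0 - int j)) \<le> 2 * int p"
proof (cases "int p \<le> 3 * max A B \<or> 3 * (2 * min A B + max A B) \<le> 2 * int p")
  \<comment> \<open>Here one of the two earlier bounds is already at most \<open>2p/3\<close>; the
    walk is needed only in the other case.\<close>
  case True
  have "3 * S \<le> 2 * P" if "P \<le> 3 * M \<or> 3 * (2 * m + M) \<le> 2 * P" "S \<le> P - M" "S \<le> 2 * m + M" for S P M m :: int
    using that by auto
  from this[OF True sum_G_le_1 sum_G_le_2] show ?thesis .
next
  case False
  hence reg: "3 * max A B < int p" "2 * int p < 3 * (2 * min A B + max A B)" by auto
  have p4: "4 \<le> p" using reg(1) A B by linarith
  note W = walk[OF reg]
  have "min A B * max A B = A * B" by (simp add: min_def max_def)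
  hence "[w = min A B * max A B] (mod int p) \<or> [w = - (min A B * max A B)] (mod int p)"
  proof -
    have "s * t = 1 \<or> s * t = - 1" using s t by auto
    thus ?thesis
    proof
      assume "s * t = 1"
      hence "[- (A * B) = - X] (mod int p)" using AB_cong by (simp add: cong_minus_minus_iff)
      hence "[w = - (A * B)] (mod int p)" using w_cong by (metis cong_sym cong_trans)
      thus ?thesis by (simp add: \<open>min A B * max A B = A * B\<close>)
    next
      assume "s * t = - 1"
      hence "[A * B = - X] (mod int p)" using AB_cong by simp
      hence "[w = A * B] (mod int p)" using w_cong by (metis cong_sym cong_trans)
      thus ?thesis by (simp add: \<open>min A B * max A B = A * B\<close>)
    qed
  qed
  hence "walk.bounded p (min A B) (max A B) (of_int B) (of_int A) (\<lambda>j. x (n0 - int j)) (\<lambda>j. F (n0 - int j)) Y Z"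
    using \<eta>_not_multiple \<zeta>_not_multiple by (intro walk.bounded_if_moves[OF W moves[OF W]])
  moreover have "walk.P0 p (min A B) (\<lambda>j. x (n0 - int j)) (\<lambda>j. F (n0 - int j)) = Q0"
    unfolding walk.P0_def[OF W] Q0_def by simp
  moreover have "walk.P1 p (min A B) (of_int B) (of_int A) (\<lambda>j. x (n0 - int j)) (\<lambda>j. F (n0 - int j)) Y Z = Q1"
    unfolding walk.P1_def[OF W] Q1_def by (auto simp: Y_less_iff[OF p4] Z_less_iff[OF p4])
  moreover have "walk.P2 p (min A B) (max A B) (of_int B) (of_int A) (\<lambda>j. x (n0 - int j)) (\<lambda>j. F (n0 - int j)) Y Z = Q2"
    unfolding walk.P2_def[OF W] Q2_def by (auto simp: Y_less_iff[OF p4] Z_less_iff[OF p4] min_def max_def)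
  moreover have "walk.Neg p (min A B) (max A B) (of_int B) (of_int A) (\<lambda>j. x (n0 - int j)) (\<lambda>j. F (n0 - int j)) Y Z = QN"
    unfolding walk.Neg_def[OF W] QN_def by (auto simp: Y_less_iff[OF p4] Z_less_iff[OF p4] min_def max_def)
  ultimately have "3 * (card Q0 + card Q1 + card Q2) \<le> 2 * p + 3 * card QN"
    by (simp add: walk.bounded_def[OF W])
  thus ?thesis by (rule two_thirds_bound[OF _ sum_G_le])
qed

end

section \<open>Choice of the signs and the final bounds\<close>

lemma exists_complement:
  fixes p r A s :: int
  assumes "[A * r = s] (mod p)" "0 < A" "A < p" "s = 1 \<or> s = - 1" "1 < r"
  shows "\<exists>C. A * r + C * p = p * r + s \<and> 0 \<le> C \<and> C < r"
proof -
  obtain k where "A * r - s = p * k" using assms(1) by (auto simp: cong_iff_dvd_diff elim: dvdE)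
  hence eq: "A * r + (r - k) * p = p * r + s" by (simp add: algebra_simps)
  have "A * r \<le> (p - 1) * r" "1 * r \<le> A * r" using assms by (intro mult_right_mono; simp)+
  hence "A * r \<le> p * r - r" "r \<le> A * r" by (simp_all add: left_diff_distrib)
  moreover have "(r - k) * p = p * r + s - A * r" using eq by simp
  ultimately have "0 * p < (r - k) * p" "(r - k) * p < r * p"
    using assms(4,5) mult.commute[of r p] by linarith+
  moreover have "0 < p" using assms by simp
  ultimately have "0 < r - k" "r - k < r" by (simp_all only: mult_less_cancel_right_pos)
  thus ?thesis using eq by (intro exI[of _ "r - k"]) auto
qed

lemma signed_coeff_bounds:
  fixes p q r :: nat and s t A B n :: int
  assumes primes: "prime p" "prime q" "prime r" and less: "p < q" "q < r"
    and s: "s = 1 \<or> s = - 1" and t: "t = 1 \<or> t = - 1"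
    and A: "0 < A" "A < int p" "[A * int r = s] (mod int p)"
    and B: "0 < B" "B < int p" "[B * int q = t] (mod int p)"
    and AB: "A + B \<le> int p" and n: "n < int (p * q * r)"
  shows "s * t * cyclotomic_coeff (p * q * r) n \<le> int p - max A B"
    "s * t * cyclotomic_coeff (p * q * r) n \<le> 2 * min A B + max A B"
    "3 * (s * t * cyclotomic_coeff (p * q * r) n) \<le> 2 * int p"
proof -
  have gt1: "p > 1" "q > 1" "r > 1" using primes[THEN prime_gt_1_nat] .
  have cop: "coprime (int p) (int q)" "coprime (int p) (int r)" "coprime (int q) (int r)"
    using primes less by (auto intro!: primes_coprime)
  obtain X where X: "[int q * int r * X = 1] (mod int p)"
    using cong_solve_coprime_int[of "int q * int r" "int p"] cop by (auto simp: coprime_commute)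
  obtain U where U: "[int p * int r * U = 1] (mod int q)"
    using cong_solve_coprime_int[of "int p * int r" "int q"] cop by (auto simp: coprime_commute)
  obtain V where V: "[int p * int q * V = 1] (mod int r)"
    using cong_solve_coprime_int[of "int p * int q" "int r"] cop by (auto simp: coprime_commute)
  have T: "triple (int p) (int q) (int r) X U V" using gt1 cop X U V by unfold_locales simp_all
  obtain C where C: "A * int r + C * int p = int p * int r + s" "0 \<le> C" "C < int r"
    using exists_complement[OF A(3,1,2) s] gt1 by auto
  obtain D where D: "B * int q + D * int p = int p * int q + t" "0 \<le> D" "D < int q"
    using exists_complement[OF B(3,1,2) t] gt1 by auto
  \<comment> \<open>A negative sign turns the corresponding shift upwards, so the base point is
    lowered by it. The four arguments of \<open>chi\<close> are then \<open>n\<close>,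
    \<open>n - q\<close>, \<open>n - r\<close>, \<open>n - q - r\<close> in some order, all below
    \<open>p * q * r\<close>.\<close>
  define n0 where "n0 = n - (if s = t then if s = 1 then 0 else int q + int r else if s = 1 then int r else int q)"
  have range: "n0 < int p * int q * int r" "n0 - s * int q < int p * int q * int r"
      "n0 - t * int r < int p * int q * int r" "n0 - s * int q - t * int r < int p * int q * int r"
    using n s t unfolding n0_def by auto
  interpret window p q r X U V s t A B C D n0
    by (intro window.intro T window_axioms.intro primes less s t C D A(1,2) B(1,2) AB range)
  have "s * t * cyclotomic_coeff (p * q * r) n = (\<Sum>j<p. s * t * bdiff (int q) (bdiff (int r) chi) (n - int j))"
    using cyclotomic_coeff_window[OF primes _ _ _ T n] less by (simp add: sum_distrib_left)
  also have "\<dots> = (\<Sum>j<p. G (n0 - int j))"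
    using s t by (intro sum.cong refl) (auto simp: G_def bdiff_def n0_def algebra_simps)
  finally have eq: "s * t * cyclotomic_coeff (p * q * r) n = (\<Sum>j<p. G (n0 - int j))" .
  show "s * t * cyclotomic_coeff (p * q * r) n \<le> int p - max A B"
    "s * t * cyclotomic_coeff (p * q * r) n \<le> 2 * min A B + max A B"
    "3 * (s * t * cyclotomic_coeff (p * q * r) n) \<le> 2 * int p"
    unfolding eq by (fact sum_G_le_1 sum_G_le_2 sum_G_le_3)+
qed

text \<open>\<open>\<alpha> * max A B = A * B\<close>, and multiplying by \<open>q * r\<close> gives
  \<open>s * t\<close> modulo \<open>p\<close>. Cancelling the invertible
  \<open>\<alpha> * q * r\<close> leaves \<open>s * t * \<beta>\<close>.\<close>

lemma max_eq_of_product_cong: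
  fixes p :: nat and q r s t A B \<alpha> \<beta> :: int
  assumes \<alpha>: "\<alpha> = min A B" and \<beta>: "0 < \<beta>" "\<beta> < int p" "[\<alpha> * \<beta> * q * r = 1] (mod int p)"
    and A: "0 < A" "A < int p" "[A * r = s] (mod int p)" and B: "0 < B" "B < int p" "[B * q = t] (mod int p)"
    and st: "s * t = 1 \<or> s * t = - 1"
  shows "max A B = (if s * t = 1 then \<beta> else int p - \<beta>)"
proof -
  have "[\<alpha> * q * r * \<beta> = 1] (mod int p)" using \<beta>(3) by (simp add: mult_ac)
  hence cop: "coprime (\<alpha> * q * r) (int p)" unfolding coprime_iff_invertible_int by blast
  have "\<alpha> * max A B = A * B" by (simp add: \<alpha> min_def max_def)
  hence "\<alpha> * q * r * max A B = A * r * (B * q)" by (simp add: mult_ac)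
  also have "[A * r * (B * q) = s * t * 1] (mod int p)" using A(3) B(3) by (simp add: cong_mult)
  also have "[s * t * 1 = s * t * (\<alpha> * q * r * \<beta>)] (mod int p)"
    by (rule cong_mult[OF cong_refl cong_sym]) fact
  also have "s * t * (\<alpha> * q * r * \<beta>) = \<alpha> * q * r * (s * t * \<beta>)" by simp
  finally have cong: "[max A B = s * t * \<beta>] (mod int p)" by (simp only: cong_mult_lcancel[OF cop])
  have m: "0 \<le> max A B" "max A B < int p" using A B by auto
  show ?thesis
  proof (cases "s * t = 1")
    case True
    hence "max A B = \<beta>" using cong m \<beta> by (intro cong_less_imp_eq_int) auto
    thus ?thesis using True by simp
  next
    case False
    hence "[max A B = - \<beta>] (mod int p)" using cong st by simp
    hence "[max A B = int p - \<beta>] (mod int p)" by (simp add: cong_def)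
    hence "max A B = int p - \<beta>" using m \<beta> by (intro cong_less_imp_eq_int) auto
    thus ?thesis using False by simp
  qed
qed

theorem theorem4p1:
  fixes p q r :: nat and \<alpha> \<beta> i :: int
  assumes "prime p" and "prime q" and "prime r"
    and "p < q" and "q < r"
    and "\<alpha> = Min {modular_inverse (int p) (int q), int p - modular_inverse (int p) (int q),
                  modular_inverse (int p) (int r), int p - modular_inverse (int p) (int r)}"
    and "0 < \<beta>" and "\<beta> \<le> int p - 1"
    and "[\<alpha> * \<beta> * int q * int r = 1] (mod int p)"
  shows "real_of_int (cyclotomic_coeff (p * q * r) i) \<le>
           Min {real_of_int (2 * \<alpha> + \<beta>), real_of_int (int p - \<beta>), 2 * real p / 3} \<and>
         - real_of_int (cyclotomic_coeff (p * q * r) i) \<le>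
           Min {real_of_int (int p + 2 * \<alpha> - \<beta>), real_of_int \<beta>, 2 * real p / 3}"
proof -
  define Q where "Q = modular_inverse (int p) (int q)"
  define R where "R = modular_inverse (int p) (int r)"
  have Q: "0 < Q" "Q < int p" "[Q * int q = 1] (mod int p)"
    and R: "0 < R" "R < int p" "[R * int r = 1] (mod int p)"
    using modular_inverse_prime_unique(1)[of p q] modular_inverse_prime_unique(1)[of p r] assms(1-5)
    by (simp_all add: Q_def R_def mult.commute)
  have neg: "0 < int p - v \<and> int p - v < int p \<and> [(int p - v) * u = - 1] (mod int p)"
    if "0 < v" "v < int p" "[v * u = 1] (mod int p)" for u v
  proof -
    have "(int p - v) * u = - (v * u) + int p * u" by (simp add: algebra_simps)
    hence "[(int p - v) * u = - (v * u)] (mod int p)" by (simp only: cong_def mod_mult_self2)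
    also have "[- (v * u) = - 1] (mod int p)" using that(3) by (simp only: cong_minus_minus_iff)
    finally show ?thesis using that by simp
  qed
  have \<alpha>: "\<alpha> = min Q (min (int p - Q) (min R (int p - R)))"
    unfolding assms(6) Q_def[symmetric] R_def[symmetric] by (simp only: Min_insert Min_singleton finite.intros insert_not_empty not_False_eq_True)
  define c where "c = cyclotomic_coeff (p * q * r)"
  have bounds: "s * t * c n \<le> int p - b \<and> s * t * c n \<le> 2 * \<alpha> + b \<and> 3 * (s * t * c n) \<le> 2 * int p"
    if "s = 1 \<or> s = - 1" "t = 1 \<or> t = - 1" "0 < A" "A < int p" "[A * int r = s] (mod int p)"
      "0 < B" "B < int p" "[B * int q = t] (mod int p)" "A + B \<le> int p" "\<alpha> = min A B" "n < int (p * q * r)"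
      "b = (if s * t = 1 then \<beta> else int p - \<beta>)"
    for s t A B n b
  proof -
    have "max A B = b" unfolding that(12)
      by (rule max_eq_of_product_cong[OF that(10) assms(7) _ assms(9) that(3-8)]) (use assms(8) that(1,2) in auto)
    thus ?thesis using signed_coeff_bounds[OF assms(1-5) that(1-9,11)] that(10) unfolding c_def by simp
  qed
  have below: "(c n \<le> int p - \<beta> \<and> c n \<le> 2 * \<alpha> + \<beta> \<and> 3 * c n \<le> 2 * int p) \<and>
    (- c n \<le> \<beta> \<and> - c n \<le> 2 * \<alpha> + (int p - \<beta>) \<and> 3 * - c n \<le> 2 * int p)"
    if n: "n < int (p * q * r)" for n
  proof
    \<comment> \<open>Equal signs: the candidates are \<open>(R, Q)\<close> and the pair of their
      complements, one of which has sum at most \<open>p\<close>. For it \<open>A <= p - B\<close>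
      and \<open>B <= p - A\<close>, so the minimum over all four numbers is
      \<open>min A B\<close>.\<close>
    show "c n \<le> int p - \<beta> \<and> c n \<le> 2 * \<alpha> + \<beta> \<and> 3 * c n \<le> 2 * int p"
    proof (cases "R + Q \<le> int p")
      case True
      hence "\<alpha> = min R Q" by (auto simp: \<alpha> min_def min_complement_cases)
      thus ?thesis using bounds[of 1 1 R Q n \<beta>] Q R n True by auto
    next
      case False
      hence "\<alpha> = min (int p - R) (int p - Q)" by (auto simp: \<alpha> min_def min_complement_cases)
      thus ?thesis using bounds[of "- 1" "- 1" "int p - R" "int p - Q" n \<beta>] neg[OF Q] neg[OF R] n False by auto
    qed
    \<comment> \<open>Opposite signs: exactly one of the two residues is complemented, and the
      condition \<open>A + B <= p\<close> becomes a comparison of \<open>R\<close> with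
      \<open>Q\<close>.\<close>
    show "- c n \<le> \<beta> \<and> - c n \<le> 2 * \<alpha> + (int p - \<beta>) \<and> 3 * - c n \<le> 2 * int p"
    proof (cases "R \<le> Q")
      case True
      hence "\<alpha> = min R (int p - Q)" by (auto simp: \<alpha> min_def min_complement_cases)
      thus ?thesis using bounds[of 1 "- 1" R "int p - Q" n "int p - \<beta>"] neg[OF Q] R n True by auto
    next
      case False
      hence "\<alpha> = min (int p - R) Q" by (auto simp: \<alpha> min_def min_complement_cases)
      thus ?thesis using bounds[of "- 1" 1 "int p - R" Q n "int p - \<beta>"] Q neg[OF R] n False by auto
    qed
  qed
  have gt1: "p > 1" "q > 1" "r > 1" using assms(1-3)[THEN prime_gt_1_nat] .
  \<comment> \<open>The window formula needs an index below \<open>p * q * r\<close>. Beyond that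
    the coefficient vanishes, so the index -1 can stand in.\<close>
  have "\<exists>n < int (p * q * r). c i = c n"
  proof (cases "i < int (p * q * r)")
    case False
    have "1 < p * q * r" using gt1 by (metis less_1_mult)
    hence "p * q * r > 0" "int (totient (p * q * r)) < i"
      using False totient_less[of "p * q * r"] by linarith+
    hence "c i = 0" unfolding c_def by (intro cyclotomic_coeff_outside disjI2)
    moreover have "c (- 1) = 0" by (simp add: c_def cyclotomic_coeff_def)
    moreover have "- 1 < int (p * q * r)" by linarith
    ultimately show ?thesis by metis
  qed auto
  then obtain n where "n < int (p * q * r)" "c i = c n" by blast
  with below[of n] have b: "c i \<le> int p - \<beta>" "c i \<le> 2 * \<alpha> + \<beta>" "3 * c i \<le> 2 * int p"
    "- c i \<le> \<beta>" "- c i \<le> 2 * \<alpha> + (int p - \<beta>)" "3 * - c i \<le> 2 * int p" by auto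
  have "real_of_int (c i) \<le> real_of_int (int p - \<beta>)" "real_of_int (c i) \<le> real_of_int (2 * \<alpha> + \<beta>)"
    "- real_of_int (c i) \<le> real_of_int \<beta>" "- real_of_int (c i) \<le> real_of_int (int p + 2 * \<alpha> - \<beta>)"
    "real_of_int (c i) \<le> 2 * real p / 3" "- real_of_int (c i) \<le> 2 * real p / 3"
    using b by linarith+
  thus ?thesis unfolding c_def by simp
qed

end
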